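(* A matroid is a $3$-connected binary $(2,2)$-uniform matroid if and only if it is a $3$-connected minor of one of $Z_5\backslash t$, $P_{10}$, $AG(4,2)$, or $AG(4,2)^*$.
   Context: A matroid is $(2,2)$-uniform if it has no minor isomorphic to $U_{2,2}\oplus U_{0,2}$. For $r\ge 3$, the rank-$r$ binary spike $Z_r$ is the vector matroid over $GF(2)$ of the $r\times(2r+1)$ matrix $[I_r \mid J_r-I_r \mid \mathbf{1}]$, where $J_r$ is the all-ones $r\times r$ matrix and the last column, the all-ones vector, is the tip $t$; $Z_5\backslash t$ is the deletion of the tip from $Z_5$. $AG(4,2)$ is the rank-$5$ binary affine geometry (the $16$ points of $PG(4,2)$ off a hyperplane). $P_{10}$ is the rank-$5$ binary matroid on $\{1,\dots,10\}$ represented over $GF(2)$ by the matrix with columns $1,\dots,10$ and rows $(1,0,0,0,0,1,0,0,1,1)$, $(0,1,0,0,0,1,1,0,0,1)$, $(0,0,1,0,0,0,1,1,0,1)$, $(0,0,0,1,0,0,0,1,1,0)$, $(0,0,0,0,1,1,1,1,0,0)$. *)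

theory Defs
  imports Main "HOL-Library.Z2"
begin

type_synonym 'a matroid = "'a set \<times> ('a set \<Rightarrow> bool)"

definition ground :: "'a matroid \<Rightarrow> 'a set" where "ground M = fst M"
definition indep :: "'a matroid \<Rightarrow> 'a set \<Rightarrow> bool" where "indep M = snd M"

definition matroid :: "'a matroid \<Rightarrow> bool" where
  "matroid M \<longleftrightarrow> finite (ground M)
     \<and> (\<forall>X. indep M X \<longrightarrow> X \<subseteq> ground M)
     \<and> indep M {}
     \<and> (\<forall>X Y. indep M Y \<and> X \<subseteq> Y \<longrightarrow> indep M X)
     \<and> (\<forall>X Y. indep M X \<and> indep M Y \<and> card X < card Y \<longrightarrow>
            (\<exists>e \<in> Y - X. indep M (insert e X)))"

definition rk :: "'a matroid \<Rightarrow> 'a set \<Rightarrow> nat" where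
  "rk M X = Max (card ` {I. I \<subseteq> X \<and> indep M I})"

definition basis :: "'a matroid \<Rightarrow> 'a set \<Rightarrow> bool" where
  "basis M B \<longleftrightarrow> indep M B \<and> (\<forall>X. indep M X \<and> B \<subseteq> X \<longrightarrow> X = B)"

definition delete :: "'a matroid \<Rightarrow> 'a set \<Rightarrow> 'a matroid" where
  "delete M D = (ground M - D, \<lambda>X. indep M X \<and> X \<inter> D = {})"

definition contract :: "'a matroid \<Rightarrow> 'a set \<Rightarrow> 'a matroid" where
  "contract M C = (ground M - C,
      \<lambda>X. X \<subseteq> ground M - C \<and> rk M (X \<union> C) = card X + rk M C)"

definition is_minor :: "'a matroid \<Rightarrow> 'a matroid \<Rightarrow> bool" where
  "is_minor N M \<longleftrightarrow> (\<exists>C D. C \<subseteq> ground M \<and> D \<subseteq> ground M \<and> C \<inter> D = {}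
        \<and> N = delete (contract M C) D)"

definition dual :: "'a matroid \<Rightarrow> 'a matroid" where
  "dual M = (ground M, \<lambda>X. X \<subseteq> ground M \<and> (\<exists>B. basis M B \<and> X \<subseteq> ground M - B))"

definition iso :: "'a matroid \<Rightarrow> 'b matroid \<Rightarrow> bool" where
  "iso M N \<longleftrightarrow> (\<exists>f. bij_betw f (ground M) (ground N)
       \<and> (\<forall>X \<subseteq> ground M. indep M X \<longleftrightarrow> indep N (f ` X)))"

definition has_minor_iso :: "'b matroid \<Rightarrow> 'a matroid \<Rightarrow> bool" where
  "has_minor_iso N M \<longleftrightarrow> (\<exists>N'. is_minor N' N \<and> iso M N')"

definition uniform :: "nat \<Rightarrow> nat \<Rightarrow> nat matroid" where
  "uniform r n = ({..<n}, \<lambda>X. X \<subseteq> {..<n} \<and> card X \<le> r)"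

definition direct_sum :: "'a matroid \<Rightarrow> 'b matroid \<Rightarrow> ('a + 'b) matroid" where
  "direct_sum M N = (Inl ` ground M \<union> Inr ` ground N,
     \<lambda>X. X \<subseteq> Inl ` ground M \<union> Inr ` ground N
        \<and> indep M (Inl -` X) \<and> indep N (Inr -` X))"

definition two_two_uniform :: "'a matroid \<Rightarrow> bool" where
  "two_two_uniform M \<longleftrightarrow> \<not> has_minor_iso M (direct_sum (uniform 2 2) (uniform 0 2))"

definition k_separation :: "'a matroid \<Rightarrow> nat \<Rightarrow> 'a set \<Rightarrow> bool" where
  "k_separation M k X \<longleftrightarrow> X \<subseteq> ground M \<and> card X \<ge> k \<and> card (ground M - X) \<ge> k
      \<and> rk M X + rk M (ground M - X) < rk M (ground M) + k"

definition three_connected :: "'a matroid \<Rightarrow> bool" where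
  "three_connected M \<longleftrightarrow> (\<forall>k X. k < 3 \<and> k \<ge> 1 \<longrightarrow> \<not> k_separation M k X)"

definition gf2_indep :: "('a \<Rightarrow> nat \<Rightarrow> bit) \<Rightarrow> 'a set \<Rightarrow> bool" where
  "gf2_indep v X \<longleftrightarrow> (\<forall>c :: 'a \<Rightarrow> bit.
      (\<forall>i. (\<Sum>x\<in>X. c x * v x i) = 0) \<longrightarrow> (\<forall>x\<in>X. c x = 0))"

definition vec_matroid :: "'a set \<Rightarrow> ('a \<Rightarrow> nat \<Rightarrow> bit) \<Rightarrow> 'a matroid" where
  "vec_matroid E v = (E, \<lambda>X. X \<subseteq> E \<and> gf2_indep v X)"

definition binary :: "'a matroid \<Rightarrow> bool" where
  "binary M \<longleftrightarrow> (\<exists>v. M = vec_matroid (ground M) v)"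

text \<open>Rank-r binary spike: columns 0..r-1 = I_r, r..2r-1 = J_r - I_r, column 2r = tip (all ones).
  Rows indexed by 0..r-1.\<close>
definition spike_col :: "nat \<Rightarrow> nat \<Rightarrow> nat \<Rightarrow> bit" where
  "spike_col r j i = (if i < r then
       (if j < r then of_bool (i = j)
        else if j < 2*r then of_bool (i \<noteq> j - r)
        else 1)
     else 0)"

definition binary_spike :: "nat \<Rightarrow> nat matroid" where
  "binary_spike r = vec_matroid {..<2*r+1} (spike_col r)"

definition spike_tip :: "nat \<Rightarrow> nat" where "spike_tip r = 2*r"

definition Z5_del_t :: "nat matroid" where
  "Z5_del_t = delete (binary_spike 5) {spike_tip 5}"

definition P10_rows :: "nat list list" where
  "P10_rows = [[1,0,0,0,0,1,0,0,1,1],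
               [0,1,0,0,0,1,1,0,0,1],
               [0,0,1,0,0,0,1,1,0,1],
               [0,0,0,1,0,0,0,1,1,0],
               [0,0,0,0,1,1,1,1,0,0]]"

definition P10_col :: "nat \<Rightarrow> nat \<Rightarrow> bit" where
  "P10_col j i = (if i < 5 \<and> 1 \<le> j \<and> j \<le> 10 then of_nat (P10_rows ! i ! (j - 1)) else 0)"

definition P10 :: "nat matroid" where
  "P10 = vec_matroid {1..10} P10_col"

text \<open>AG(4,2): points of PG(4,2) off the hyperplane x_4 = 0; point k < 16 has
  coordinates (bits of k, 1).\<close>
definition AG42_col :: "nat \<Rightarrow> nat \<Rightarrow> bit" where
  "AG42_col k i = (if i < 4 then of_bool (odd (k div 2 ^ i)) else if i = 4 then 1 else 0)"

definition AG42 :: "nat matroid" where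
  "AG42 = vec_matroid {..<16} AG42_col"

end

theory Submission
  imports Defs "HOL-Library.Function_Algebras"
begin

text \<open>
  Call a set \<open>X\<close> crowded if it has nullity and corank at least 2; a matroid is
  (2,2)-uniform iff it has no crowded set, a condition that is self-dual and closed under minors.
  For a simple binary matroid of rank at most 4 nothing more is needed: it is a restriction of
  \<open>PG(3,2) = AG(4,2)/p\<close>. In rank 5 being uncrowded means, for simple matroids, that
  distinct triangles are disjoint. If such a point set contains a triangle \<open>T\<close>, each of the 7
  nonzero cosets of the line spanned by \<open>T\<close> contains at most one point, so there are at most 10 points; in
  the extremal case the set is described by four vectors of \<open>GF(2)\<^sup>2\<close>, and one finds \<open>P\<^sub>1\<^sub>0\<close>
  unless the set fails to be cosimple or its dual is affine. If it is a cap containing a 5-circuit,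
  the other points differ by pairwise intersecting pairs of circuit elements, which again
  bounds the size by 10 and leaves \<open>Z\<^sub>5\<setminus>t\<close> as the only extremal case. Every other simple uncrowded
  matroid of rank 5 with at least 10 points is affine, i.e. a restriction of \<open>AG(4,2)\<close>. In particular rank 5 and corank at least 6 forces affineness;
  when rank and corank are both at least 6, applying this to all contractions to rank 5 gives a
  contradiction, and the remaining cases follow by duality.
\<close>

section \<open>Rank\<close>

text \<open>From four elements on, 3-connectivity is used only as simplicity of \<open>M\<close> and
  of its dual. Below that, \<open>U_{1,2}\<close> is 3-connected but neither simple nor cosimple,
  and it is exhibited as a minor by hand. The threshold 10 is 3 + 7 when there is a triangle and 5 +
  5 for a cap on a 5-circuit; it is also the number of elements when rank and corank are both 5. So
  a simple uncrowded non-affine matroid of rank 5 and corank at least 5 has corank exactly 5. The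
  obstacle at large rank and corank is that contraction destroys simplicity. Hence affineness in
  rank 5 is stated for all uncrowded binary matroids on at least 11 elements, with simplicity
  recovered by counting. Linear algebra over GF(2) is done by counting subset sums: a coefficient
  vector is a subset, and a rank is the logarithm of the number of sums. Exchange, uniqueness of
  coordinates and injectivity of linear maps all become comparisons of cardinalities.\<close>

lemma matroidD:
  assumes "matroid M"
  shows matroid_finite: "finite (ground M)"
    and indep_ground: "indep M X \<Longrightarrow> X \<subseteq> ground M"
    and indep_empty: "indep M {}"
    and indep_mono: "indep M Y \<Longrightarrow> X \<subseteq> Y \<Longrightarrow> indep M X"
    and indep_augment: "indep M X \<Longrightarrow> indep M Y \<Longrightarrow> card X < card Y \<Longrightarrow> \<exists>e \<in> Y - X. indep M (insert e X)"
  using assms unfolding matroid_def by blast+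

lemma indep_finite: "matroid M \<Longrightarrow> indep M X \<Longrightarrow> finite X"
  using matroidD(1,2) finite_subset by metis

lemma finite_indeps: "matroid M \<Longrightarrow> finite {I. I \<subseteq> X \<and> indep M I}"
  by (rule finite_subset[of _ "Pow (ground M)"]) (auto dest: matroidD)

lemma card_le_rk: "matroid M \<Longrightarrow> indep M I \<Longrightarrow> I \<subseteq> X \<Longrightarrow> card I \<le> rk M X"
  unfolding rk_def by (rule Max_ge) (auto simp: finite_indeps)

lemma rk_attained:
  assumes "matroid M"
  obtains I where "I \<subseteq> X" "indep M I" "card I = rk M X"
proof -
  have "Max (card ` {I. I \<subseteq> X \<and> indep M I}) \<in> card ` {I. I \<subseteq> X \<and> indep M I}"
    by (rule Max_in) (use assms finite_indeps[OF assms] indep_empty[OF assms] in auto)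
  then show ?thesis using that unfolding rk_def by auto
qed

lemma rk_leI: "matroid M \<Longrightarrow> (\<And>I. I \<subseteq> X \<Longrightarrow> indep M I \<Longrightarrow> card I \<le> k) \<Longrightarrow> rk M X \<le> k"
  by (metis rk_attained)

lemma rk_mono: "matroid M \<Longrightarrow> X \<subseteq> Y \<Longrightarrow> rk M X \<le> rk M Y"
  by (rule rk_leI) (auto intro: card_le_rk)

lemma rk_le_card: "matroid M \<Longrightarrow> finite X \<Longrightarrow> rk M X \<le> card X"
  by (rule rk_leI) (auto intro: card_mono)

lemma rk_indep: "matroid M \<Longrightarrow> indep M I \<Longrightarrow> rk M I = card I"
  by (metis card_le_rk indep_finite le_antisym order_refl rk_le_card)

lemma indep_iff_rk: "matroid M \<Longrightarrow> X \<subseteq> ground M \<Longrightarrow> indep M X \<longleftrightarrow> rk M X = card X"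
  by (metis card_subset_eq finite_subset matroid_finite rk_attained rk_indep)

lemma rk_empty: "matroid M \<Longrightarrow> rk M {} = 0"
  using rk_indep indep_empty by fastforce

lemma extend_to_basis_of:
  assumes M: "matroid M" and "indep M I" "I \<subseteq> X"
  obtains J where "I \<subseteq> J" "J \<subseteq> X" "indep M J" "card J = rk M X"
proof -
  have "\<exists>J. I \<subseteq> J \<and> J \<subseteq> X \<and> indep M J \<and> card J = rk M X"
    using assms(2,3)
  proof (induction "rk M X - card I" arbitrary: I rule: less_induct)
    case less
    show ?case
    proof (cases "card I = rk M X")
      case True then show ?thesis using less by blast
    next
      case False
      then have lt: "card I < rk M X" using card_le_rk[OF M] less by (simp add: le_neq_implies_less)
      obtain K where K: "K \<subseteq> X" "indep M K" "card K = rk M X" by (rule rk_attained[OF M])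
      then obtain e where e: "e \<in> K - I" "indep M (insert e I)"
        using indep_augment[OF M less(2) K(2)] lt by auto
      have "card (insert e I) = Suc (card I)" using e indep_finite[OF M less(2)] by simp
      then have "rk M X - card (insert e I) < rk M X - card I" using lt by simp
      moreover have "insert e I \<subseteq> X" using e K less(3) by blast
      ultimately obtain J where "insert e I \<subseteq> J" "J \<subseteq> X" "indep M J" "card J = rk M X"
        using less(1)[of "insert e I"] e(2) by metis
      then show ?thesis by (intro exI[of _ J]) auto
    qed
  qed
  then show ?thesis using that by blast
qed

lemma basis_of_maximal:
  assumes "matroid M" "indep M J" "J \<subseteq> X" "card J = rk M X" "e \<in> X - J"
  shows "\<not> indep M (insert e J)"
  using card_le_rk[of M "insert e J" X] assms indep_finite[of M J] by auto

lemma basis_of_Int: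
  assumes M: "matroid M" and J: "indep M J" "J \<subseteq> X" "card J = rk M X" and B: "indep M B" "J \<subseteq> B"
  shows "B \<inter> X = J"
proof (rule antisym; rule subsetI)
  fix e assume "e \<in> B \<inter> X"
  moreover from this have "indep M (insert e J)" using indep_mono[OF M B(1)] B(2) by simp
  ultimately show "e \<in> J" using basis_of_maximal[OF M J, of e] by blast
qed (use J B in auto)

lemma rk_Un_le:
  assumes "matroid M" "finite Y"
  shows "rk M (X \<union> Y) \<le> rk M X + card Y"
proof (rule rk_leI[OF assms(1)])
  fix I assume I: "I \<subseteq> X \<union> Y" "indep M I"
  have "card I \<le> card (I \<inter> X) + card (I \<inter> Y)"
    by (metis I(1) card_Un_le inf.absorb_iff1 inf_sup_distrib1)
  also have "\<dots> \<le> rk M X + card Y"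
    using I assms by (intro add_mono card_le_rk card_mono)
      (auto intro: indep_mono[OF assms(1) I(2)])
  finally show "card I \<le> rk M X + card Y" .
qed

lemma basis_iff:
  assumes "matroid M"
  shows "basis M B \<longleftrightarrow> indep M B \<and> card B = rk M (ground M)"
proof
  assume "basis M B"
  then have B: "indep M B" "\<And>X. indep M X \<Longrightarrow> B \<subseteq> X \<Longrightarrow> X = B" unfolding basis_def by auto
  obtain J where "B \<subseteq> J" "indep M J" "card J = rk M (ground M)"
    using extend_to_basis_of[OF assms B(1)] indep_ground[OF assms B(1)] by metis
  then show "indep M B \<and> card B = rk M (ground M)" using B by auto
next
  assume B: "indep M B \<and> card B = rk M (ground M)"
  show "basis M B" unfolding basis_def
  proof (intro conjI allI impI)
    fix X assume X: "indep M X \<and> B \<subseteq> X"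
    then have "card X \<le> card B" using card_le_rk[OF assms, of X] B indep_ground[OF assms] by metis
    then show "X = B" using X indep_finite[OF assms, of X] by (metis card_seteq)
  qed (use B in auto)
qed

section \<open>Duality and minors\<close>

lemma ground_simps[simp]:
  "ground (dual M) = ground M" "ground (delete M D) = ground M - D" "ground (contract M C) = ground M - C"
  by (auto simp: ground_def dual_def delete_def contract_def)

lemma matroid_eqI: "ground M = ground N \<Longrightarrow> (\<And>X. indep M X \<longleftrightarrow> indep N X) \<Longrightarrow> M = N"
  unfolding ground_def indep_def by (simp add: prod_eq_iff fun_eq_iff)

lemma indep_delete: "indep (delete M D) X \<longleftrightarrow> indep M X \<and> X \<inter> D = {}"
  by (simp add: indep_def delete_def)

lemma indep_contract_rk:
  "indep (contract M C) X \<longleftrightarrow> X \<subseteq> ground M - C \<and> rk M (X \<union> C) = card X + rk M C"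
  by (simp add: indep_def contract_def)

lemma indep_dual:
  assumes "matroid M"
  shows "indep (dual M) X \<longleftrightarrow> X \<subseteq> ground M \<and> rk M (ground M - X) = rk M (ground M)"
proof -
  have "(\<exists>B. basis M B \<and> X \<subseteq> ground M - B) \<longleftrightarrow> rk M (ground M - X) = rk M (ground M)"
    if "X \<subseteq> ground M"
  proof
    assume "\<exists>B. basis M B \<and> X \<subseteq> ground M - B"
    then obtain B where B: "basis M B" "X \<subseteq> ground M - B" by blast
    then have "indep M B" "card B = rk M (ground M)" "B \<subseteq> ground M - X"
      using basis_iff[OF assms] indep_ground[OF assms] by blast+
    then show "rk M (ground M - X) = rk M (ground M)"
      using card_le_rk[OF assms] rk_mono[OF assms] by (metis Diff_subset le_antisym)
  next
    assume "rk M (ground M - X) = rk M (ground M)"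
    then obtain B where "B \<subseteq> ground M - X" "indep M B" "card B = rk M (ground M)"
      using rk_attained[OF assms] by metis
    then show "\<exists>B. basis M B \<and> X \<subseteq> ground M - B" using basis_iff[OF assms] that by blast
  qed
  then show ?thesis unfolding indep_def dual_def ground_def by auto
qed

text \<open>Fixing one basis \<open>I\<close> of \<open>C\<close> turns the rank condition that
  defines contraction into plain independence in \<open>M\<close>, from which the matroid axioms of
  the contraction can be inherited.\<close>

lemma indep_contract:
  assumes M: "matroid M" and I: "indep M I" "I \<subseteq> C" "card I = rk M C"
  shows "indep (contract M C) X \<longleftrightarrow> X \<subseteq> ground M - C \<and> indep M (X \<union> I)"
proof -
  have "rk M (X \<union> C) = card X + rk M C \<longleftrightarrow> indep M (X \<union> I)" if X: "X \<subseteq> ground M - C"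
  proof -
    have fin: "finite X" "finite I" using X I matroid_finite[OF M] indep_finite[OF M]
      by (auto intro: finite_subset)
    have card: "card (X \<union> I) = card X + rk M C"
      using X I fin by (subst card_Un_disjoint) auto
    show ?thesis
    proof
      assume r: "rk M (X \<union> C) = card X + rk M C"
      obtain J where J: "I \<subseteq> J" "J \<subseteq> X \<union> C" "indep M J" "card J = rk M (X \<union> C)"
        using extend_to_basis_of[OF M I(1), of "X \<union> C"] I by blast
      have "J \<inter> C = I"
        by (rule basis_of_Int[OF M I J(3,1)])
      then have "J \<subseteq> X \<union> I" using J by auto
      then have "J = X \<union> I" using card_subset_eq[of "X \<union> I" J] fin J card r by simp
      then show "indep M (X \<union> I)" using J by simp
    next
      assume "indep M (X \<union> I)"
      then have "card X + rk M C \<le> rk M (X \<union> C)"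
        using card_le_rk[OF M, of "X \<union> I" "X \<union> C"] card I by auto
      moreover have "rk M (C \<union> X) \<le> rk M C + card X" by (rule rk_Un_le[OF M fin(1)])
      ultimately show "rk M (X \<union> C) = card X + rk M C" by (simp add: Un_commute)
    qed
  qed
  then show ?thesis by (auto simp: indep_contract_rk)
qed

lemma matroid_delete: "matroid M \<Longrightarrow> matroid (delete M D)"
proof -
  assume M: "matroid M"
  show ?thesis unfolding matroid_def indep_delete ground_simps
  proof (intro conjI allI impI)
    fix X Y assume XY: "(indep M X \<and> X \<inter> D = {}) \<and> (indep M Y \<and> Y \<inter> D = {}) \<and> card X < card Y"
    then obtain e where "e \<in> Y - X" "indep M (insert e X)" using indep_augment[OF M] by meson
    then show "\<exists>e\<in>Y - X. indep M (insert e X) \<and> insert e X \<inter> D = {}" using XY by (intro bexI[of _ e]) auto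
  qed (use matroid_finite[OF M] indep_ground[OF M] indep_empty[OF M] indep_mono[OF M] in auto)
qed

lemma matroid_contract:
  assumes M: "matroid M"
  shows "matroid (contract M C)"
proof -
  obtain I where I: "I \<subseteq> C" "indep M I" "card I = rk M C" by (rule rk_attained[OF M])
  note ic = indep_contract[OF M I(2,1,3)]
  show ?thesis unfolding matroid_def
  proof (intro conjI allI impI)
    show "finite (ground (contract M C))" using matroid_finite[OF M] by simp
    show "indep (contract M C) {}" using I by (simp add: ic)
    fix X assume "indep (contract M C) X"
    then show "X \<subseteq> ground (contract M C)" by (simp add: ic)
  next
    fix X Y assume "indep (contract M C) Y \<and> X \<subseteq> Y"
    then show "indep (contract M C) X"
      using indep_mono[OF M, of "Y \<union> I" "X \<union> I"] unfolding ic by blast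
  next
    fix X Y assume XY: "indep (contract M C) X \<and> indep (contract M C) Y \<and> card X < card Y"
    then have i: "indep M (X \<union> I)" "indep M (Y \<union> I)" "X \<subseteq> ground M - C" "Y \<subseteq> ground M - C" by (auto simp: ic)
    have "card (Z \<union> I) = card Z + card I" if "Z \<subseteq> ground M - C" "indep M (Z \<union> I)" for Z
      using that I indep_finite[OF M that(2)] by (subst card_Un_disjoint) auto
    then have "card (X \<union> I) < card (Y \<union> I)" using XY i by simp
    from indep_augment[OF M i(1,2) this] obtain e where "e \<in> (Y \<union> I) - (X \<union> I)" "indep M (insert e (X \<union> I))" by blast
    then show "\<exists>e\<in>Y - X. indep (contract M C) (insert e X)" using i by (intro bexI[of _ e]) (auto simp: ic)
  qed
qed

lemma rk_delete: "X \<inter> D = {} \<Longrightarrow> rk (delete M D) X = rk M X"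
  unfolding rk_def indep_delete by (rule arg_cong[where f = "\<lambda>S. Max (card ` S)"]) auto

lemma rk_contract:
  assumes M: "matroid M" and X: "X \<subseteq> ground M - C"
  shows "rk (contract M C) X + rk M C = rk M (X \<union> C)"
proof -
  obtain I where I: "I \<subseteq> C" "indep M I" "card I = rk M C" by (rule rk_attained[OF M])
  note N = matroid_contract[OF M, of C]
  obtain K where K: "K \<subseteq> X" "indep (contract M C) K" "card K = rk (contract M C) X" by (rule rk_attained[OF N])
  have le: "rk (contract M C) X + rk M C \<le> rk M (X \<union> C)"
    using K rk_mono[OF M, of "K \<union> C" "X \<union> C"] by (auto simp: indep_contract_rk)
  obtain J where J: "I \<subseteq> J" "J \<subseteq> X \<union> C" "indep M J" "card J = rk M (X \<union> C)"
    using extend_to_basis_of[OF M I(2), of "X \<union> C"] I by blast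
  have JC: "J \<inter> C = I"
    by (rule basis_of_Int[OF M I(2,1,3) J(3,1)])
  have "(J - I) \<union> I = J" using J by auto
  then have "indep (contract M C) (J - I)"
    using J X JC by (auto simp: indep_contract[OF M I(2,1,3)])
  then have "card (J - I) \<le> rk (contract M C) X" by (rule card_le_rk[OF N]) (use J JC in auto)
  moreover have "card J = card (J - I) + card I"
    using J(1) indep_finite[OF M J(3)] by (metis card_Diff_subset card_mono finite_subset le_add_diff_inverse2)
  ultimately show ?thesis using le J I by simp
qed

text \<open>A basis of the complement of \<open>X\<close> extends to a basis \<open>B\<close> of
  \<open>M\<close> avoiding \<open>I\<close>, since \<open>I\<close> is coindependent; then
  \<open>X - B\<close> is the required set. Both augmentation in the dual and the dual rank formula
  rest on this.\<close>

lemma rk_dual_aux: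
  assumes M: "matroid M" and I: "indep (dual M) I" and IX: "I \<subseteq> X" and X: "X \<subseteq> ground M"
  obtains J where "I \<subseteq> J" "J \<subseteq> X" "indep (dual M) J"
    "card J + rk M (ground M) = card X + rk M (ground M - X)"
proof -
  let ?E = "ground M"
  obtain K where K: "K \<subseteq> ?E - X" "indep M K" "card K = rk M (?E - X)" by (rule rk_attained[OF M])
  obtain B where B: "K \<subseteq> B" "B \<subseteq> ?E - I" "indep M B" "card B = rk M (?E - I)"
    using extend_to_basis_of[OF M K(2), of "?E - I"] K IX by blast
  have rB: "card B = rk M ?E" using I B by (simp add: indep_dual[OF M])
  have fX: "finite X" "finite B" using X matroid_finite[OF M] finite_subset indep_finite[OF M B(3)] by auto
  have "B - X = K"
    using basis_of_Int[OF M K(2,1,3) B(3,1)] indep_ground[OF M B(3)] by blast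
  then have c1: "card B = card K + card (B \<inter> X)" using card_Int_Diff[OF fX(2), of X] by simp
  have c2: "card X = card (X - B) + card (B \<inter> X)" using card_Int_Diff[OF fX(1), of B] by (simp add: Int_commute)
  have "B \<subseteq> ?E - (X - B)" using B by auto
  then have "rk M (?E - (X - B)) = rk M ?E"
    using card_le_rk[OF M B(3), of "?E - (X - B)"] rB rk_mono[OF M, of "?E - (X - B)" ?E] by simp
  then have "indep (dual M) (X - B)" using X by (auto simp: indep_dual[OF M])
  moreover have "card (X - B) + rk M ?E = card X + rk M (?E - X)" using c1 c2 rB K by simp
  moreover have "I \<subseteq> X - B" using IX B by auto
  ultimately show ?thesis using that by blast
qed

lemma card_dual_indep_le:
  assumes M: "matroid M" and I: "indep (dual M) I" and IX: "I \<subseteq> X" and X: "X \<subseteq> ground M"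
  shows "card I + rk M (ground M) \<le> card X + rk M (ground M - X)"
proof -
  obtain J where J: "I \<subseteq> J" "J \<subseteq> X" "card J + rk M (ground M) = card X + rk M (ground M - X)"
    by (rule rk_dual_aux[OF assms])
  have "card I \<le> card J" using J X matroid_finite[OF M] by (meson card_mono finite_subset)
  then show ?thesis using J by simp
qed

lemma matroid_dual:
  assumes M: "matroid M"
  shows "matroid (dual M)"
  unfolding matroid_def
proof (intro conjI allI impI)
  show "finite (ground (dual M))" using matroid_finite[OF M] by simp
  show "indep (dual M) {}" by (simp add: indep_dual[OF M])
  fix X assume "indep (dual M) X"
  then show "X \<subseteq> ground (dual M)" by (simp add: indep_dual[OF M])
next
  fix X Y assume "indep (dual M) Y \<and> X \<subseteq> Y"
  then show "indep (dual M) X"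
    using rk_mono[OF M, of "ground M - Y" "ground M - X"] rk_mono[OF M, of "ground M - X" "ground M"]
    unfolding indep_dual[OF M] by (metis Diff_mono Diff_subset le_antisym order_refl subset_trans)
next
  fix X Y assume XY: "indep (dual M) X \<and> indep (dual M) Y \<and> card X < card Y"
  then have X: "indep (dual M) X" and Y: "indep (dual M) Y" and XE: "X \<union> Y \<subseteq> ground M"
    by (auto simp: indep_dual[OF M])
  obtain J where J: "X \<subseteq> J" "J \<subseteq> X \<union> Y" "indep (dual M) J"
    "card J + rk M (ground M) = card (X \<union> Y) + rk M (ground M - (X \<union> Y))"
    by (rule rk_dual_aux[OF M X _ XE]) auto
  have "card Y \<le> card J" using card_dual_indep_le[OF M Y _ XE] J by auto
  then obtain e where e: "e \<in> J - X" using XY J(1) by (metis Diff_iff leD subset_antisym subsetI)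
  have "ground M - J \<subseteq> ground M - insert e X" using J(1) e by auto
  from rk_mono[OF M this] have "indep (dual M) (insert e X)"
    using J(1,3) e rk_mono[OF M, of "ground M - insert e X" "ground M"]
    unfolding indep_dual[OF M] by auto
  then show "\<exists>e\<in>Y - X. indep (dual M) (insert e X)" using e J by blast
qed

lemma rk_dual:
  assumes M: "matroid M" and X: "X \<subseteq> ground M"
  shows "rk (dual M) X + rk M (ground M) = card X + rk M (ground M - X)"
proof -
  note D = matroid_dual[OF M]
  obtain J where "J \<subseteq> X" "indep (dual M) J"
    "card J + rk M (ground M) = card X + rk M (ground M - X)"
    using rk_dual_aux[OF M indep_empty[OF D] _ X] by auto
  moreover obtain K where "K \<subseteq> X" "indep (dual M) K" "card K = rk (dual M) X" by (rule rk_attained[OF D])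
  ultimately show ?thesis using card_dual_indep_le[OF M _ _ X, of K] card_le_rk[OF D, of J X] by simp
qed

lemma dual_dual:
  assumes M: "matroid M"
  shows "dual (dual M) = M"
proof (rule matroid_eqI)
  fix X
  note D = matroid_dual[OF M]
  have "rk (dual M) (ground M - X) = rk (dual M) (ground M) \<longleftrightarrow> rk M X = card X" if X: "X \<subseteq> ground M"
  proof -
    have "card (ground M - X) + card X = card (ground M)"
      using X matroid_finite[OF M] by (metis card_Diff_subset card_mono finite_subset le_add_diff_inverse2)
    moreover have "ground M - (ground M - X) = X" using X by auto
    ultimately show ?thesis using rk_dual[OF M, of "ground M - X"] rk_dual[OF M, of "ground M"]
      by (auto simp: rk_empty[OF M])
  qed
  then show "indep (dual (dual M)) X \<longleftrightarrow> indep M X"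
    using indep_iff_rk[OF M] indep_ground[OF M] by (auto simp: indep_dual[OF D])
qed simp

lemma contract_empty: "matroid M \<Longrightarrow> contract M {} = M"
  by (rule matroid_eqI) (auto simp: indep_contract[where I = "{}"] indep_empty rk_empty dest: indep_ground)

lemma delete_empty: "delete M {} = M"
  by (rule matroid_eqI) (auto simp: indep_delete)

text \<open>Both sides are independence conditions that unfold to the same comparison of two ranks
  in \<open>M\<close>, those of the complements of \<open>X \<union> D\<close> and of
  \<open>D\<close>.\<close>

lemma dual_minor:
  assumes M: "matroid M" and CD: "C \<subseteq> ground M" "D \<subseteq> ground M" "C \<inter> D = {}"
  shows "dual (delete (contract M C) D) = delete (contract (dual M) D) C"
proof (rule matroid_eqI)
  fix X
  let ?E = "ground M" and ?N = "delete (contract M C) D"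
  note D = matroid_dual[OF M]
  have N: "matroid ?N" by (intro matroid_delete matroid_contract M)
  have "rk ?N (?E - C - D - X) = rk ?N (?E - C - D) \<longleftrightarrow> rk (dual M) (X \<union> D) = card X + rk (dual M) D"
    if X: "X \<subseteq> ?E - C - D"
  proof -
    have fin: "finite X" "finite D" using X CD matroid_finite[OF M] by (auto intro: finite_subset)
    have 1: "rk ?N Y + rk M C = rk M (Y \<union> C)" if "Y \<subseteq> ?E - C - D" for Y
      using rk_contract[OF M, of Y C] that by (subst rk_delete) auto
    have e: "(?E - C - D - X) \<union> C = ?E - (X \<union> D)" "(?E - C - D) \<union> C = ?E - D" using X CD by auto
    have 2: "rk ?N (?E - C - D - X) = rk ?N (?E - C - D) \<longleftrightarrow> rk M (?E - (X \<union> D)) = rk M (?E - D)"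
      using 1[of "?E - C - D - X"] 1[of "?E - C - D"] unfolding e by auto
    have "card (X \<union> D) = card X + card D" using X fin by (subst card_Un_disjoint) auto
    moreover have "X \<union> D \<subseteq> ?E" using X CD by auto
    ultimately show ?thesis using 2 rk_dual[OF M, of "X \<union> D"] rk_dual[OF M CD(2)] by auto
  qed
  then show "indep (dual ?N) X \<longleftrightarrow> indep (delete (contract (dual M) D) C) X"
    by (auto simp: indep_dual[OF N] indep_delete indep_contract_rk)
qed auto

text \<open>Closure of binary matroids under contraction is obtained through this identity from
  closure under deletion and duality.\<close>

lemma contract_dual_delete:
  assumes "matroid M" "C \<subseteq> ground M"
  shows "contract M C = dual (delete (dual M) C)"
  using dual_minor[OF matroid_dual[OF assms(1)], of "{}" C] assms
  by (simp add: dual_dual contract_empty matroid_dual delete_empty)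

section \<open>Isomorphism\<close>

lemma card_image_iso: "bij_betw f A B \<Longrightarrow> X \<subseteq> A \<Longrightarrow> card (f ` X) = card X"
  by (meson bij_betw_imp_inj_on card_image inj_on_subset)

lemma iso_rk:
  assumes M: "matroid M" and N: "matroid N" and f: "bij_betw f (ground M) (ground N)"
    "\<And>X. X \<subseteq> ground M \<Longrightarrow> indep M X \<longleftrightarrow> indep N (f ` X)" and X: "X \<subseteq> ground M"
  shows "rk M X = rk N (f ` X)"
proof (rule antisym)
  obtain I where I: "I \<subseteq> X" "indep M I" "card I = rk M X" by (rule rk_attained[OF M])
  have "card (f ` I) \<le> rk N (f ` X)" using I f X by (intro card_le_rk[OF N]) auto
  then show "rk M X \<le> rk N (f ` X)" using card_image_iso[OF f(1), of I] I X by auto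
  obtain J where J: "J \<subseteq> f ` X" "indep N J" "card J = rk N (f ` X)" by (rule rk_attained[OF N])
  then obtain I where I: "I \<subseteq> X" "J = f ` I" by (meson subset_imageE)
  then have "card I \<le> rk M X" using J f X by (intro card_le_rk[OF M]) auto
  then show "rk N (f ` X) \<le> rk M X" using card_image_iso[OF f(1), of I] I J X by auto
qed

lemma iso_dual:
  assumes M: "matroid M" and N: "matroid N" and "iso M N"
  shows "iso (dual M) (dual N)"
proof -
  obtain f where f: "bij_betw f (ground M) (ground N)"
    "\<And>X. X \<subseteq> ground M \<Longrightarrow> indep M X \<longleftrightarrow> indep N (f ` X)" using assms unfolding iso_def by blast
  have im: "f ` ground M = ground N" using f(1) by (simp add: bij_betw_def)
  have "indep (dual M) X \<longleftrightarrow> indep (dual N) (f ` X)" if X: "X \<subseteq> ground M" for X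
  proof -
    have "f ` (ground M - X) = ground N - f ` X"
      using inj_on_image_set_diff[of f "ground M" "ground M" X] f(1) X im by (auto simp: bij_betw_def)
    moreover have "f ` X \<subseteq> ground N" using X im by auto
    ultimately show ?thesis using X im iso_rk[OF M N f, of "ground M - X"] iso_rk[OF M N f, of "ground M"]
      by (auto simp: indep_dual[OF M] indep_dual[OF N])
  qed
  then show ?thesis unfolding iso_def using f(1) by auto
qed

lemma has_minor_iso_alt:
  "has_minor_iso N M \<longleftrightarrow> (\<exists>C D. C \<subseteq> ground N \<and> D \<subseteq> ground N \<and> C \<inter> D = {} \<and> iso M (delete (contract N C) D))"
  unfolding has_minor_iso_def is_minor_def by blast

lemma has_minor_iso_dual:
  assumes M: "matroid M" and N: "matroid N" and "has_minor_iso N (dual M)"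
  shows "has_minor_iso (dual N) M"
proof -
  obtain C D where CD: "C \<subseteq> ground N" "D \<subseteq> ground N" "C \<inter> D = {}" "iso (dual M) (delete (contract N C) D)"
    using assms(3) unfolding has_minor_iso_alt by blast
  have "iso (dual (dual M)) (dual (delete (contract N C) D))"
    by (rule iso_dual[OF matroid_dual[OF M] _ CD(4)]) (intro matroid_delete matroid_contract N)
  then show ?thesis unfolding dual_dual[OF M] dual_minor[OF N CD(1-3)] has_minor_iso_alt using CD by (intro exI[of _ D] exI[of _ C]) auto
qed

section \<open>The excluded minor\<close>

definition crowded :: "'a matroid \<Rightarrow> 'a set \<Rightarrow> bool" where
  "crowded M X \<longleftrightarrow> X \<subseteq> ground M \<and> rk M X + 2 \<le> card X \<and> rk M X + 2 \<le> rk M (ground M)"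

abbreviation U22_U02 where "U22_U02 \<equiv> direct_sum (uniform 2 2) (uniform 0 2)"

lemma ground_U22_U02: "ground U22_U02 = {Inl 0, Inl 1, Inr 0, Inr 1}"
  by (auto simp: direct_sum_def uniform_def ground_def lessThan_Suc numeral_2_eq_2)

lemma indep_U22_U02: "indep U22_U02 X \<longleftrightarrow> X \<subseteq> {Inl 0, Inl 1}"
proof -
  have "X \<subseteq> Inl ` {..<2::nat} \<union> Inr ` {..<2::nat} \<and> (Inl -` X \<subseteq> {..<2} \<and> card (Inl -` X) \<le> 2) \<and> Inr -` X \<subseteq> {..<2} \<and> card (Inr -` X) \<le> 0
     \<longleftrightarrow> X \<subseteq> Inl ` {..<2}" (is "?L \<longleftrightarrow> ?R")
  proof
    assume L: ?L
    then have "finite (Inr -` X)" by (meson finite_lessThan finite_subset)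
    then have "Inr -` X = {}" using L by simp
    then show ?R using L by (auto simp: set_eq_iff vimage_def)
  next
    assume R: ?R
    then have s: "Inl -` X \<subseteq> {..<2}" "Inr -` X = {}" by auto
    then have "card (Inl -` X) \<le> 2" using card_mono[of "{..<2::nat}" "Inl -` X"] by simp
    then show ?L using s R by auto
  qed
  moreover have "Inl ` {..<2::nat} = {Inl 0, Inl 1 :: nat + nat}"
    by (auto simp: lessThan_Suc numeral_2_eq_2)
  ultimately show ?thesis
    by (auto simp: direct_sum_def uniform_def indep_def ground_def)
qed

text \<open>The two loops \<open>a\<close>, \<open>b\<close> of the minor lie in the closure of
  \<open>C\<close>, so adding them to \<open>C\<close> raises the nullity by 2 and leaves the rank
  alone, while \<open>c\<close>, \<open>d\<close> witness that two more dimensions remain.\<close>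

lemma minor_U22_U02_crowded:
  assumes M: "matroid M" and "has_minor_iso M U22_U02"
  shows "\<exists>X. crowded M X"
proof -
  obtain C D f where CD: "C \<subseteq> ground M" "D \<subseteq> ground M" "C \<inter> D = {}"
    and f: "bij_betw f (ground U22_U02) (ground M - C - D)"
    "\<And>X. X \<subseteq> ground U22_U02 \<Longrightarrow> indep U22_U02 X \<longleftrightarrow> indep (delete (contract M C) D) (f ` X)"
    using assms(2) unfolding has_minor_iso_alt iso_def by auto
  define c d a b where "c = f (Inl 0)" "d = f (Inl 1)" "a = f (Inr 0)" "b = f (Inr 1)"
  have mem: "{a,b,c,d} \<subseteq> ground M - C - D" using f(1) ground_U22_U02 unfolding bij_betw_def c_d_a_b_def by auto
  have ne: "a \<noteq> b" "c \<noteq> d" using f(1) unfolding bij_betw_def inj_on_def ground_U22_U02 c_d_a_b_def by auto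
  have cd: "indep (contract M C) {c, d}"
    using f(2)[of "{Inl 0, Inl 1}"] unfolding c_d_a_b_def ground_U22_U02 indep_U22_U02 by (auto simp: indep_delete)
  have a: "\<not> indep (contract M C) {a}" and b: "\<not> indep (contract M C) {b}"
    using f(2)[of "{Inr 0}"] f(2)[of "{Inr 1}"] mem unfolding c_d_a_b_def ground_U22_U02 indep_U22_U02 by (auto simp: indep_delete)
  note K = matroid_contract[OF M, of C]
  have "rk (contract M C) {a, b} = 0"
  proof -
    have "rk (contract M C) {a,b} \<le> 0"
    proof (rule rk_leI[OF K])
      fix I assume I: "I \<subseteq> {a,b}" "indep (contract M C) I"
      have "a \<notin> I" "b \<notin> I" using a b indep_mono[OF K I(2)] by auto
      then have "I = {}" using I(1) by blast
      then show "card I \<le> 0" by simp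
    qed
    then show ?thesis by simp
  qed
  then have r: "rk M ({a,b} \<union> C) = rk M C" using rk_contract[OF M, of "{a,b}" C] mem by auto
  have r2: "rk M C + 2 \<le> rk M (ground M)"
  proof -
    have "rk M ({c,d} \<union> C) = 2 + rk M C" using cd ne by (simp add: indep_contract_rk)
    moreover have "rk M ({c,d} \<union> C) \<le> rk M (ground M)" by (rule rk_mono[OF M]) (use mem CD in auto)
    ultimately show ?thesis by simp
  qed
  have fC: "finite C" using CD(1) matroid_finite[OF M] finite_subset by blast
  have "card ({a,b} \<union> C) = 2 + card C" using ne mem fC by (subst card_Un_disjoint) auto
  then have "crowded M ({a,b} \<union> C)" unfolding crowded_def
    using r r2 rk_le_card[OF M fC] mem CD by auto
  then show ?thesis by blast
qed

lemma two_elements: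
  assumes "card A \<ge> 2"
  obtains a b where "a \<in> A" "b \<in> A" "a \<noteq> b"
proof -
  have "finite A" using assms by (intro card_ge_0_finite) simp
  then show ?thesis using that card_le_Suc0_iff_eq[of A] assms by fastforce
qed

text \<open>Contracting a basis \<open>C\<close> of the crowded set turns the rest of that set into
  loops, and there are two of them. A basis of \<open>M\<close> extending \<open>C\<close> supplies
  two elements that stay independent.\<close>

lemma crowded_minor_U22_U02:
  assumes M: "matroid M" and X: "crowded M X"
  shows "has_minor_iso M U22_U02"
proof -
  let ?E = "ground M"
  obtain C where C: "C \<subseteq> X" "indep M C" "card C = rk M X" by (rule rk_attained[OF M])
  have XE: "X \<subseteq> ?E" and fX: "finite X" using X matroid_finite[OF M] finite_subset unfolding crowded_def by auto
  have fC: "finite C" using fX C finite_subset by auto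
  have "card (X - C) \<ge> 2" using X C fC by (auto simp: crowded_def card_Diff_subset)
  then obtain a b where ab: "a \<in> X - C" "b \<in> X - C" "a \<noteq> b"
    by (rule two_elements)
  obtain B where B: "C \<subseteq> B" "B \<subseteq> ?E" "indep M B" "card B = rk M ?E"
    using extend_to_basis_of[OF M C(2), of ?E] C XE by blast
  have BX: "B \<inter> X = C"
    by (rule basis_of_Int[OF M C(2,1,3) B(3,1)])
  have "card (B - C) \<ge> 2" using X C B fC by (auto simp: crowded_def card_Diff_subset)
  then obtain c d where cd: "c \<in> B - C" "d \<in> B - C" "c \<noteq> d"
    by (rule two_elements)
  have dist: "c \<noteq> a" "c \<noteq> b" "d \<noteq> a" "d \<noteq> b" using ab cd BX by auto
  define D where "D = ?E - C - {a,b,c,d}"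
  have ground: "ground (delete (contract M C) D) = {a,b,c,d}"
    using ab cd B XE BX C unfolding D_def by auto
  define f :: "nat + nat \<Rightarrow> 'a" where
    "f x = (case x of Inl i \<Rightarrow> if i = 0 then c else d | Inr i \<Rightarrow> if i = 0 then a else b)" for x
  have bij: "bij_betw f (ground U22_U02) (ground (delete (contract M C) D))"
    unfolding ground ground_U22_U02 bij_betw_def inj_on_def f_def using dist ab cd by auto
  have rC: "rk M C = card C" by (rule rk_indep[OF M C(2)])
  have ind: "indep (delete (contract M C) D) Y \<longleftrightarrow> Y \<subseteq> {c,d}" if Y: "Y \<subseteq> {a,b,c,d}" for Y
  proof -
    have loop: "\<not> indep M (insert e C)" if "e \<in> {a,b}" for e
      using basis_of_maximal[OF M C(2,1,3)] that ab by auto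
    have "indep M (Y \<union> C) \<longleftrightarrow> Y \<subseteq> {c,d}"
    proof
      assume "indep M (Y \<union> C)"
      then have "insert e C \<subseteq> Y \<union> C \<Longrightarrow> e \<notin> {a,b}" for e using loop indep_mono[OF M] by blast
      then have "a \<notin> Y" "b \<notin> Y" by auto
      then show "Y \<subseteq> {c,d}" using Y by auto
    next
      assume "Y \<subseteq> {c,d}"
      then have "Y \<union> C \<subseteq> B" using cd B by blast
      then show "indep M (Y \<union> C)" by (rule indep_mono[OF M B(3)])
    qed
    moreover have "Y \<subseteq> ?E - C" "Y \<inter> D = {}" using Y ground unfolding D_def by auto
    ultimately show ?thesis by (simp add: indep_delete indep_contract[OF M C(2) order_refl rC[symmetric]])
  qed
  have "iso U22_U02 (delete (contract M C) D)" unfolding iso_def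
  proof (intro exI[of _ f] conjI allI impI bij)
    fix Y assume Y: "Y \<subseteq> ground U22_U02"
    then have fY: "f ` Y \<subseteq> {a,b,c,d}" using bij ground unfolding bij_betw_def by auto
    have "f y \<in> {c,d} \<longleftrightarrow> y \<in> {Inl 0, Inl 1}" if "y \<in> {Inl 0, Inl 1, Inr 0, Inr 1}" for y
      using that dist by (auto simp: f_def)
    then show "indep U22_U02 Y \<longleftrightarrow> indep (delete (contract M C) D) (f ` Y)"
      unfolding ind[OF fY] indep_U22_U02 using Y unfolding ground_U22_U02 by blast
  qed
  moreover have "C \<subseteq> ?E" "D \<subseteq> ?E" "C \<inter> D = {}" using C XE unfolding D_def by auto
  ultimately show ?thesis unfolding has_minor_iso_alt by blast
qed

lemma two_two_uniform_iff: "matroid M \<Longrightarrow> two_two_uniform M \<longleftrightarrow> (\<nexists>X. crowded M X)"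
  unfolding two_two_uniform_def using minor_U22_U02_crowded crowded_minor_U22_U02 by blast

text \<open>Passing to the dual and to the complement exchanges nullity and corank.\<close>

lemma crowded_dual:
  assumes M: "matroid M" and "crowded (dual M) X"
  shows "crowded M (ground M - X)"
proof -
  have X: "X \<subseteq> ground M" "rk (dual M) X + 2 \<le> card X" "rk (dual M) X + 2 \<le> rk (dual M) (ground M)"
    using assms unfolding crowded_def by auto
  have "card (ground M - X) + card X = card (ground M)"
    using X matroid_finite[OF M] by (metis card_Diff_subset card_mono finite_subset le_add_diff_inverse2)
  then show ?thesis
    using X rk_dual[OF M X(1)] rk_dual[OF M, of "ground M"] by (auto simp: crowded_def rk_empty[OF M])
qed

text \<open>The corank is unchanged, and the nullity can only grow because \<open>rk M C\<close> is
  at most \<open>card C\<close>.\<close>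

lemma crowded_contract:
  assumes M: "matroid M" and C: "C \<subseteq> ground M" and X: "crowded (contract M C) X"
  shows "crowded M (X \<union> C)"
proof -
  have XE: "X \<subseteq> ground M - C" using X by (auto simp: crowded_def)
  have fin: "finite X" "finite C" using XE C matroid_finite[OF M] by (auto intro: finite_subset)
  have "card (X \<union> C) = card X + card C" using XE fin by (subst card_Un_disjoint) auto
  moreover have "(ground M - C) \<union> C = ground M" using C by auto
  ultimately show ?thesis
    using X XE C rk_contract[OF M, of X C] rk_contract[OF M, of "ground M - C" C] rk_le_card[OF M fin(2)]
    by (auto simp: crowded_def)
qed

lemma crowded_delete:
  assumes M: "matroid M" and X: "crowded (delete M D) X"
  shows "crowded M X"
proof -
  have XE: "X \<subseteq> ground M - D" using X by (auto simp: crowded_def)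
  then have "rk (delete M D) X = rk M X" "rk (delete M D) (ground M - D) = rk M (ground M - D)"
    by (auto intro!: rk_delete)
  moreover have "rk M (ground M - D) \<le> rk M (ground M)" by (rule rk_mono[OF M]) auto
  ultimately show ?thesis using X by (auto simp: crowded_def)
qed

lemma crowded_iso:
  assumes M: "matroid M" and N: "matroid N" and "iso M N" and X: "crowded M X"
  shows "\<exists>Y. crowded N Y"
proof -
  obtain f where f: "bij_betw f (ground M) (ground N)"
    "\<And>X. X \<subseteq> ground M \<Longrightarrow> indep M X \<longleftrightarrow> indep N (f ` X)" using assms unfolding iso_def by blast
  have XE: "X \<subseteq> ground M" using X by (simp add: crowded_def)
  have im: "f ` ground M = ground N" using f(1) by (simp add: bij_betw_def)
  have "crowded N (f ` X)"
    using X XE im iso_rk[OF M N f XE] iso_rk[OF M N f order_refl] card_image_iso[OF f(1) XE]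
    by (auto simp: crowded_def)
  then show ?thesis by blast
qed

lemma not_crowded_minor:
  assumes "matroid M" "matroid N" "has_minor_iso N M" "\<nexists>X. crowded N X"
  shows "\<nexists>X. crowded M X"
proof -
  obtain C D where CD: "C \<subseteq> ground N" "D \<subseteq> ground N" "C \<inter> D = {}" "iso M (delete (contract N C) D)"
    using assms(3) unfolding has_minor_iso_alt by blast
  show ?thesis
    using crowded_iso[OF assms(1) _ CD(4)] crowded_delete[OF matroid_contract] crowded_contract[OF _ CD(1)]
      matroid_delete[OF matroid_contract] assms by metis
qed

section \<open>Connectivity\<close>

definition simple :: "'a matroid \<Rightarrow> bool" where
  "simple M \<longleftrightarrow> (\<forall>X \<subseteq> ground M. card X \<le> 2 \<longrightarrow> indep M X)"

lemma k_separation_dual: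
  assumes M: "matroid M" and "k_separation (dual M) k X"
  shows "k_separation M k X"
proof -
  have X: "X \<subseteq> ground M" using assms by (simp add: k_separation_def)
  have "card (ground M - X) + card X = card (ground M)"
    using X matroid_finite[OF M] by (metis card_Diff_subset card_mono finite_subset le_add_diff_inverse2)
  moreover have "ground M - (ground M - X) = X" using X by auto
  ultimately show ?thesis using assms(2) rk_dual[OF M X] rk_dual[OF M, of "ground M - X"] rk_dual[OF M, of "ground M"]
    by (auto simp: k_separation_def rk_empty[OF M])
qed

lemma three_connected_dual: "matroid M \<Longrightarrow> three_connected M \<Longrightarrow> three_connected (dual M)"
  unfolding three_connected_def using k_separation_dual by blast

text \<open>A dependent set of size \<open>k\<close> at most 2 is itself one side of a
  \<open>k\<close>-separation; four elements guarantee that the other side has at least two.\<close>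

lemma three_connected_simple:
  assumes M: "matroid M" and c: "three_connected M" and n: "card (ground M) \<ge> 4"
  shows "simple M"
  unfolding simple_def
proof (intro allI impI)
  fix X assume X: "X \<subseteq> ground M" "card X \<le> 2"
  have fin: "finite X" using X matroid_finite[OF M] finite_subset by auto
  have le: "rk M X \<le> card X" by (rule rk_le_card[OF M fin])
  show "indep M X"
  proof (rule ccontr)
    assume "\<not> indep M X"
    then have lt: "rk M X < card X" using le indep_iff_rk[OF M X(1)] by auto
    have "rk M (ground M - X) \<le> rk M (ground M)" by (rule rk_mono[OF M]) auto
    moreover have "card (ground M - X) \<ge> 2" using X n fin by (simp add: card_Diff_subset)
    ultimately have "k_separation M (card X) X" using X lt by (auto simp: k_separation_def)
    then show False using c X lt unfolding three_connected_def by auto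
  qed
qed

section \<open>Vector families over GF(2)\<close>

type_synonym vec = "nat \<Rightarrow> bit"

declare add_bit_eq_xor [simp del] mult_bit_eq_and [simp del]

lemma bit_add_self [simp]: "(a::bit) + a = 0"
  by (cases a) auto

lemma vec_add_self [simp]: "(x::vec) + x = 0"
  by (simp add: fun_eq_iff)

lemma vec_add_self_left [simp]: "(x::vec) + (x + y) = y"
  by (simp add: fun_eq_iff flip: add.assoc)

lemma vec_add_eq_0_iff: "(x::vec) + y = 0 \<longleftrightarrow> x = y"
  by (metis add.right_neutral vec_add_self vec_add_self_left)

lemma vec_add_eq_iff: "(x::vec) + y = z \<longleftrightarrow> x = y + z"
  by (metis add.commute vec_add_self_left)

lemma sum_vec_apply: "(sum (v :: 'a \<Rightarrow> vec) Y) i = (\<Sum>x\<in>Y. v x i)"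
  by (induction Y rule: infinite_finite_induct) auto

lemma of_nat_bit_eq_0_iff: "(of_nat n :: bit) = 0 \<longleftrightarrow> even n"
  by (induction n) auto

lemma sum_symdiff:
  fixes v :: "'a \<Rightarrow> vec"
  assumes "finite Y" "finite Z"
  shows "sum v ((Y - Z) \<union> (Z - Y)) = sum v Y + sum v Z"
proof -
  have "sum v ((Y - Z) \<union> (Z - Y)) = sum v (Y - Z) + sum v (Z - Y)"
    using assms by (intro sum.union_disjoint) auto
  moreover have "sum v Y = sum v (Y \<inter> Z) + sum v (Y - Z)" "sum v Z = sum v (Y \<inter> Z) + sum v (Z - Y)"
    using sum.Int_Diff[of Y v Z] sum.Int_Diff[of Z v Y] assms by (auto simp: Int_commute)
  ultimately show ?thesis by (simp add: ac_simps)
qed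

text \<open>Over GF(2) a linear combination is the sum over its support, so no coefficients are
  needed. Sets of indices rather than of vectors are used, which makes two indices with equal
  columns dependent.\<close>

definition free :: "('a \<Rightarrow> vec) \<Rightarrow> 'a set \<Rightarrow> bool" where
  "free v X \<longleftrightarrow> (\<forall>Y \<subseteq> X. sum v Y = 0 \<longrightarrow> Y = {})"

definition gen :: "('a \<Rightarrow> vec) \<Rightarrow> 'a set \<Rightarrow> vec set" where
  "gen v X = {sum v Y | Y. Y \<subseteq> X}"

lemma gf2_indep_iff_free:
  assumes "finite X"
  shows "gf2_indep v X \<longleftrightarrow> free v X"
proof
  assume L: "gf2_indep v X"
  show "free v X" unfolding free_def
  proof (intro allI impI)
    fix Y assume Y: "Y \<subseteq> X" "sum v Y = 0"
    define c :: "'a \<Rightarrow> bit" where "c x = of_bool (x \<in> Y)" for x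
    have "(\<Sum>x\<in>X. c x * v x i) = 0" for i
    proof -
      have "(\<Sum>x\<in>X. c x * v x i) = (\<Sum>x\<in>Y. v x i)"
        using Y assms by (intro sum.mono_neutral_cong_right) (auto simp: c_def)
      then show ?thesis using Y(2) by (simp add: flip: sum_vec_apply)
    qed
    then have "\<forall>x\<in>X. c x = 0" using L unfolding gf2_indep_def by blast
    then show "Y = {}" using Y by (auto simp: c_def)
  qed
next
  assume R: "free v X"
  show "gf2_indep v X" unfolding gf2_indep_def
  proof (intro allI impI)
    fix c :: "'a \<Rightarrow> bit" assume c: "\<forall>i. (\<Sum>x\<in>X. c x * v x i) = 0"
    define Y where "Y = {x \<in> X. c x \<noteq> 0}"
    have "(\<Sum>x\<in>Y. v x i) = (\<Sum>x\<in>X. c x * v x i)" for i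
      using assms by (intro sum.mono_neutral_cong_left) (auto simp: Y_def bit_not_zero_iff)
    then have "sum v Y = 0" using c by (auto simp: fun_eq_iff sum_vec_apply)
    moreover have "Y \<subseteq> X" unfolding Y_def by blast
    ultimately have "Y = {}" using R unfolding free_def by blast
    then show "\<forall>x\<in>X. c x = 0" unfolding Y_def by blast
  qed
qed

lemma free_subset: "free v X \<Longrightarrow> Y \<subseteq> X \<Longrightarrow> free v Y"
  unfolding free_def by blast

lemma free_empty: "free v {}"
  unfolding free_def by blast

lemma gen_mono: "X \<subseteq> Y \<Longrightarrow> gen v X \<subseteq> gen v Y"
  unfolding gen_def by blast

lemma gen_0: "0 \<in> gen v X"
  unfolding gen_def by (auto intro!: exI[of _ "{}"])

lemma gen_single: "x \<in> X \<Longrightarrow> v x \<in> gen v X"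
  unfolding gen_def by (auto intro!: exI[of _ "{x}"])

lemma gen_sum: "Y \<subseteq> X \<Longrightarrow> sum v Y \<in> gen v X"
  unfolding gen_def by blast

lemma finite_gen: "finite X \<Longrightarrow> finite (gen v X)"
  unfolding gen_def by (simp add: setcompr_eq_image flip: Pow_def)

lemma gen_add:
  assumes "finite X" "a \<in> gen v X" "b \<in> gen v X"
  shows "a + b \<in> gen v X"
proof -
  obtain Y Z where "Y \<subseteq> X" "a = sum v Y" "Z \<subseteq> X" "b = sum v Z" using assms unfolding gen_def by blast
  then show ?thesis using sum_symdiff[of Y Z v] assms(1)
    unfolding gen_def by (auto simp: finite_subset intro!: exI[of _ "(Y - Z) \<union> (Z - Y)"])
qed

lemma sum_in_gen: "finite X \<Longrightarrow> (\<And>y. y \<in> Y \<Longrightarrow> w y \<in> gen v X) \<Longrightarrow> sum w Y \<in> gen v X"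
  by (induction Y rule: infinite_finite_induct) (auto simp: gen_0 gen_add)

lemma gen_subset: "finite X \<Longrightarrow> (\<And>y. y \<in> Y \<Longrightarrow> w y \<in> gen v X) \<Longrightarrow> gen w Y \<subseteq> gen v X"
  unfolding gen_def[of w Y] by (auto intro!: sum_in_gen)

lemma free_inj:
  assumes "free v X" "finite X" "Y \<subseteq> X" "Z \<subseteq> X" "sum v Y = sum v Z"
  shows "Y = Z"
proof -
  have "sum v ((Y - Z) \<union> (Z - Y)) = 0"
    using assms sum_symdiff[of Y Z v] finite_subset[OF _ assms(2)] by simp
  moreover have "(Y - Z) \<union> (Z - Y) \<subseteq> X" using assms by blast
  ultimately have "(Y - Z) \<union> (Z - Y) = {}" using assms(1) unfolding free_def by blast
  then show ?thesis by blast
qed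

lemma card_gen:
  assumes "free v X" "finite X"
  shows "card (gen v X) = 2 ^ card X"
proof -
  have "inj_on (sum v) (Pow X)" using free_inj[OF assms] by (auto intro!: inj_onI)
  then show ?thesis using assms unfolding gen_def
    by (simp add: setcompr_eq_image card_image card_Pow flip: Pow_def)
qed

lemma free_insertI:
  assumes "finite X" "free v X" "v x \<notin> gen v X"
  shows "free v (insert x X)"
  unfolding free_def
proof (intro allI impI)
  fix Y assume Y: "Y \<subseteq> insert x X" "sum v Y = 0"
  show "Y = {}"
  proof (cases "x \<in> Y")
    case True
    have "finite Y" using Y assms(1) finite_subset by blast
    then have "v x = sum v (Y - {x})" using True Y(2) by (simp add: sum.remove vec_add_eq_0_iff)
    then show ?thesis using assms(3) Y(1) gen_sum[of "Y - {x}" X v] by auto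
  next
    case False
    then show ?thesis using Y assms(2) unfolding free_def by blast
  qed
qed

lemma free_insertD:
  assumes "finite X" "free v (insert x X)" "x \<notin> X"
  shows "v x \<notin> gen v X"
proof
  assume "v x \<in> gen v X"
  then obtain Y where Y: "Y \<subseteq> X" "v x = sum v Y" unfolding gen_def by blast
  then have "insert x Y = Y"
    using free_inj[OF assms(2), of "{x}" Y] assms by auto
  then show False using Y assms by auto
qed

text \<open>Counting in place of Steinitz exchange: if nothing in \<open>Y\<close> extended
  \<open>X\<close>, the \<open>2 ^ card Y\<close> sums of \<open>Y\<close> would all be among the
  \<open>2 ^ card X\<close> sums of \<open>X\<close>.\<close>

lemma free_augment:
  assumes "finite X" "finite Y" "free v X" "free v Y" "card X < card Y"
  shows "\<exists>e\<in>Y - X. free v (insert e X)"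
proof (rule ccontr)
  assume n: "\<not> ?thesis"
  have "v y \<in> gen v X" if "y \<in> Y" for y
    using n free_insertI[OF assms(1,3), of y] gen_single[of y X v] that by blast
  then have "gen v Y \<subseteq> gen v X" by (rule gen_subset[OF assms(1)])
  then have "card (gen v Y) \<le> card (gen v X)" by (rule card_mono[OF finite_gen[OF assms(1)]])
  then show False using assms by (simp add: card_gen)
qed

lemma ground_vec [simp]: "ground (vec_matroid E v) = E"
  by (simp add: vec_matroid_def ground_def)

lemma indep_vec: "finite E \<Longrightarrow> indep (vec_matroid E v) X \<longleftrightarrow> X \<subseteq> E \<and> free v X"
  using gf2_indep_iff_free[of X v] by (auto simp: vec_matroid_def indep_def finite_subset)

lemma matroid_vec:
  assumes "finite E"
  shows "matroid (vec_matroid E v)"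
  unfolding matroid_def indep_vec[OF assms] ground_vec
proof (intro conjI allI impI)
  fix X Y assume "(X \<subseteq> E \<and> free v X) \<and> (Y \<subseteq> E \<and> free v Y) \<and> card X < card Y"
  moreover from this obtain e where "e \<in> Y - X" "free v (insert e X)"
    using free_augment[of X Y v] assms finite_subset by metis
  ultimately show "\<exists>e\<in>Y - X. insert e X \<subseteq> E \<and> free v (insert e X)" by (intro bexI[of _ e]) auto
qed (use assms free_empty free_subset in auto)

lemma gen_basis:
  assumes E: "finite E" and J: "J \<subseteq> X" "X \<subseteq> E" "free v J" "card J = rk (vec_matroid E v) X"
  shows "gen v J = gen v X"
proof
  have fJ: "finite J" using E J by (meson finite_subset)
  have "v x \<in> gen v J" if x: "x \<in> X" for x
  proof (cases "x \<in> J")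
    case False
    then have "\<not> indep (vec_matroid E v) (insert x J)"
      using J x E by (intro basis_of_maximal[OF matroid_vec[OF E]]) (auto simp: indep_vec)
    then show ?thesis using free_insertI[OF fJ J(3), of x] J x by (auto simp: indep_vec[OF E])
  qed (rule gen_single)
  then show "gen v X \<subseteq> gen v J" by (rule gen_subset[OF fJ])
qed (rule gen_mono[OF J(1)])

text \<open>The form in which dimension is used below: the rank is the binary logarithm of the size
  of the span.\<close>

lemma card_gen_rk:
  assumes "finite E" "X \<subseteq> E"
  shows "card (gen v X) = 2 ^ rk (vec_matroid E v) X"
proof -
  obtain J where J: "J \<subseteq> X" "indep (vec_matroid E v) J" "card J = rk (vec_matroid E v) X"
    by (rule rk_attained[OF matroid_vec[OF assms(1)]])
  then have "free v J" "finite J" using assms by (auto simp: indep_vec intro: finite_subset)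
  then show ?thesis using gen_basis[OF assms(1) J(1) assms(2)] card_gen[of v J] J by simp
qed

lemma delete_vec: "finite E \<Longrightarrow> delete (vec_matroid E v) D = vec_matroid (E - D) v"
  by (rule matroid_eqI) (auto simp: indep_delete indep_vec)

lemma binary_delete:
  assumes "matroid M" "binary M"
  shows "binary (delete M D)"
proof -
  obtain v where v: "M = vec_matroid (ground M) v" using assms by (auto simp: binary_def)
  have "delete M D = vec_matroid (ground M - D) v"
    using delete_vec[OF matroid_finite[OF assms(1)], of v D] v by simp
  then show ?thesis unfolding binary_def by auto
qed

lemma free_image:
  assumes "\<And>Y. Y \<subseteq> X \<Longrightarrow> sum v Y = 0 \<longleftrightarrow> sum w (g ` Y) = 0"
  shows "free v X \<longleftrightarrow> free w (g ` X)"
  unfolding free_def using assms by (metis image_is_empty image_mono subset_imageE)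

lemma binary_iso:
  assumes M: "matroid M" and "iso M N" "binary N"
  shows "binary M"
proof -
  obtain f where f: "bij_betw f (ground M) (ground N)"
    "\<And>X. X \<subseteq> ground M \<Longrightarrow> indep M X \<longleftrightarrow> indep N (f ` X)" using assms unfolding iso_def by blast
  obtain v where v: "N = vec_matroid (ground N) v" using assms by (auto simp: binary_def)
  have fin: "finite (ground M)" "finite (ground N)"
    using matroid_finite[OF M] bij_betw_finite[OF f(1)] by auto
  have inj: "inj_on f (ground M)" using f(1) by (simp add: bij_betw_def)
  have s: "sum (v \<circ> f) Y = 0 \<longleftrightarrow> sum v (f ` Y) = 0" if "Y \<subseteq> ground M" for Y
    using inj that by (simp add: sum.reindex inj_on_subset)
  have fr: "free v (f ` X) \<longleftrightarrow> free (v \<circ> f) X" if X: "X \<subseteq> ground M" for X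
    using free_image[of X "v \<circ> f" v f] s X by auto
  have "M = vec_matroid (ground M) (v \<circ> f)"
  proof (rule matroid_eqI)
    fix X
    have "indep N (f ` X) \<longleftrightarrow> free (v \<circ> f) X" if "X \<subseteq> ground M"
      using fr[OF that] f(1) that fin by (subst v) (auto simp: indep_vec bij_betw_def)
    then show "indep M X \<longleftrightarrow> indep (vec_matroid (ground M) (v \<circ> f)) X"
      using f(2) indep_ground[OF M] by (auto simp: indep_vec[OF fin(1)])
  qed simp
  then show ?thesis unfolding binary_def by blast
qed

section \<open>Circuits and duality for binary matroids\<close>

text \<open>The columns of the representation of the dual list the members of the cycle space; hence
  a set sums to zero in it iff it is orthogonal to all cycles.\<close>

lemma dual_vec_representation:
  assumes E: "finite E"
  obtains w where "dual (vec_matroid E v) = vec_matroid E w"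
    "\<And>c. c \<subseteq> E \<Longrightarrow> sum w c = 0 \<longleftrightarrow> (\<forall>Y \<subseteq> E. sum v Y = 0 \<longrightarrow> even (card (c \<inter> Y)))"
proof -
  let ?M = "vec_matroid E v"
  note M = matroid_vec[OF E, of v]
  define Z where "Z = {Y. Y \<subseteq> E \<and> sum v Y = 0}"
  have "finite Z" unfolding Z_def using E by simp
  then obtain g and n :: nat where g: "Z = g ` {i. i < n}"
    using finite_imp_nat_seg_image_inj_on by metis
  \<comment> \<open>Row \<open>i\<close> is the indicator vector of the \<open>i\<close>-th cycle
    \<open>g i\<close>; rows from \<open>n\<close> on are zero.\<close>
  define w :: "'a \<Rightarrow> vec" where "w x i = of_bool (i < n \<and> x \<in> g i)" for x i
  have ortho: "sum w c = 0 \<longleftrightarrow> (\<forall>Y \<subseteq> E. sum v Y = 0 \<longrightarrow> even (card (c \<inter> Y)))" if c: "c \<subseteq> E" for c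
  proof -
    have "finite c" using c E finite_subset by blast
    then have "(\<Sum>x\<in>c. w x i) = of_nat (card (c \<inter> g i))" if "i < n" for i
      using that by (simp add: w_def of_bool_def sum.If_cases Int_def)
    moreover have "(\<Sum>x\<in>c. w x i) = 0" if "\<not> i < n" for i using that by (simp add: w_def)
    ultimately have "sum w c = 0 \<longleftrightarrow> (\<forall>i<n. even (card (c \<inter> g i)))"
      unfolding fun_eq_iff sum_vec_apply by (metis of_nat_bit_eq_0_iff zero_fun_apply)
    also have "\<dots> \<longleftrightarrow> (\<forall>Y\<in>Z. even (card (c \<inter> Y)))" unfolding g by auto
    finally show ?thesis unfolding Z_def by auto
  qed
  have "rk ?M (E - X) = rk ?M E \<longleftrightarrow> free w X" if X: "X \<subseteq> E" for X
  proof
    assume r: "rk ?M (E - X) = rk ?M E"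
    obtain B where B: "B \<subseteq> E - X" "indep ?M B" "card B = rk ?M (E - X)" by (rule rk_attained[OF M])
    have gB: "gen v B = gen v E" using B r by (intro gen_basis[OF E]) (auto simp: indep_vec[OF E])
    show "free w X" unfolding free_def
    proof (intro allI impI)
      fix c assume c: "c \<subseteq> X" "sum w c = 0"
      show "c = {}"
      proof (rule ccontr)
        assume "c \<noteq> {}"
        then obtain x where x: "x \<in> c" by blast
        then have "v x \<in> gen v B" unfolding gB using c X by (intro gen_single) auto
        \<comment> \<open>\<open>insert x Y\<close> is the fundamental circuit of \<open>x\<close>
          over a basis disjoint from \<open>X\<close>, so it meets \<open>c\<close> in
          \<open>x\<close> alone, an odd intersection.\<close>
        then obtain Y where Y: "Y \<subseteq> B" "v x = sum v Y" unfolding gen_def by blast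
        have xY: "x \<notin> Y" "Y \<inter> X = {}" using Y B x c by auto
        have "finite Y" using Y B E by (meson Diff_subset finite_subset)
        then have "sum v (insert x Y) = 0" using Y xY by simp
        moreover have "insert x Y \<subseteq> E" using Y B x c X by auto
        ultimately have "even (card (c \<inter> insert x Y))" using ortho[of c] c X by auto
        moreover have "c \<inter> insert x Y = {x}" using xY x c by auto
        ultimately show False by simp
      qed
    qed
  next
    assume fr: "free w X"
    obtain J where J: "J \<subseteq> E - X" "indep ?M J" "card J = rk ?M (E - X)" by (rule rk_attained[OF M])
    obtain B where B: "J \<subseteq> B" "B \<subseteq> E" "indep ?M B" "card B = rk ?M E"
      using extend_to_basis_of[OF M J(2), of E] J by auto
    have fB: "finite B" "free v B" using B E finite_subset by (auto simp: indep_vec[OF E])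
    have gB: "gen v B = gen v E" using B fB by (intro gen_basis[OF E]) auto
    have gJ: "gen v J = gen v (E - X)" using J by (intro gen_basis[OF E]) (auto simp: indep_vec[OF E])
    have "B = J"
    proof (rule ccontr)
      assume "B \<noteq> J"
      then obtain b where b: "b \<in> B" "b \<notin> J" using B by blast
      have "v x \<in> gen v B" if "x \<in> E" for x using gen_single[OF that, of v] gB by simp
      then have "\<exists>A. A \<subseteq> B \<and> v x = sum v A" if "x \<in> E" for x using that unfolding gen_def by blast
      then obtain A where A: "\<And>x. x \<in> E \<Longrightarrow> A x \<subseteq> B" "\<And>x. x \<in> E \<Longrightarrow> v x = sum v (A x)" by metis
      \<comment> \<open>The fundamental cocircuit of \<open>b\<close>: the elements whose expansion
        in \<open>B\<close> uses \<open>b\<close>. It lies in \<open>X\<close> because elements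
        outside \<open>X\<close> expand in \<open>J\<close>.\<close>
      define c where "c = {x \<in> E. b \<in> A x}"
      have "c \<subseteq> X"
      proof
        fix x assume x: "x \<in> c"
        show "x \<in> X"
        proof (rule ccontr)
          assume "x \<notin> X"
          then have "v x \<in> gen v J" unfolding gJ using x by (intro gen_single) (auto simp: c_def)
          then obtain Y where "Y \<subseteq> J" "v x = sum v Y" unfolding gen_def by blast
          then have "A x = Y" using free_inj[OF fB(2,1), of "A x" Y] A[of x] x B by (auto simp: c_def)
          then show False using \<open>Y \<subseteq> J\<close> x b by (auto simp: c_def)
        qed
      qed
      moreover have "sum w c = 0"
        unfolding ortho[OF \<open>c \<subseteq> X\<close>[THEN subset_trans, OF X]]
      proof (intro allI impI)
        fix Y assume Y: "Y \<subseteq> E" "sum v Y = 0"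
        have fY: "finite Y" using Y E finite_subset by blast
        \<comment> \<open>The parity of \<open>c \<inter> Y'\<close> is the coefficient of
          \<open>b\<close> in the expansion of the sum over \<open>Y'\<close>; for a cycle that
          coefficient is 0.\<close>
        have key: "\<exists>S \<subseteq> B. sum v Y' = sum v S \<and> (b \<in> S \<longleftrightarrow> odd (card (c \<inter> Y')))"
          if "finite Y'" "Y' \<subseteq> E" for Y' using that
        proof (induction Y')
          case empty
          then show ?case by (intro exI[of _ "{}"]) auto
        next
          case (insert x Y')
          then obtain S where S: "S \<subseteq> B" "sum v Y' = sum v S" "b \<in> S \<longleftrightarrow> odd (card (c \<inter> Y'))" by auto
          have x: "x \<in> E" using insert by auto
          have fS: "finite S" "finite (A x)" using S A(1)[OF x] fB(1) finite_subset by auto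
          have "sum v (insert x Y') = sum v ((A x - S) \<union> (S - A x))"
            using insert S(2) A(2)[OF x] sum_symdiff[OF fS(2,1), of v] by simp
          moreover have "odd (card (c \<inter> insert x Y')) \<longleftrightarrow> b \<in> (A x - S) \<union> (S - A x)"
            using insert S(3) x by (cases "b \<in> A x") (auto simp: c_def Int_insert_right)
          moreover have "(A x - S) \<union> (S - A x) \<subseteq> B" using S A(1)[OF x] by auto
          ultimately show ?case by (intro exI[of _ "(A x - S) \<union> (S - A x)"]) auto
        qed
        obtain S where "S \<subseteq> B" "sum v Y = sum v S" "b \<in> S \<longleftrightarrow> odd (card (c \<inter> Y))"
          using key[OF fY Y(1)] by blast
        then show "even (card (c \<inter> Y))" using Y(2) fB(2) unfolding free_def by auto
      qed
      ultimately have "c = {}" using fr unfolding free_def by blast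
      moreover have "b \<in> c"
      proof -
        have "b \<in> E" using b B by auto
        then have "A b = {b}" using free_inj[OF fB(2,1), of "A b" "{b}"] A[of b] b by auto
        then show ?thesis using \<open>b \<in> E\<close> by (simp add: c_def)
      qed
      ultimately show False by blast
    qed
    then show "rk ?M (E - X) = rk ?M E" using J B by simp
  qed
  then have "dual ?M = vec_matroid E w"
    by (intro matroid_eqI) (auto simp: indep_dual[OF M] indep_vec[OF E])
  then show ?thesis using that ortho by blast
qed

lemma binary_dual:
  assumes "matroid M" "binary M"
  shows "binary (dual M)"
proof -
  obtain v where v: "M = vec_matroid (ground M) v" using assms by (auto simp: binary_def)
  obtain w where "dual (vec_matroid (ground M) v) = vec_matroid (ground M) w"
    by (rule dual_vec_representation[OF matroid_finite[OF assms(1)]])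
  then show ?thesis unfolding binary_def using v by auto
qed

lemma binary_contract:
  assumes "matroid M" "binary M" "C \<subseteq> ground M"
  shows "binary (contract M C)"
  unfolding contract_dual_delete[OF assms(1,3)]
  by (intro binary_dual binary_delete matroid_delete matroid_dual assms)

definition circuit :: "'a matroid \<Rightarrow> 'a set \<Rightarrow> bool" where
  "circuit M C \<longleftrightarrow> C \<subseteq> ground M \<and> \<not> indep M C \<and> (\<forall>x\<in>C. indep M (C - {x}))"

text \<open>For binary matroids this is representability inside an affine geometry.\<close>

definition affine :: "'a matroid \<Rightarrow> bool" where
  "affine M \<longleftrightarrow> (\<forall>C. circuit M C \<longrightarrow> even (card C))"

lemma sum_circuit:
  assumes E: "finite E" and C: "circuit (vec_matroid E v) C"
  shows "sum v C = 0"
proof -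
  obtain Y where Y: "Y \<subseteq> C" "sum v Y = 0" "Y \<noteq> {}"
    using C unfolding circuit_def indep_vec[OF E] free_def by auto
  have "Y = C"
  proof (rule ccontr)
    assume "Y \<noteq> C"
    then obtain x where "x \<in> C" "Y \<subseteq> C - {x}" using Y by blast
    then show False using Y C unfolding circuit_def indep_vec[OF E] free_def by blast
  qed
  then show ?thesis using Y by simp
qed

text \<open>A zero-sum set that is not a circuit splits into two smaller zero-sum sets, and when its
  size is odd so is the size of one part.\<close>

lemma odd_circuit:
  assumes E: "finite E" and "Y \<subseteq> E" "sum v Y = 0" "odd (card Y)"
  obtains C where "circuit (vec_matroid E v) C" "odd (card C)"
proof -
  have "\<exists>C. circuit (vec_matroid E v) C \<and> odd (card C)"
    using assms(2-4)
  proof (induction "card Y" arbitrary: Y rule: less_induct)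
    case less
    have fY: "finite Y" using less(2) E finite_subset by blast
    show ?case
    proof (cases "circuit (vec_matroid E v) Y")
      case True
      then show ?thesis using less by blast
    next
      case False
      have "Y \<noteq> {}" using less(4) by auto
      then have "\<not> free v Y" using less(3) unfolding free_def by blast
      then obtain x where x: "x \<in> Y" "\<not> free v (Y - {x})"
        using False less(2) unfolding circuit_def by (auto simp: indep_vec[OF E])
      then obtain Z where Z: "Z \<subseteq> Y - {x}" "sum v Z = 0" "Z \<noteq> {}" unfolding free_def by auto
      have ZY: "Z \<subset> Y" using Z x by auto
      have fZ: "finite Z" using ZY fY finite_subset by auto
      have "sum v Y = sum v (Y - Z) + sum v Z" using ZY fY by (intro sum.subset_diff) auto
      then have Z': "sum v (Y - Z) = 0" using less(3) Z by simp
      have c: "card Y = card (Y - Z) + card Z" using ZY fY fZ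
        by (metis card_Diff_subset card_mono le_add_diff_inverse2 psubset_imp_subset)
      have lt: "card Z < card Y" "card (Y - Z) < card Y"
        using psubset_card_mono[OF fY ZY] c Z(3) fZ by (auto simp: card_gt_0_iff)
      show ?thesis
      proof (cases "odd (card Z)")
        case True
        then show ?thesis using less(1)[OF lt(1)] ZY less(2) Z(2) by auto
      next
        case False
        then have "odd (card (Y - Z))" using c less(4) by auto
        moreover have "Y - Z \<subseteq> E" using less(2) by auto
        ultimately show ?thesis using less(1)[OF lt(2)] Z' by blast
      qed
    qed
  qed
  then show ?thesis using that by blast
qed

lemma affine_vec:
  assumes "finite E"
  shows "affine (vec_matroid E v) \<longleftrightarrow> (\<forall>Y \<subseteq> E. sum v Y = 0 \<longrightarrow> even (card Y))"
  unfolding affine_def using odd_circuit[OF assms] sum_circuit[OF assms] by (metis circuit_def ground_vec)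

text \<open>The hypothesis makes \<open>E\<close> itself a cycle, and a set orthogonal to
  \<open>E\<close> has even size.\<close>

lemma affine_dual_vec:
  assumes E: "finite E" and "sum v E = 0"
  shows "affine (dual (vec_matroid E v))"
proof -
  obtain w where w: "dual (vec_matroid E v) = vec_matroid E w"
    "\<And>c. c \<subseteq> E \<Longrightarrow> sum w c = 0 \<longleftrightarrow> (\<forall>Y \<subseteq> E. sum v Y = 0 \<longrightarrow> even (card (c \<inter> Y)))"
    by (rule dual_vec_representation[OF E, of v]) blast
  have "even (card c)" if "c \<subseteq> E" "sum w c = 0" for c
    using w(2)[OF that(1)] that assms(2) by (metis inf.absorb1 order_refl)
  then show ?thesis unfolding w(1) affine_vec[OF E] by blast
qed

section \<open>Recognising vector matroids\<close>

text \<open>The coordinate copy of \<open>GF(2)^r\<close> inside the infinite sequences.\<close>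

definition supp_below :: "nat \<Rightarrow> vec set" where
  "supp_below r = {x. \<forall>i\<ge>r. x i = 0}"

text \<open>The linear map that sends the \<open>j\<close>-th unit vector to \<open>u j\<close>, for
  \<open>j < r\<close>.\<close>

definition lincomb :: "(nat \<Rightarrow> vec) \<Rightarrow> nat \<Rightarrow> vec \<Rightarrow> vec" where
  "lincomb u r x = (\<lambda>i. \<Sum>j<r. x j * u j i)"

lemma lincomb_0 [simp]: "lincomb u r 0 = 0"
  by (simp add: lincomb_def fun_eq_iff)

lemma lincomb_add: "lincomb u r (x + y) = lincomb u r x + lincomb u r y"
  by (simp add: lincomb_def fun_eq_iff distrib_right sum.distrib)

lemma lincomb_sum: "lincomb u r (sum w Y) = (\<Sum>y\<in>Y. lincomb u r (w y))"
  by (induction Y rule: infinite_finite_induct)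
    (simp_all only: sum.infinite sum.empty sum.insert lincomb_0 lincomb_add not_False_eq_True)

lemma lincomb_conv_sum: "lincomb u r x = (\<Sum>j<r. if x j = 0 then 0 else u j)"
  by (auto simp: fun_eq_iff lincomb_def sum_vec_apply bit_not_zero_iff intro!: sum.cong)

lemma supp_below_0: "0 \<in> supp_below r"
  by (simp add: supp_below_def)

lemma supp_below_sum: "(\<And>y. y \<in> Y \<Longrightarrow> w y \<in> supp_below r) \<Longrightarrow> sum w Y \<in> supp_below r"
  by (simp add: supp_below_def sum_vec_apply)

lemma supp_below_finite: "finite (supp_below r)" and card_supp_below: "card (supp_below r) \<le> 2 ^ r"
proof -
  have "supp_below r \<subseteq> (\<lambda>S i. of_bool (i \<in> S)) ` Pow {..<r}" (is "_ \<subseteq> ?f ` _")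
  proof
    fix x assume x: "x \<in> supp_below r"
    have "x = ?f {i. i < r \<and> x i \<noteq> 0}"
      using x by (auto simp: fun_eq_iff supp_below_def bit_not_zero_iff not_le)
    then show "x \<in> ?f ` Pow {..<r}" by blast
  qed
  moreover have "finite (?f ` Pow {..<r})" "card (?f ` Pow {..<r}) \<le> 2 ^ r"
    using card_image_le[of "Pow {..<r}" ?f] by (auto simp: card_Pow)
  ultimately show "finite (supp_below r)" "card (supp_below r) \<le> 2 ^ r"
    using finite_subset card_mono le_trans by metis+
qed

lemma rk_supp_below:
  assumes "finite E" "\<And>x. x \<in> E \<Longrightarrow> v x \<in> supp_below r"
  shows "rk (vec_matroid E v) E \<le> r"
proof -
  have "gen v E \<subseteq> supp_below r" unfolding gen_def using assms(2) by (auto intro!: supp_below_sum)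
  then have "card (gen v E) \<le> 2 ^ r" using card_mono[OF supp_below_finite] card_supp_below le_trans by metis
  then have "(2::nat) ^ rk (vec_matroid E v) E \<le> 2 ^ r" using card_gen_rk[OF assms(1) order_refl, of v] by simp
  then show ?thesis by simp
qed

lemma iso_vecI:
  assumes E: "finite E" and g: "bij_betw g E F"
    and "\<And>Y. Y \<subseteq> E \<Longrightarrow> sum v Y = 0 \<longleftrightarrow> sum w (g ` Y) = 0"
  shows "iso (vec_matroid E v) (vec_matroid F w)"
proof -
  have "finite F" "g ` E = F" using E bij_betw_finite[OF g] bij_betw_imp_surj_on[OF g] by auto
  moreover have "free v X \<longleftrightarrow> free w (g ` X)" if "X \<subseteq> E" for X
    using that by (intro free_image assms(3)) auto
  ultimately show ?thesis unfolding iso_def using g E by (intro exI[of _ g]) (auto simp: indep_vec)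
qed

text \<open>Injectivity of \<open>lincomb u r\<close> comes from the rank hypothesis, by counting.\<close>

lemma iso_lincomb:
  assumes E: "finite E" and v: "inj_on v E" and w: "inj_on w F" "\<And>k. k \<in> F \<Longrightarrow> w k \<in> supp_below r"
    and im: "(\<lambda>k. lincomb u r (w k)) ` F = v ` E" and rk: "rk (vec_matroid E v) E = r"
  shows "iso (vec_matroid E v) (vec_matroid F w)"
proof -
  let ?L = "lincomb u r" and ?V = "supp_below r"
  have ex: "\<exists>k\<in>F. v x = ?L (w k)" if "x \<in> E" for x
    using im that by (metis (no_types, lifting) imageE imageI)
  then obtain g where g: "\<And>x. x \<in> E \<Longrightarrow> g x \<in> F" "\<And>x. x \<in> E \<Longrightarrow> v x = ?L (w (g x))" by metis
  have sumv: "sum v Y = ?L (\<Sum>x\<in>Y. w (g x))" if "Y \<subseteq> E" for Y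
    unfolding lincomb_sum using that g(2) by (intro sum.cong) auto
  have inV: "(\<Sum>x\<in>Y. w (g x)) \<in> ?V" if "Y \<subseteq> E" for Y
    using that g(1) w(2) by (intro supp_below_sum) auto
  have "gen v E \<subseteq> ?L ` ?V" unfolding gen_def using sumv inV by auto
  then have "2 ^ r \<le> card (?L ` ?V)"
    using card_gen_rk[OF E order_refl, of v] rk card_mono[OF finite_imageI[OF supp_below_finite]] by metis
  then have "card (?L ` ?V) = card ?V"
    using card_supp_below[of r] card_image_le[OF supp_below_finite, of ?L r] by simp
  then have inj: "inj_on ?L ?V" by (rule eq_card_imp_inj_on[OF supp_below_finite])
  have ginj: "inj_on g E" using g(2) v by (metis inj_onI inj_onD)
  have "g ` E = F"
  proof
    show "F \<subseteq> g ` E"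
    proof
      fix k assume k: "k \<in> F"
      then obtain x where x: "x \<in> E" "?L (w k) = v x" using im by blast
      then have "w k = w (g x)" using inj_onD[OF inj] g w(2) k by metis
      then show "k \<in> g ` E" using inj_onD[OF w(1)] g(1) x k by blast
    qed
  qed (use g in auto)
  then have bij: "bij_betw g E F" using ginj by (simp add: bij_betw_def)
  show ?thesis
  proof (rule iso_vecI[OF E bij])
    fix Y assume Y: "Y \<subseteq> E"
    have "sum w (g ` Y) = (\<Sum>x\<in>Y. w (g x))" using ginj Y by (simp add: sum.reindex inj_on_subset)
    moreover have "?L (\<Sum>x\<in>Y. w (g x)) = 0 \<longleftrightarrow> (\<Sum>x\<in>Y. w (g x)) = 0"
      using inj_onD[OF inj, of "\<Sum>x\<in>Y. w (g x)" 0] inV[OF Y] supp_below_0 by auto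
    ultimately show "sum v Y = 0 \<longleftrightarrow> sum w (g ` Y) = 0" using sumv[OF Y] by simp
  qed
qed

lemma has_minor_iso_restriction:
  assumes "finite F" "F' \<subseteq> F" "iso M (vec_matroid F' w)"
  shows "has_minor_iso (vec_matroid F w) M"
proof -
  have "delete (contract (vec_matroid F w) {}) (F - F') = vec_matroid F' w"
    using assms by (simp add: contract_empty matroid_vec delete_vec double_diff)
  then show ?thesis unfolding has_minor_iso_alt using assms(3)
    by (intro exI[of _ "{}"] exI[of _ "F - F'"]) auto
qed

text \<open>Pivoting: coordinate \<open>p\<close> of every other column is cleared by adding column
  \<open>c\<close>, that is, the columns are projected along \<open>v c\<close> onto the hyperplane
  where coordinate \<open>p\<close> vanishes.\<close>

lemma contract_vec_point:
  assumes E: "finite E" and c: "c \<in> E" "v c p \<noteq> 0"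
  shows "contract (vec_matroid E v) {c} = vec_matroid (E - {c}) (\<lambda>x. if v x p = 0 then v x else v x + v c)"
proof -
  let ?w = "\<lambda>x. if v x p = 0 then v x else v x + v c"
  have vc: "v c \<noteq> 0" "v c p = 1" using c by (auto simp: bit_not_zero_iff)
  have fc: "free v {c}" using vc unfolding free_def by (auto simp: subset_singleton_iff)
  note M = matroid_vec[OF E, of v]
  have rc: "rk (vec_matroid E v) {c} = card {c}"
    by (rule rk_indep[OF M]) (use c fc E in \<open>auto simp: indep_vec\<close>)
  have "free v (insert c X) \<longleftrightarrow> free ?w X" if X: "X \<subseteq> E - {c}" for X
  proof -
    have w: "sum ?w Y = (if sum v Y p = 0 then sum v Y else sum v Y + v c)" if "finite Y" for Y
      using that by (induction Y) (auto simp: add.assoc add.left_commute bit_not_zero_iff)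
    have fin: "Y \<subseteq> insert c X \<Longrightarrow> finite Y" for Y using X E by (meson Diff_subset finite_insert finite_subset)
    show ?thesis
    proof
      assume L: "free v (insert c X)"
      show "free ?w X" unfolding free_def
      proof (intro allI impI)
        fix Y assume Y: "Y \<subseteq> X" "sum ?w Y = 0"
        have cY: "c \<notin> Y" "finite Y" using Y X fin by auto
        then have "sum v Y = 0 \<or> sum v (insert c Y) = 0"
          using Y(2) w[OF cY(2)] by (auto simp: add.commute split: if_splits)
        moreover have "Y \<subseteq> insert c X" "insert c Y \<subseteq> insert c X" using Y by auto
        ultimately show "Y = {}" using L unfolding free_def by blast
      qed
    next
      assume R: "free ?w X"
      show "free v (insert c X)" unfolding free_def
      proof (intro allI impI)
        fix Y assume Y: "Y \<subseteq> insert c X" "sum v Y = 0"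
        have fY: "finite (Y - {c})" using fin[OF Y(1)] by simp
        have s: "sum v (Y - {c}) = (if c \<in> Y then v c else 0)"
          using Y(2) fin[OF Y(1)] by (auto simp: sum.remove[of Y c] vec_add_eq_0_iff)
        have "sum ?w (Y - {c}) = 0" unfolding w[OF fY] s using vc by auto
        moreover have "Y - {c} \<subseteq> X" using Y by auto
        ultimately have "Y - {c} = {}" using R unfolding free_def by blast
        then have "Y \<subseteq> {c}" by auto
        then show "Y = {}" using Y(2) fc unfolding free_def by blast
      qed
    qed
  qed
  moreover have "insert c X \<subseteq> E \<longleftrightarrow> X \<subseteq> E" for X using c by auto
  ultimately show ?thesis
    using E c fc by (intro matroid_eqI) (auto simp: indep_contract[OF M _ order_refl rc[symmetric]] indep_vec)
qed

section \<open>The two-dimensional obstruction in the cycle space\<close>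

text \<open>Two distinct nonempty cycles span a plane of the cycle space, so their union has nullity
  at least 2. With at most five elements its rank is at most 3, which leaves corank 2 in rank
  5.\<close>

lemma crowdedI:
  assumes E: "finite E" and rk: "rk (vec_matroid E v) E \<ge> 5"
    and Y: "Y \<subseteq> E" "sum v Y = 0" "Y \<noteq> {}" and Z: "Z \<subseteq> E" "sum v Z = 0" "Z \<noteq> {}"
    and ne: "Y \<noteq> Z" and le: "card (Y \<union> Z) \<le> 5"
  shows "crowded (vec_matroid E v) (Y \<union> Z)"
proof -
  let ?X = "Y \<union> Z" and ?M = "vec_matroid E v"
  have fin: "finite Y" "finite Z" using Y Z E finite_subset by auto
  obtain x where x: "x \<in> Y" using Y by blast
  \<comment> \<open>A cycle that avoids \<open>x\<close>. Hence some \<open>z\<close> in it is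
    spanned without \<open>x\<close>, and then \<open>x\<close> is spanned by the elements other
    than \<open>x\<close> and \<open>z\<close>.\<close>
  define Z' where "Z' = (if x \<in> Z then (Y - Z) \<union> (Z - Y) else Z)"
  have Z': "Z' \<noteq> {}" "x \<notin> Z'" "Z' \<subseteq> ?X" "sum v Z' = 0"
    using x ne Z Y sum_symdiff[OF fin, of v] unfolding Z'_def by auto
  then obtain z where z: "z \<in> Z'" by blast
  have fX: "finite ?X" "finite Z'" using fin Z' finite_subset by auto
  let ?W = "?X - {x, z}"
  have "v z = sum v (Z' - {z})" using Z' z fX(2) by (simp add: sum.remove vec_add_eq_0_iff)
  then have vz: "v z \<in> gen v ?W" using Z' gen_sum[of "Z' - {z}" ?W v] by auto
  have vx: "v x \<in> gen v ?W"
  proof -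
    have "v x = sum v (Y - {x})" using Y x fin by (simp add: sum.remove vec_add_eq_0_iff)
    moreover have "sum v (Y - {x}) \<in> gen v ?W"
    proof (rule sum_in_gen)
      fix y assume "y \<in> Y - {x}"
      then show "v y \<in> gen v ?W" using vz gen_single[of y ?W v] by (cases "y = z") auto
    qed (use fX in auto)
    ultimately show ?thesis by simp
  qed
  have "gen v ?X \<subseteq> gen v ?W"
  proof (rule gen_subset)
    fix y assume "y \<in> ?X"
    then show "v y \<in> gen v ?W" using vx vz gen_single[of y ?W v] by (cases "y = z"; cases "y = x") auto
  qed (use fX in auto)
  then have "card (gen v ?X) \<le> card (gen v ?W)" using fX by (intro card_mono finite_gen) auto
  also have "\<dots> \<le> card (Pow ?W)" unfolding gen_def using fX
    by (simp add: setcompr_eq_image card_image_le flip: Pow_def)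
  finally have "(2::nat) ^ rk ?M ?X \<le> 2 ^ card ?W" using card_gen_rk[OF E, of ?X v] Y Z fX by (simp add: card_Pow)
  then have "rk ?M ?X \<le> card ?W" by simp
  moreover have "x \<noteq> z" using z Z' by auto
  then have "card ?W + 2 = card ?X" using x z Z'(3) fX card_Diff_subset[of "{x,z}" ?X] card_mono[of ?X "{x,z}"] by auto
  ultimately show ?thesis using Y Z rk le unfolding crowded_def by auto
qed

text \<open>A crowded set of rank at most 3 contains two fundamental cycles \<open>Y\<close>,
  \<open>Z\<close> inside five elements. Together with their symmetric difference \<open>W\<close>
  they have total size twice that of \<open>Y \<union> Z\<close>, so at most 10; as each has at
  least 3 elements, two of them are triangles, and these share a point.\<close>

lemma not_crowdedI:
  assumes E: "finite E" and rk: "rk (vec_matroid E v) E \<le> 5"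
    and simp: "\<And>Y. Y \<subseteq> E \<Longrightarrow> sum v Y = 0 \<Longrightarrow> Y \<noteq> {} \<Longrightarrow> card Y \<ge> 3"
    and tri: "\<And>Y Z. Y \<subseteq> E \<Longrightarrow> Z \<subseteq> E \<Longrightarrow> sum v Y = 0 \<Longrightarrow> sum v Z = 0 \<Longrightarrow> card Y = 3 \<Longrightarrow> card Z = 3 \<Longrightarrow>
      Y \<inter> Z \<noteq> {} \<Longrightarrow> Y = Z"
  shows "\<not> crowded (vec_matroid E v) X"
proof
  let ?M = "vec_matroid E v"
  assume "crowded ?M X"
  then have X: "X \<subseteq> E" "rk ?M X + 2 \<le> card X" "rk ?M X \<le> 3" using rk unfolding crowded_def by auto
  obtain J where J: "J \<subseteq> X" "indep ?M J" "card J = rk ?M X" by (rule rk_attained[OF matroid_vec[OF E]])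
  have fX: "finite X" "finite J" using X J E finite_subset by metis+
  have "card (X - J) \<ge> 2" using X J fX by (simp add: card_Diff_subset)
  then obtain x y where xy: "x \<in> X - J" "y \<in> X - J" "x \<noteq> y" by (rule two_elements)
  have gJ: "gen v J = gen v X" using J X by (intro gen_basis[OF E]) (auto simp: indep_vec[OF E])
  have "v z \<in> gen v J" if "z \<in> X" for z unfolding gJ using that by (rule gen_single)
  then have "v x \<in> gen v J" "v y \<in> gen v J" using xy by auto
  then obtain A B where A: "A \<subseteq> J" "v x = sum v A" and B: "B \<subseteq> J" "v y = sum v B"
    unfolding gen_def by blast
  have fAB: "finite A" "finite B" using A B fX finite_subset by auto
  define Y Z where "Y = insert x A" and "Z = insert y B"
  define W where "W = (Y - Z) \<union> (Z - Y)"
  have YE: "Y \<subseteq> E" "Z \<subseteq> E" "W \<subseteq> E" using A B X J xy unfolding Y_def Z_def W_def by auto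
  have fYZ: "finite Y" "finite Z" using fAB unfolding Y_def Z_def by auto
  have nA: "x \<notin> A" "x \<notin> B" "y \<notin> A" "y \<notin> B" using A B xy by auto
  have s: "sum v Y = 0" "sum v Z = 0" unfolding Y_def Z_def using A B nA fAB by auto
  then have sW: "sum v W = 0" unfolding W_def by (simp add: sum_symdiff[OF fYZ])
  have xW: "x \<in> Y" "x \<notin> Z" "x \<in> W" "y \<in> Z" "y \<notin> Y" "y \<in> W" unfolding W_def Y_def Z_def using nA xy by auto
  have c3: "card Y \<ge> 3" "card Z \<ge> 3" "card W \<ge> 3" using simp YE s sW xW by blast+
  let ?i = "card (Y \<inter> Z)"
  have cY: "card Y = ?i + card (Y - Z)" and cZ: "card Z = ?i + card (Z - Y)"
    using card_Int_Diff[OF fYZ(1), of Z] card_Int_Diff[OF fYZ(2), of Y] by (auto simp: Int_commute)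
  have cW: "card W = card (Y - Z) + card (Z - Y)"
    unfolding W_def using fYZ by (intro card_Un_disjoint) auto
  have "Y \<union> Z \<subseteq> insert x (insert y J)" using A B unfolding Y_def Z_def by auto
  then have "card (Y \<union> Z) \<le> card (insert x (insert y J))" by (rule card_mono[rotated]) (use fX in auto)
  also have "\<dots> \<le> 5" using xy fX J X by simp
  finally have "card (Y \<union> Z) \<le> 5" .
  moreover have "card (Y \<union> Z) + ?i = card Y + card Z" using card_Un_Int[OF fYZ] by simp
  ultimately have le: "?i + card (Y - Z) + card (Z - Y) \<le> 5" using cY cZ by linarith
  consider "card Y = 3" "card Z = 3" "?i \<ge> 1" | "card Y = 3" "card W = 3" "card (Y - Z) \<ge> 1"
    | "card Z = 3" "card W = 3" "card (Z - Y) \<ge> 1"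
    using c3 cY cZ cW le by linarith
  then show False
  proof cases
    case 1
    then have "Y \<inter> Z \<noteq> {}" by auto
    then show False using tri[OF YE(1,2) s] 1 xW by auto
  next
    case 2
    then show False using tri[OF YE(1,3) s(1) sW] xW by auto
  next
    case 3
    then show False using tri[OF YE(2,3) s(2) sW] xW by auto
  qed
qed

section \<open>The four maximal matroids\<close>

text \<open>Reduces injectivity on columns, which are functions on all naturals, to distinctness of
  finite lists that can be evaluated.\<close>

lemma inj_on_cols:
  assumes "distinct (map (\<lambda>k. map (w k) [0..<n]) ks)"
  shows "inj_on (w :: nat \<Rightarrow> vec) (set ks)"
proof (rule inj_onI)
  fix x y assume "x \<in> set ks" "y \<in> set ks" "w x = w y"
  moreover from this have "map (w x) [0..<n] = map (w y) [0..<n]" by simp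
  ultimately show "x = y" using assms unfolding distinct_map by (blast dest: inj_onD)
qed

lemma small_dependency:
  assumes inj: "inj_on (w :: 'a \<Rightarrow> vec) F" and nz: "\<And>x. x \<in> F \<Longrightarrow> w x \<noteq> 0"
    and Y: "Y \<subseteq> F" "sum w Y = 0" "Y \<noteq> {}" and fin: "finite F"
  shows "card Y \<ge> 3"
proof (rule ccontr)
  assume "\<not> card Y \<ge> 3"
  moreover have "card Y \<noteq> 0" using Y fin finite_subset[of Y F] by simp
  ultimately have "card Y = 1 \<or> card Y = 2" by auto
  then show False
  proof
    assume "card Y = 1"
    then obtain x where "Y = {x}" by (auto simp: card_1_singleton_iff)
    then show False using Y nz by auto
  next
    assume "card Y = 2"
    then obtain x y where "Y = {x, y}" "x \<noteq> y" by (auto simp: card_2_iff)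
    then show False using Y inj by (auto simp: vec_add_eq_0_iff dest: inj_onD)
  qed
qed

lemma AG42_vec: "AG42 = vec_matroid {..<16} AG42_col"
  by (rule AG42_def)

lemma Z5_vec: "Z5_del_t = vec_matroid {..<10} (spike_col 5)"
  unfolding Z5_del_t_def binary_spike_def spike_tip_def
  by (subst delete_vec) (auto intro!: arg_cong2[where f = vec_matroid])

lemma AG42_supp: "AG42_col k \<in> supp_below 5"
  by (simp add: supp_below_def AG42_col_def)

lemma spike_supp: "spike_col r k \<in> supp_below r"
  by (simp add: supp_below_def spike_col_def)

lemma P10_supp: "P10_col k \<in> supp_below 5"
  by (simp add: supp_below_def P10_col_def)

lemma AG42_inj: "inj_on AG42_col {..<16}"
proof -
  have "distinct (map (\<lambda>k. map (AG42_col k) [0..<5]) [0..<16])" by code_simp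
  then show ?thesis using inj_on_cols[of AG42_col 5 "[0..<16]"] by (simp add: atLeast0LessThan)
qed

lemma spike_inj: "inj_on (spike_col 5) {..<10}"
proof -
  have "distinct (map (\<lambda>k. map (spike_col 5 k) [0..<5]) [0..<10])" by code_simp
  then show ?thesis using inj_on_cols[of "spike_col 5" 5 "[0..<10]"] by (simp add: atLeast0LessThan)
qed

lemma P10_inj: "inj_on P10_col {1..10}"
proof -
  have "distinct (map (\<lambda>k. map (P10_col k) [0..<5]) [1..<11])" by code_simp
  moreover have "set [1..<11] = {1..10}" by auto
  ultimately show ?thesis using inj_on_cols[of P10_col 5 "[1..<11]"] by simp
qed

text \<open>The last coordinate of every column is 1, so it computes the size of the set modulo
  2.\<close>

lemma AG42_even:
  assumes "finite Y" "sum AG42_col Y = 0"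
  shows "even (card Y)"
proof -
  have "(\<Sum>k\<in>Y. AG42_col k 4) = 0" using assms(2) by (simp flip: sum_vec_apply)
  then show ?thesis by (simp add: AG42_col_def of_nat_bit_eq_0_iff)
qed

lemma AG42_dependency:
  assumes "Y \<subseteq> {..<16}" "sum AG42_col Y = 0" "Y \<noteq> {}"
  shows "card Y \<ge> 4"
proof -
  have "AG42_col k \<noteq> 0" for k by (auto simp: fun_eq_iff AG42_col_def intro!: exI[of _ 4])
  then have "card Y \<ge> 3" using small_dependency[OF AG42_inj] assms by blast
  moreover have "even (card Y)" using assms by (intro AG42_even) (auto intro: finite_subset)
  ultimately show ?thesis by (cases "card Y = 3") auto
qed

lemma not_crowded_AG42: "\<not> crowded AG42 X"
  unfolding AG42_vec
proof (rule not_crowdedI)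
  show "rk (vec_matroid {..<16} AG42_col) {..<16} \<le> 5" by (rule rk_supp_below) (auto intro: AG42_supp)
  fix Y Z assume "Y \<subseteq> {..<16}" "sum AG42_col Y = 0"
  note * = AG42_dependency[OF this]
  show "Y \<noteq> {} \<Longrightarrow> 3 \<le> card Y" using * by simp
  show "card Y = 3 \<Longrightarrow> Y \<inter> Z \<noteq> {} \<Longrightarrow> Y = Z" using * by auto
qed auto

lemma spike_triples:
  assumes "{x, y, z} \<subseteq> {..<10}"
  shows "spike_col 5 x + spike_col 5 y + spike_col 5 z \<noteq> 0"
proof -
  have "\<forall>x\<in>set [0..<10]. \<forall>y\<in>set [0..<10]. \<forall>z\<in>set [0..<10]. \<exists>i\<in>set [0..<5].
      spike_col 5 x i + spike_col 5 y i + spike_col 5 z i \<noteq> 0"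
    by code_simp
  moreover have "{x, y, z} \<subseteq> set [0..<10]" using assms by auto
  ultimately obtain i where "(spike_col 5 x + spike_col 5 y + spike_col 5 z) i \<noteq> 0"
    by (metis insert_subset plus_fun_apply)
  then show ?thesis by (metis zero_fun_apply)
qed

text \<open>Column 9 is the sum of columns 1 and 4, and evaluation shows that this is the only
  triangle. Applied to each of the three points in turn, it identifies a triangle
  completely.\<close>

lemma P10_triples:
  assumes "{x, y, z} \<subseteq> {1..10}" "P10_col x + P10_col y + P10_col z = 0" "x \<noteq> y" "x \<noteq> z" "y \<noteq> z"
  shows "x \<in> {1,4,9}"
proof -
  have "\<forall>x\<in>set [1..<11]. \<forall>y\<in>set [1..<11]. \<forall>z\<in>set [1..<11]. x \<noteq> y \<longrightarrow> x \<noteq> z \<longrightarrow> y \<noteq> z \<longrightarrow> x \<in> {1,4,9} \<or> (\<exists>i\<in>set [0..<5].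
      P10_col x i + P10_col y i + P10_col z i \<noteq> 0)"
    by code_simp
  moreover have "(P10_col x + P10_col y + P10_col z) i = 0" for i unfolding assms(2) by simp
  moreover have "{x,y,z} \<subseteq> set [1..<11]" using assms by auto
  ultimately show ?thesis using assms(3-5) by (metis insert_subset plus_fun_apply)
qed

text \<open>All triangles of the spike pass through the tip, so after its deletion the condition on
  pairs of triangles is vacuous.\<close>

lemma not_crowded_Z5: "\<not> crowded Z5_del_t X"
  unfolding Z5_vec
proof (rule not_crowdedI)
  show "rk (vec_matroid {..<10} (spike_col 5)) {..<10} \<le> 5" by (rule rk_supp_below) (auto intro: spike_supp)
  \<comment> \<open>\<open>spike_triples\<close> admits repetitions, and three equal columns sum to
    that column.\<close>
  have nz: "spike_col 5 x \<noteq> 0" if "x \<in> {..<10}" for x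
    using spike_triples[of x x x] that by auto
  fix Y :: "nat set" assume Y: "Y \<subseteq> {..<10}" "sum (spike_col 5) Y = 0"
  show "Y \<noteq> {} \<Longrightarrow> 3 \<le> card Y" using small_dependency[OF spike_inj nz] Y by auto
  fix Z assume "card Y = 3"
  then obtain x y z where xyz: "Y = {x,y,z}" "x \<noteq> y" "y \<noteq> z" "x \<noteq> z" by (auto simp: card_3_iff)
  then show "Y = Z" using spike_triples[of x y z] Y by (auto simp: ac_simps)
qed auto

lemma not_crowded_P10: "\<not> crowded P10 X"
  unfolding P10_def
proof (rule not_crowdedI)
  show "rk (vec_matroid {1..10} P10_col) {1..10} \<le> 5" by (rule rk_supp_below) (auto intro: P10_supp)
  have nz: "P10_col x \<noteq> 0" if "x \<in> {1..10}" for x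
  proof
    assume "P10_col x = 0"
    have "\<forall>x\<in>set [1..<11]. \<exists>i\<in>set [0..<5]. P10_col x i \<noteq> 0" by code_simp
    moreover have "x \<in> set [1..<11]" using that by auto
    ultimately show False using \<open>P10_col x = 0\<close> by (metis zero_fun_apply)
  qed
  have tri: "Y = {1,4,9}" if Y: "Y \<subseteq> {1..10}" "sum P10_col Y = 0" "card Y = 3" for Y
  proof -
    obtain x y z where xyz: "Y = {x,y,z}" "x \<noteq> y" "y \<noteq> z" "x \<noteq> z" using Y(3) by (auto simp: card_3_iff)
    then have "P10_col x + P10_col y + P10_col z = 0" using Y(2) by (simp add: ac_simps)
    then have "x \<in> {1,4,9}" "y \<in> {1,4,9}" "z \<in> {1,4,9}"
      using P10_triples[of x y z] P10_triples[of y x z] P10_triples[of z x y] Y xyz by (auto simp: ac_simps)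
    then have "Y \<subseteq> {1,4,9}" using xyz by auto
    then show ?thesis using Y(3) by (intro card_subset_eq) auto
  qed
  fix Y Z :: "nat set" assume Y: "Y \<subseteq> {1..10}" "sum P10_col Y = 0"
  show "Y \<noteq> {} \<Longrightarrow> 3 \<le> card Y" using small_dependency[OF P10_inj nz] Y by auto
  show "Z \<subseteq> {1..10} \<Longrightarrow> sum P10_col Z = 0 \<Longrightarrow> card Y = 3 \<Longrightarrow> card Z = 3 \<Longrightarrow> Y = Z" using tri Y by metis
qed auto

section \<open>Simple binary matroids as minors of AG(4,2)\<close>

lemma bits_exist:
  fixes p :: "nat \<Rightarrow> bool"
  obtains k :: nat where "k < 16" "\<And>i. i < 4 \<Longrightarrow> odd (k div 2 ^ i) \<longleftrightarrow> p i"
proof -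
  define k :: nat where "k = of_bool (p 0) + 2 * of_bool (p 1) + 4 * of_bool (p 2) + 8 * of_bool (p 3)"
  have "k < 16 \<and> (odd (k div 2 ^ 0) \<longleftrightarrow> p 0) \<and> (odd (k div 2 ^ 1) \<longleftrightarrow> p 1) \<and> (odd (k div 2 ^ 2) \<longleftrightarrow> p 2)
      \<and> (odd (k div 2 ^ 3) \<longleftrightarrow> p 3)"
    unfolding k_def by (cases "p 0"; cases "p 1"; cases "p 2"; cases "p 3") simp_all
  moreover have "i < 4 \<Longrightarrow> i = 0 \<or> i = 1 \<or> i = 2 \<or> i = 3" for i :: nat by auto
  ultimately show ?thesis using that by metis
qed

lemma sum_as_if:
  assumes "T \<subseteq> {..<r::nat}"
  shows "sum f T = (\<Sum>j<r. if j \<in> T then f j else 0)"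
  using sum.inter_restrict[of "{..<r}" f T] assms by (simp add: Int_absorb1)

lemma enumerated_basis:
  fixes E :: "'a set"
  assumes E: "finite E" and rk: "rk (vec_matroid E v) E = r"
  obtains b :: "nat \<Rightarrow> 'a" where "inj_on b {..<r}" "b ` {..<r} \<subseteq> E" "free v (b ` {..<r})" "gen v (b ` {..<r}) = gen v E"
proof -
  obtain B where B: "B \<subseteq> E" "indep (vec_matroid E v) B" "card B = r"
    using rk_attained[OF matroid_vec[OF E]] rk by metis
  have "finite B" using B E finite_subset by auto
  then obtain b where b: "bij_betw b {..<r} B" using ex_bij_betw_nat_finite[of B] B(3) by (auto simp: atLeast0LessThan)
  then have "b ` {..<r} = B" "inj_on b {..<r}" by (auto simp: bij_betw_def)
  moreover have "gen v B = gen v E" using B rk by (intro gen_basis[OF E]) (auto simp: indep_vec[OF E])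
  ultimately show ?thesis using that[of b] B by (simp add: indep_vec[OF E])
qed

lemma expand_in_basis:
  assumes "inj_on b {..<r}" "gen v (b ` {..<r}) = gen v E" "x \<in> E"
  obtains T where "T \<subseteq> {..<r}" "v x = sum (v \<circ> b) T"
proof -
  have "v x \<in> gen v (b ` {..<r})" using assms gen_single by metis
  then obtain A where A: "A \<subseteq> b ` {..<r}" "v x = sum v A" unfolding gen_def by blast
  then obtain T where T: "T \<subseteq> {..<r}" "A = b ` T" by (meson subset_imageE)
  then show ?thesis using that[of T] A assms(1) by (simp add: sum.reindex inj_on_subset)
qed

lemma simple_vec:
  assumes E: "finite E" and s: "simple (vec_matroid E v)"
  shows "inj_on v E" and "\<And>x. x \<in> E \<Longrightarrow> v x \<noteq> 0"
proof -
  have fr: "free v X" if "X \<subseteq> E" "card X \<le> 2" for X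
    using s that unfolding simple_def by (auto simp: indep_vec[OF E])
  show "inj_on v E"
  proof (rule inj_onI, rule ccontr)
    fix x y assume "x \<in> E" "y \<in> E" "v x = v y" "x \<noteq> y"
    moreover from this have "sum v {x,y} = 0" "free v {x,y}" using fr[of "{x,y}"] by auto
    ultimately show False unfolding free_def by blast
  qed
  fix x assume "x \<in> E"
  then have "free v {x}" using fr[of "{x}"] by auto
  then have "sum v {x} \<noteq> 0" unfolding free_def by blast
  then show "v x \<noteq> 0" by simp
qed

text \<open>In an affine matroid every column is a sum of an odd number of basis columns, since a
  column off the basis closes a cycle of even size. Oddness is the equation of an affine hyperplane
  missing the origin.\<close>

lemma affine_rank5_vec_minor_AG42:
  fixes E :: "'a set"
  assumes E: "finite E" and s: "simple (vec_matroid E v)" and rk: "rk (vec_matroid E v) E = 5"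
    and aff: "affine (vec_matroid E v)"
  shows "has_minor_iso AG42 (vec_matroid E v)"
proof -
  have ev: "even (card Y)" if "Y \<subseteq> E" "sum v Y = 0" for Y using aff that unfolding affine_vec[OF E] by blast
  obtain b :: "nat \<Rightarrow> 'a" where b: "inj_on b {..<5}" "b ` {..<5} \<subseteq> E" "free v (b ` {..<5})" "gen v (b ` {..<5}) = gen v E"
    by (rule enumerated_basis[OF E rk])
  \<comment> \<open>Chosen so that a sum of basis columns has \<open>u 4\<close>-coefficient equal
    to the parity of the number of summands; for odd sums this is the constant last coordinate of
    \<open>AG42_col\<close>.\<close>
  define u where "u j = (if j < 4 then v (b j) + v (b 4) else v (b 4))" for j :: nat
  have ex: "\<exists>k<16. lincomb u 5 (AG42_col k) = v x" if x: "x \<in> E" for x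
  proof -
    obtain T where T: "T \<subseteq> {..<5}" "v x = sum (v \<circ> b) T" by (rule expand_in_basis[OF b(1,4) x])
    have fT: "finite T" "inj_on b T" using T b(1) by (auto intro: finite_subset inj_on_subset)
    have cT: "card (b ` T) = card T" using fT by (simp add: card_image)
    have sT: "sum v (b ` T) = v x" using T fT by (simp add: sum.reindex)
    have odd: "odd (card T)"
    proof (cases "x \<in> b ` T")
      case True
      have sub: "b ` T \<subseteq> b ` {..<5}" "{x} \<subseteq> b ` {..<5}" using T True by auto
      have "b ` T = {x}" using free_inj[OF b(3) _ sub] sT by simp
      then show ?thesis unfolding cT[symmetric] by simp
    next
      case False
      then have "sum v (insert x (b ` T)) = 0" using sT fT by simp
      moreover have "insert x (b ` T) \<subseteq> E" using x T b(2) by auto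
      ultimately have "even (card (insert x (b ` T)))" by (rule ev[rotated])
      then show ?thesis using False fT cT by simp
    qed
    obtain k :: nat where k: "k < 16" "\<And>i. i < 4 \<Longrightarrow> odd (k div 2 ^ i) \<longleftrightarrow> i \<in> T" by (rule bits_exist[of "\<lambda>i. i \<in> T"]) blast
    have five: "{..<5} = {0,1,2,3,4::nat}" by auto
    have v': "v x = (\<Sum>j<5. if j \<in> T then v (b j) else 0)"
      unfolding T(2) sum_as_if[OF T(1)] o_def by (rule refl)
    have c': "card T = (\<Sum>j<5. if j \<in> T then 1 else 0)"
      unfolding card_eq_sum by (rule sum_as_if[OF T(1)])
    have col: "AG42_col k j = of_bool (j \<in> T)" if "j < 4" for j using k that by (simp add: AG42_col_def)
    have "lincomb u 5 (AG42_col k) = v x"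
      using odd unfolding v' c' lincomb_conv_sum five u_def
      by (cases "0 \<in> T"; cases "1 \<in> T"; cases "2 \<in> T"; cases "3 \<in> T"; cases "4 \<in> T")
        (simp_all add: col AG42_col_def[of k 4] ac_simps)
    then show ?thesis using k by blast
  qed
  define F where "F = {k. k < 16 \<and> lincomb u 5 (AG42_col k) \<in> v ` E}"
  have "iso (vec_matroid E v) (vec_matroid F AG42_col)"
  proof (rule iso_lincomb[OF E])
    show "inj_on AG42_col F" by (rule inj_on_subset[OF AG42_inj]) (auto simp: F_def)
    show "(\<lambda>k. lincomb u 5 (AG42_col k)) ` F = v ` E" unfolding F_def using ex by force
  qed (use simple_vec[OF E s] rk AG42_supp in auto)
  then show ?thesis unfolding AG42_vec by (rule has_minor_iso_restriction[rotated 2]) (auto simp: F_def)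
qed

text \<open>\<open>AG42\<close> contracted by a point is the projective geometry of rank 4.\<close>

lemma rank4_vec_minor_AG42:
  assumes E: "finite E" and s: "simple (vec_matroid E v)" and rk: "rk (vec_matroid E v) E \<le> 4"
  shows "has_minor_iso AG42 (vec_matroid E v)"
proof -
  define r where "r = rk (vec_matroid E v) E"
  have r: "r \<le> 4" using rk r_def by simp
  \<comment> \<open>Column 0 is the last unit vector, so pivoting on coordinate 4 just erases that
    coordinate: \<open>w k\<close> is the binary expansion of \<open>k\<close>.\<close>
  define w where "w k = (if AG42_col k 4 = 0 then AG42_col k else AG42_col k + AG42_col 0)" for k
  have w: "w k i = of_bool (i < 4 \<and> odd (k div 2 ^ i))" for k i
    by (auto simp: w_def AG42_col_def)
  have con: "contract AG42 {0} = vec_matroid ({..<16} - {0}) w"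
    unfolding AG42_vec w_def by (rule contract_vec_point) (auto simp: AG42_col_def)
  obtain b where b: "inj_on b {..<r}" "b ` {..<r} \<subseteq> E" "free v (b ` {..<r})" "gen v (b ` {..<r}) = gen v E"
    by (rule enumerated_basis[OF E r_def[symmetric]])
  have ex: "\<exists>k<16. w k \<in> supp_below r \<and> lincomb (v \<circ> b) r (w k) = v x" if x: "x \<in> E" for x
  proof -
    obtain T where T: "T \<subseteq> {..<r}" "v x = sum (v \<circ> b) T" by (rule expand_in_basis[OF b(1,4) x])
    obtain k :: nat where k: "k < 16" "\<And>i. i < 4 \<Longrightarrow> odd (k div 2 ^ i) \<longleftrightarrow> i \<in> T" by (rule bits_exist[of "\<lambda>i. i \<in> T"]) blast
    have "i \<in> T \<Longrightarrow> i < 4" for i using T r by auto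
    then have wk: "w k i = of_bool (i \<in> T)" for i using k(2)[of i] by (auto simp: w)
    have "lincomb (v \<circ> b) r (w k) = v x" unfolding lincomb_conv_sum T(2) sum_as_if[OF T(1)]
      by (rule sum.cong) (auto simp: wk)
    moreover have "w k \<in> supp_below r" using T by (auto simp: supp_below_def wk)
    ultimately show ?thesis using k by blast
  qed
  \<comment> \<open>The support condition matters when \<open>r < 4\<close>: without it different
    \<open>k\<close> would have the same image under \<open>lincomb\<close>, which sees only the
    first \<open>r\<close> coordinates.\<close>
  define F where "F = {k. k < 16 \<and> w k \<in> supp_below r \<and> lincomb (v \<circ> b) r (w k) \<in> v ` E}"
  have "0 \<notin> F"
  proof
    assume "0 \<in> F"
    moreover have "w 0 = 0" by (simp add: w fun_eq_iff)
    ultimately show False using simple_vec(2)[OF E s] by (auto simp: F_def)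
  qed
  then have F: "F \<subseteq> {..<16} - {0}" by (auto simp: F_def)
  have w': "w k + AG42_col 0 = AG42_col k" for k by (auto simp: fun_eq_iff w AG42_col_def)
  have iso: "iso (vec_matroid E v) (vec_matroid F w)"
  proof (rule iso_lincomb[OF E])
    show "inj_on w F"
    proof (rule inj_onI)
      fix k l assume "k \<in> F" "l \<in> F" "w k = w l"
      then show "k = l" using w'[of k] w'[of l] inj_onD[OF AG42_inj, of k l] by (simp add: F_def)
    qed
    show "(\<lambda>k. lincomb (v \<circ> b) r (w k)) ` F = v ` E" unfolding F_def using ex by force
  qed (use simple_vec[OF E s] r_def in \<open>auto simp: F_def\<close>)
  have "delete (contract AG42 {0}) ({..<16} - {0} - F) = vec_matroid F w"
    unfolding con using F by (subst delete_vec) (auto simp: double_diff)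
  then show ?thesis unfolding has_minor_iso_alt using iso
    by (intro exI[of _ "{0}"] exI[of _ "{..<16} - {0} - F"]) (auto simp: AG42_vec)
qed

text \<open>The points 0, 1, 2, 3 form an affine plane, hence a 4-circuit; contracting two of them
  makes the other two parallel. This covers the one tiny 3-connected matroid that is neither simple
  nor cosimple.\<close>

lemma U12_minor_AG42:
  assumes g: "ground M = {x, y}" "x \<noteq> y" and i: "\<And>X. indep M X \<longleftrightarrow> X \<subseteq> {x, y} \<and> X \<noteq> {x, y}"
  shows "has_minor_iso AG42 M"
proof -
  let ?C = "{0, 1::nat}" and ?D = "{..<16} - {0, 1, 2, 3::nat}"
  have M: "matroid AG42" unfolding AG42_vec by (simp add: matroid_vec)
  have ind: "indep AG42 X" if X: "X \<subseteq> {..<16}" "card X \<le> 3" for X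
  proof -
    have "Y = {}" if Y: "Y \<subseteq> X" "sum AG42_col Y = 0" for Y
    proof (rule ccontr)
      assume "Y \<noteq> {}"
      moreover have "card Y \<le> card X" using Y X by (intro card_mono) (auto intro: finite_subset)
      ultimately show False using AG42_dependency[of Y] X Y by auto
    qed
    then show ?thesis unfolding AG42_vec using X by (auto simp: indep_vec free_def)
  qed
  have C: "indep AG42 ?C" by (rule ind) auto
  have ground: "ground AG42 = {..<16}" by (simp add: AG42_vec)
  note ic = indep_contract[OF M C order_refl rk_indep[OF M C, symmetric]]
  have dep: "\<not> indep AG42 {0,1,2,3}"
  proof -
    have "sum AG42_col {0,1,2,3} i = 0" for i
    proof -
      have "i = 0 \<or> i = 1 \<or> i = 2 \<or> i = 3 \<or> i = 4 \<or> i > 4" by arith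
      then show ?thesis by (elim disjE) (simp_all add: AG42_col_def sum_vec_apply)
    qed
    then have "sum AG42_col {0,1,2,3} = 0" by (simp add: fun_eq_iff)
    then have "\<not> free AG42_col {0,1,2,3}" unfolding free_def by blast
    then show ?thesis unfolding AG42_vec by (simp add: indep_vec)
  qed
  define f where "f z = (if z = x then 2 else 3::nat)" for z
  have ground': "ground (delete (contract AG42 ?C) ?D) = {2, 3}" by (auto simp: ground)
  have N: "indep (delete (contract AG42 ?C) ?D) Y \<longleftrightarrow> Y \<noteq> {2,3}" if "Y \<subseteq> {2,3}" for Y
  proof -
    have Y: "Y = {} \<or> Y = {2} \<or> Y = {3} \<or> Y = {2,3}" using that by auto
    have "indep (delete (contract AG42 ?C) ?D) Y \<longleftrightarrow> indep AG42 (Y \<union> ?C)"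
      unfolding indep_delete ic ground using that by auto
    moreover have "indep AG42 ({} \<union> ?C)" "indep AG42 ({2} \<union> ?C)" "indep AG42 ({3} \<union> ?C)"
      by (rule ind; simp)+
    moreover have "{2,3} \<union> ?C = {0,1,2,3}" by auto
    ultimately show ?thesis using dep Y by (elim disjE) simp_all
  qed
  have "iso M (delete (contract AG42 ?C) ?D)" unfolding iso_def ground' g(1)
  proof (intro exI[of _ f] conjI allI impI)
    show "bij_betw f {x, y} {2, 3}" using g(2) by (auto simp: bij_betw_def f_def)
    fix X assume X: "X \<subseteq> {x, y}"
    then have "X \<in> {{}, {x}, {y}, {x,y}}" by auto
    moreover have "f ` X \<subseteq> {2,3}" by (auto simp: f_def)
    ultimately show "indep M X \<longleftrightarrow> indep (delete (contract AG42 ?C) ?D) (f ` X)"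
      unfolding i using N[of "f ` X"] g(2) by (auto simp: f_def)
  qed
  then show ?thesis unfolding has_minor_iso_alt
    by (intro exI[of _ ?C] exI[of _ ?D]) (auto simp: AG42_vec)
qed

section \<open>Point sets of rank 5\<close>

abbreviation (input) idv :: "vec \<Rightarrow> vec" where "idv \<equiv> \<lambda>x. x"

text \<open>Here \<open>x\<close> is the common point. Agreement in one more point suffices, as two
  points of a triangle determine the third.\<close>

definition disjoint_triangles :: "vec set \<Rightarrow> bool" where
  "disjoint_triangles S \<longleftrightarrow> (\<forall>x y z y' z'. {x, y, z, y', z'} \<subseteq> S \<longrightarrow> x = y + z \<longrightarrow> x = y' + z' \<longrightarrow> y' = y \<or> y' = z)"

lemma disjoint_trianglesD:
  assumes "disjoint_triangles S" "x = y + z" "x = y' + z'" "{x, y, z, y', z'} \<subseteq> S"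
  shows "y' = y \<or> y' = z"
  using assms(1)[unfolded disjoint_triangles_def, rule_format, OF assms(4,2,3)] .

lemma extend_free:
  assumes "finite S" "free v I" "I \<subseteq> S"
  obtains J where "I \<subseteq> J" "J \<subseteq> S" "free v J" "gen v J = gen v S"
proof -
  note M = matroid_vec[OF assms(1), of v]
  obtain J where "I \<subseteq> J" "J \<subseteq> S" "indep (vec_matroid S v) J" "card J = rk (vec_matroid S v) S"
    using extend_to_basis_of[OF M, of I S] assms by (auto simp: indep_vec)
  then show ?thesis using that[of J] gen_basis[OF assms(1)] by (auto simp: indep_vec[OF assms(1)])
qed

section \<open>Rank-5 point sets containing a triangle\<close>

lemma sum_imageE:
  assumes "s \<in> (\<lambda>(t, q). t + q) ` (A \<times> B)"
  obtains t q where "t \<in> A" "q \<in> B" "s = t + q"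
  using assms by auto

lemma free_pair: "a \<noteq> 0 \<Longrightarrow> b \<noteq> 0 \<Longrightarrow> a + b \<noteq> 0 \<Longrightarrow> free idv {a, b}"
  unfolding free_def
proof (intro allI impI)
  fix Y assume *: "a \<noteq> 0" "b \<noteq> 0" "a + b \<noteq> 0" "Y \<subseteq> {a, b}" "sum idv Y = 0"
  have "a \<noteq> b" using * by auto
  then have "sum idv Y \<noteq> 0" if "Y = {a} \<or> Y = {b} \<or> Y = {a, b}" using *(1-3) that by auto
  moreover have "Y = {} \<or> Y = {a} \<or> Y = {b} \<or> Y = {a,b}" using *(4) by auto
  ultimately show "Y = {}" using *(5) by blast
qed

text \<open>Each coset of a triangle's span, other than the span itself, meets the set in at most one point.\<close>

lemma triangle_normal_form:
  assumes S: "finite S" "card (gen idv S) = 32" "0 \<notin> S" "disjoint_triangles S"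
    and T: "a \<in> S" "b \<in> S" "a + b \<in> S" and big: "card S \<ge> 10"
  obtains d e f \<alpha> \<beta> \<gamma> \<delta> where "{\<alpha>, \<beta>, \<gamma>, \<delta>} \<subseteq> {0, a, b, a + b}"
    "S = {a, b, a + b, d, e, f, d + e + \<alpha>, d + f + \<beta>, e + f + \<gamma>, d + e + f + \<delta>}" "card S = 10"
proof -
  have ab: "a \<noteq> 0" "b \<noteq> 0" "a + b \<noteq> 0" using S T by auto
  have ne: "a \<noteq> b" using ab by auto
  let ?T = "{a, b, a + b}" and ?V = "{0, a, b, a + b}"
  obtain J where J: "{a, b} \<subseteq> J" "J \<subseteq> S" "free idv J" "gen idv J = gen idv S"
    using extend_free[OF S(1) free_pair[OF ab]] T by blast
  have fJ: "finite J" using J S finite_subset by blast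
  have "(2::nat) ^ card J = 2 ^ 5" using card_gen[OF J(3) fJ] J(4) S(2) by simp
  then have "card J = 5" by (metis one_less_numeral_iff power_inject_exp semiring_norm(76))
  then have "card (J - {a, b}) = 3" using J(1) ne by (simp add: card_Diff_subset)
  then obtain d e f where def_: "J - {a, b} = {d, e, f}" "d \<noteq> e" "e \<noteq> f" "d \<noteq> f" by (auto simp: card_3_iff)
  \<comment> \<open>Representatives of the eight cosets of the span \<open>?V\<close> of the
    triangle.\<close>
  let ?Q = "{0, d, e, f, d + e, d + f, e + f, d + e + f}"
  have Jeq: "J = {a, b} \<union> {d, e, f}" using def_(1) J(1) by blast
  have defS: "d \<in> S" "e \<in> S" "f \<in> S" using J(2) Jeq by auto
  have surj: "gen idv S \<subseteq> (\<lambda>(t, q). t + q) ` (?V \<times> ?Q)"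
  proof
    fix s assume "s \<in> gen idv S"
    then have "s \<in> gen idv J" using J(4) by simp
    then obtain Y where Y: "Y \<subseteq> J" "s = sum idv Y" unfolding gen_def by blast
    have dis: "{a, b} \<inter> {d, e, f} = {}" using def_(1) by blast
    have fY: "finite Y" using Y fJ finite_subset by blast
    have "Y = (Y \<inter> {a, b}) \<union> (Y \<inter> {d, e, f})" using Y(1) Jeq by blast
    then have s: "s = sum idv (Y \<inter> {a, b}) + sum idv (Y \<inter> {d, e, f})"
      unfolding Y(2) using fY dis by (subst sum.union_disjoint[symmetric]) auto
    have "sum idv (Y \<inter> {a, b}) \<in> ?V" using ne by (cases "a \<in> Y"; cases "b \<in> Y") auto
    moreover have "sum idv (Y \<inter> {d, e, f}) \<in> ?Q"
      using def_(2-4) by (cases "d \<in> Y"; cases "e \<in> Y"; cases "f \<in> Y") (auto simp: ac_simps)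
    ultimately have "(sum idv (Y \<inter> {a, b}), sum idv (Y \<inter> {d, e, f})) \<in> ?V \<times> ?Q" by (rule SigmaI)
    then show "s \<in> (\<lambda>(t, q). t + q) ` (?V \<times> ?Q)" unfolding s by (rule rev_image_eqI) simp
  qed
  \<comment> \<open>Only upper bounds are available directly. As the at most 4 * 8 sums must fill a
    span of size 32, they are pairwise different, so the decomposition into a \<open>?V\<close> part
    and a \<open>?Q\<close> part is unique.\<close>
  have cT: "card ?V \<le> 4" using card_length[of "[0, a, b, a + b]"] by simp
  have cQ: "card ?Q \<le> 8" using card_length[of "[0, d, e, f, d + e, d + f, e + f, d + e + f]"] by simp
  have cardle: "card (?V \<times> ?Q) \<le> 32" using mult_le_mono[OF cT cQ] by (simp only: card_cartesian_product)
  have "32 \<le> card ((\<lambda>(t, q). t + q) ` (?V \<times> ?Q))"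
    using card_mono[OF _ surj] S(2) by simp
  then have "card ((\<lambda>(t, q). t + q) ` (?V \<times> ?Q)) = card (?V \<times> ?Q)"
    using cardle card_image_le[of "?V \<times> ?Q" "\<lambda>(t, q). t + q"] by auto
  then have inj: "inj_on (\<lambda>(t, q). t + q) (?V \<times> ?Q)" by (rule eq_card_imp_inj_on[rotated]) auto
  have ex: "\<exists>t\<in>?V. \<exists>q\<in>?Q - {0}. s = t + q" if s: "s \<in> S - ?T" for s
  proof -
    have "s \<in> gen idv S" using s gen_single[of s S idv] by auto
    then have "s \<in> (\<lambda>(t, q). t + q) ` (?V \<times> ?Q)" by (rule subsetD[OF surj])
    then obtain t q where tq: "t \<in> ?V" "q \<in> ?Q" "s = t + q" by (rule sum_imageE)
    moreover have "q \<noteq> 0"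
    proof
      assume "q = 0"
      then have "s \<in> ?V" using tq by simp
      then show False using s S(3) by auto
    qed
    ultimately show ?thesis by blast
  qed
  have closed: "t + t' \<in> ?V" if "t \<in> ?V" "t' \<in> ?V" for t t' using that by (auto simp: ac_simps)
  have TS: "?T \<subseteq> S" using T by auto
  have tri: "\<exists>y z. t = y + z \<and> y \<in> ?T \<and> z \<in> ?T" if "t \<in> ?T" for t
  proof -
    have "a = b + (a + b)" "b = a + (a + b)" by (simp_all add: ac_simps)
    then show ?thesis using that by blast
  qed
  \<comment> \<open>Two points of one coset differ by a point \<open>t\<close> of the triangle and
    thus form a second triangle through \<open>t\<close>.\<close>
  have coset: "s = s'" if s: "s \<in> S - ?T" "s' \<in> S - ?T" "s + s' \<in> ?V" for s s'
  proof (rule ccontr)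
    assume "s \<noteq> s'"
    then have "s + s' \<in> ?T" using s(3) by (auto simp: vec_add_eq_0_iff)
    then obtain y z where yz: "s + s' = y + z" "y \<in> ?T" "z \<in> ?T" using tri by blast
    have "{s + s', s, s', y, z} \<subseteq> S" using s yz(2,3) \<open>s + s' \<in> ?T\<close> TS by blast
    from disjoint_trianglesD[OF S(4) refl yz(1) this] show False using s yz(2) by blast
  qed
  define q where "q s = (SOME q. q \<in> ?Q - {0} \<and> (\<exists>t\<in>?V. s = t + q))" for s
  have q: "q s \<in> ?Q - {0}" "\<exists>t\<in>?V. s = t + q s" if "s \<in> S - ?T" for s
    using someI_ex[of "\<lambda>q. q \<in> ?Q - {0} \<and> (\<exists>t\<in>?V. s = t + q)"] ex[OF that] unfolding q_def by blast+
  have qinj: "inj_on q (S - ?T)"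
  proof (rule inj_onI)
    fix s s' assume s: "s \<in> S - ?T" "s' \<in> S - ?T" "q s = q s'"
    obtain t t' where t: "t \<in> ?V" "s = t + q s" "t' \<in> ?V" "s' = t' + q s" using q(2)[OF s(1)] q(2)[OF s(2)] s(3) by metis
    then have "s + s' = t + t'" by (metis (no_types, opaque_lifting) add.commute add.left_commute vec_add_self_left)
    then have "s + s' \<in> ?V" by (simp only: closed[OF t(1,3)])
    then show "s = s'" by (rule coset[OF s(1,2)])
  qed
  have "card ?T = 3" using ab ne by (auto simp: card_insert_if vec_add_eq_iff)
  then have cS: "card S = card (S - ?T) + 3" using T S(1) card_mono[of S ?T] by (subst card_Diff_subset) auto
  have cQ0: "card (?Q - {0}) \<le> 7"
  proof -
    have "?Q - {0} \<subseteq> set [d, e, f, d + e, d + f, e + f, d + e + f]" by auto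
    then have "card (?Q - {0}) \<le> card (set [d, e, f, d + e, d + f, e + f, d + e + f])" by (rule card_mono[rotated]) simp
    also have "\<dots> \<le> 7" using card_length[of "[d, e, f, d + e, d + f, e + f, d + e + f]"] by simp
    finally show ?thesis .
  qed
  have sub: "q ` (S - ?T) \<subseteq> ?Q - {0}" by (rule image_subsetI, rule q(1))
  have cq: "card (q ` (S - ?T)) = card (S - ?T)" by (rule card_image[OF qinj])
  have fQ: "finite (?Q - {0})" by simp
  have onto: "q ` (S - ?T) = ?Q - {0}"
    by (rule card_seteq[OF fQ sub]) (use cQ0 cq cS big in linarith)
  have c10: "card S = 10" using cQ0 cq[unfolded onto] cS big by linarith
  have ex': "\<exists>t\<in>?V. t + p \<in> S - ?T" if "p \<in> ?Q - {0}" for p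
  proof -
    have "p \<in> q ` (S - ?T)" unfolding onto by (rule that)
    then obtain s where s: "p = q s" "s \<in> S - ?T" by (rule imageE)
    then obtain t where "t \<in> ?V" "s = t + p" using q(2) by metis
    then show ?thesis using s by blast
  qed
  have dj: "x + y \<noteq> 0 \<and> x \<noteq> 0" if "x \<in> {d,e,f}" "y \<in> {d,e,f}" "x \<noteq> y" for x y
    using that defS S(3) by (auto simp: vec_add_eq_0_iff)
  have def0: "d + e + f \<noteq> 0"
  proof
    assume "d + e + f = 0"
    then have "sum idv {d, e, f} = 0" using def_(2-4) by (simp add: ac_simps)
    then show False using J(3) Jeq unfolding free_def by blast
  qed
  \<comment> \<open>With at least 10 points each of the seven cosets is met. The cosets of
    \<open>d\<close>, \<open>e\<close>, \<open>f\<close> are met in these basis vectors themselves;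
    the points in the other four are recorded by their offsets from the coset
    representatives.\<close>
  obtain \<alpha> where \<alpha>: "\<alpha> \<in> ?V" "\<alpha> + (d + e) \<in> S - ?T" using ex'[of "d + e"] dj[of d e] def_ by blast
  obtain \<beta> where \<beta>: "\<beta> \<in> ?V" "\<beta> + (d + f) \<in> S - ?T" using ex'[of "d + f"] dj[of d f] def_ by blast
  obtain \<gamma> where \<gamma>: "\<gamma> \<in> ?V" "\<gamma> + (e + f) \<in> S - ?T" using ex'[of "e + f"] dj[of e f] def_ by blast
  obtain \<delta> where \<delta>: "\<delta> \<in> ?V" "\<delta> + (d + e + f) \<in> S - ?T" using ex'[of "d + e + f"] def0 by blast
  have nT: "x \<notin> ?T" if "x \<in> {d,e,f}" for x
  proof
    assume "x \<in> ?T"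
    then have "(x, 0) \<in> ?V \<times> ?Q" "(0, x) \<in> ?V \<times> ?Q" using that by auto
    then have "(x, 0) = (0, x)" using inj_onD[OF inj, of "(x, 0)" "(0, x)"] by simp
    then show False using that defS S(3) by auto
  qed
  let ?R = "{a, b, a + b, d, e, f, d + e + \<alpha>, d + f + \<beta>, e + f + \<gamma>, d + e + f + \<delta>}"
  have "S \<subseteq> ?R"
  proof
    fix s assume s: "s \<in> S"
    show "s \<in> ?R"
    proof (cases "s \<in> ?T")
      case False
      then obtain t p where tp: "t \<in> ?V" "p \<in> ?Q - {0}" "s = t + p" using ex[of s] s by blast
      have eq: "s = t' + p" if "t' \<in> ?V" "t' + p \<in> S - ?T" for t'
      proof (rule coset)
        have "s + (t' + p) = t + t'" unfolding tp(3) by (simp add: ac_simps)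
        then show "s + (t' + p) \<in> ?V" by (simp only: closed[OF tp(1) that(1)])
      qed (use s False that in auto)
      have eq0: "s = p" if "p \<in> {d,e,f}" using eq[of 0] nT[OF that] that defS by auto
      have "p = d \<or> p = e \<or> p = f \<or> p = d + e \<or> p = d + f \<or> p = e + f \<or> p = d + e + f" using tp(2) by auto
      then show ?thesis
        using eq0 eq[OF \<alpha>(1)] eq[OF \<beta>(1)] eq[OF \<gamma>(1)] eq[OF \<delta>(1)] \<alpha>(2) \<beta>(2) \<gamma>(2) \<delta>(2)
        by (elim disjE) (simp_all add: ac_simps)
    qed auto
  qed
  moreover have "?R \<subseteq> S" using T defS \<alpha> \<beta> \<gamma> \<delta> by (simp add: ac_simps)
  ultimately have "S = ?R" by (rule subset_antisym)
  then show ?thesis using that[of \<alpha> \<beta> \<gamma> \<delta> d e f] \<alpha>(1) \<beta>(1) \<gamma>(1) \<delta>(1) c10 by simp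
qed

text \<open>The triangle normal form with the three pair offsets equal to \<open>u\<close> and the
  last one \<open>w\<close>. Up to a change of basis this is \<open>P10\<close>, with
  \<open>{u, w, u + w}\<close> in the place of its triangle \<open>{1, 4, 9}\<close>.\<close>

abbreviation (input) P10_form where
  "P10_form u w d e f \<equiv> {u, w, u + w, d, e, f, d + e + u, d + f + u, e + f + u, d + e + f + w}"

abbreviation (input) triangle_form where
  "triangle_form a b d e f \<alpha> \<beta> \<gamma> \<delta> \<equiv> {a, b, a + b, d, e, f, d + e + \<alpha>, d + f + \<beta>, e + f + \<gamma>, d + e + f + \<delta>}"

lemma sum_distinct_triangle:
  assumes "{x, y, z} \<subseteq> {0, a, b, a + b}" "distinct [0, x, y, z]"
  shows "x + y + z = (0::vec)"
proof -
  have "x \<in> {a, b, a + b}" "y \<in> {a, b, a + b}" "z \<in> {a, b, a + b}" "x \<noteq> y" "x \<noteq> z" "y \<noteq> z"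
    using assms by auto
  then show ?thesis by (elim insertE emptyE) (simp_all add: ac_simps)
qed

lemma triangle_form_distinct:
  assumes "card (triangle_form a b d e f \<alpha> \<beta> \<gamma> \<delta>) = 10"
  shows "distinct [a, b, a + b, d, e, f, d + e + \<alpha>, d + f + \<beta>, e + f + \<gamma>, d + e + f + \<delta>]"
  by (rule card_distinct) (use assms in simp)

text \<open>The triangle cancels and each of \<open>d\<close>, \<open>e\<close>, \<open>f\<close>
  occurs four times, so only the offsets survive. By \<open>affine_dual_vec\<close> this sum is
  nonzero when the dual is not affine.\<close>

lemma sum_triangle_form:
  assumes "card (triangle_form a b d e f \<alpha> \<beta> \<gamma> \<delta>) = 10"
  shows "sum idv (triangle_form a b d e f \<alpha> \<beta> \<gamma> \<delta>) = \<alpha> + \<beta> + \<gamma> + \<delta>"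
proof -
  have "sum idv (set [a, b, a + b, d, e, f, d + e + \<alpha>, d + f + \<beta>, e + f + \<gamma>, d + e + f + \<delta>])
    = sum_list [a, b, a + b, d, e, f, d + e + \<alpha>, d + f + \<beta>, e + f + \<gamma>, d + e + f + \<delta>]"
    using sum.distinct_set_conv_list[OF triangle_form_distinct[OF assms], of idv] by simp
  then show ?thesis by (simp add: ac_simps)
qed

text \<open>The hypotheses \<open>\<alpha> = 0\<close>, ..., \<open>\<alpha> = \<delta>\<close>, ..., \<open>\<alpha> + \<beta> + \<gamma> = 0\<close> say
  that one of the seven lines of the Fano plane lifts to a triangle; any two such lines meet, so at
  most one of them can hold.\<close>

lemma triangle_form_lines:
  assumes S: "S = triangle_form a b d e f \<alpha> \<beta> \<gamma> \<delta>" "card S = 10" "disjoint_triangles S"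
  shows "\<alpha> = 0 \<Longrightarrow> \<beta> \<noteq> 0 \<and> \<gamma> \<noteq> 0 \<and> \<delta> \<noteq> 0 \<and> \<beta> \<noteq> \<delta> \<and> \<gamma> \<noteq> \<delta> \<and> \<beta> \<noteq> \<gamma>"
    and "\<alpha> = \<delta> \<Longrightarrow> \<beta> \<noteq> \<delta>"
    and "\<alpha> + \<beta> + \<gamma> = 0 \<Longrightarrow> \<alpha> \<noteq> \<delta>"
proof -
  let ?A = "d + e + \<alpha>" and ?B = "d + f + \<beta>" and ?C = "e + f + \<gamma>" and ?G = "d + e + f + \<delta>"
  have dist: "distinct [a, b, a + b, d, e, f, ?A, ?B, ?C, ?G]"
    by (rule triangle_form_distinct) (use S in simp)
  have dis: "x = y + z \<Longrightarrow> x = y' + z' \<Longrightarrow> y' = y \<or> y' = z"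
    if "{x, y, z, y', z'} \<subseteq> {d, e, f, ?A, ?B, ?C, ?G}" for x y z y' z'
  proof -
    assume *: "x = y + z" "x = y' + z'"
    show ?thesis by (rule disjoint_trianglesD[OF S(3) *]) (use that S(1) in blast)
  qed
  show "\<beta> \<noteq> 0 \<and> \<gamma> \<noteq> 0 \<and> \<delta> \<noteq> 0 \<and> \<beta> \<noteq> \<delta> \<and> \<gamma> \<noteq> \<delta> \<and> \<beta> \<noteq> \<gamma>" if \<alpha>: "\<alpha> = 0"
  proof (intro conjI notI)
    have 1: "d = e + ?A" "e = d + ?A" "?A = d + e" using \<alpha> by (simp_all add: ac_simps)
    show False if "\<beta> = 0"
    proof -
      have "d = f + ?B" using that by (simp add: ac_simps)
      from dis[OF _ 1(1) this] dist show False by auto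
    qed
    show False if "\<gamma> = 0"
    proof -
      have "e = f + ?C" using that by (simp add: ac_simps)
      from dis[OF _ 1(2) this] dist show False by auto
    qed
    show False if "\<delta> = 0"
    proof -
      have "?A = f + ?G" using that \<alpha> by (simp add: ac_simps)
      from dis[OF _ 1(3) this] dist show False by auto
    qed
    show False if "\<beta> = \<delta>"
    proof -
      have "e = ?B + ?G" using that by (simp add: ac_simps)
      from dis[OF _ 1(2) this] dist show False by auto
    qed
    show False if "\<gamma> = \<delta>"
    proof -
      have "d = ?C + ?G" using that by (simp add: ac_simps)
      from dis[OF _ 1(1) this] dist show False by auto
    qed
    show False if "\<beta> = \<gamma>"
    proof -
      have "?A = ?B + ?C" using that \<alpha> by (simp add: ac_simps)
      from dis[OF _ 1(3) this] dist show False by auto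
    qed
  qed
  show "\<beta> \<noteq> \<delta>" if "\<alpha> = \<delta>"
  proof
    assume "\<beta> = \<delta>"
    then have "?G = e + ?B" "?G = f + ?A" using that by (simp_all add: ac_simps)
    from dis[OF _ this] dist show False by auto
  qed
  show "\<alpha> \<noteq> \<delta>" if "\<alpha> + \<beta> + \<gamma> = 0"
  proof
    assume "\<alpha> = \<delta>"
    then have G: "?A = f + ?G" by (simp add: ac_simps)
    have "\<alpha> = \<beta> + \<gamma>" using that by (simp add: vec_add_eq_0_iff add.assoc)
    then have "?A = ?B + ?C" by (simp add: ac_simps)
    from dis[OF _ G this] dist show False by auto
  qed
qed

text \<open>If \<open>\<alpha> = 0\<close>, then \<open>d\<close>, \<open>e\<close>,
  \<open>d + e\<close> is a triangle, and disjointness from the other possible triangles makes the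
  remaining offsets the three distinct nonzero vectors of a plane, whose sum is zero.\<close>

lemma triangle_form_nonzero:
  assumes S: "S = triangle_form a b d e f \<alpha> \<beta> \<gamma> \<delta>" "card S = 10" "disjoint_triangles S"
    and V: "{\<alpha>, \<beta>, \<gamma>, \<delta>} \<subseteq> {0, a, b, a + b}" and ne: "\<alpha> + \<beta> + \<gamma> + \<delta> \<noteq> 0"
  shows "\<alpha> \<noteq> 0"
proof
  assume \<alpha>: "\<alpha> = 0"
  have "\<beta> + \<gamma> + \<delta> = 0"
    by (rule sum_distinct_triangle[of _ _ _ a b]) (use V triangle_form_lines(1)[OF S \<alpha>] in auto)
  then show False using ne \<alpha> by simp
qed

text \<open>Permuting \<open>d\<close>, \<open>e\<close>, \<open>f\<close> permutes the pair offsets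
  and fixes \<open>\<delta>\<close>, so facts about \<open>\<alpha>\<close> carry over to
  \<open>\<beta>\<close> and \<open>\<gamma>\<close>.\<close>

lemma triangle_form_perms:
  "triangle_form a b (d::vec) e f \<alpha> \<beta> \<gamma> \<delta> = triangle_form a b d f e \<beta> \<alpha> \<gamma> \<delta>"
  "triangle_form a b d e f \<alpha> \<beta> \<gamma> \<delta> = triangle_form a b f e d \<gamma> \<beta> \<alpha> \<delta>"
  "triangle_form a b d e f \<alpha> \<beta> \<gamma> \<delta> = triangle_form a b e d f \<alpha> \<gamma> \<beta> \<delta>"
  by (simp_all add: ac_simps insert_commute)

lemma triangle_rename:
  assumes "u \<in> {a, b, a + b}" "w \<in> {a, b, a + b}" "u \<noteq> w"
  shows "{a, b, a + b} = {u, w, u + (w::vec)}"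
  using assms by (elim insertE[of u] insertE[of w]) (auto simp: ac_simps)

text \<open>Since \<open>\<delta>\<close> differs from \<open>\<alpha>\<close> and from
  \<open>\<gamma>\<close>, only 0 and \<open>\<alpha> + \<gamma>\<close> are left. In either case
  another choice of three points as \<open>d\<close>, \<open>e\<close>, \<open>f\<close> makes the
  three pair offsets equal.\<close>

lemma P10_form_of_two_equal:
  assumes S: "S = triangle_form a b d e f \<alpha> \<alpha> \<gamma> \<delta>" "card S = 10" "disjoint_triangles S"
    and V: "{\<alpha>, \<gamma>, \<delta>} \<subseteq> {0, a, b, a + b}" and nz: "\<alpha> \<noteq> 0" "\<gamma> \<noteq> 0" "\<alpha> \<noteq> \<gamma>"
    and ne: "\<gamma> \<noteq> \<delta>"
  shows "\<exists>u w d e f. S = P10_form u w d e f"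
proof -
  have "\<alpha> \<noteq> \<delta>" using triangle_form_lines(2)[OF S] by blast
  have T: "{a, b, a + b} = {\<alpha>, \<gamma>, \<alpha> + \<gamma>}" by (rule triangle_rename) (use V nz in auto)
  have S': "S = {a, b, a + b} \<union> {d, e, f, d + e + \<alpha>, d + f + \<alpha>, e + f + \<gamma>, d + e + f + \<delta>}"
    unfolding S by auto
  have "\<delta> = 0 \<or> \<delta> = \<alpha> + \<gamma>" using V T \<open>\<alpha> \<noteq> \<delta>\<close> ne by auto
  then show ?thesis
  proof
    assume "\<delta> = 0"
    then have "S = P10_form \<alpha> (\<alpha> + \<gamma>) d e (d + f + \<alpha>)" unfolding S' T by (simp add: ac_simps insert_commute)
    then show ?thesis by blast
  next
    assume "\<delta> = \<alpha> + \<gamma>"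
    then have "S = P10_form \<gamma> (\<alpha> + \<gamma>) e f (d + e + f + \<delta>)" unfolding S' T by (simp add: ac_simps insert_commute)
    then show ?thesis by blast
  qed
qed

lemma gen_four_le: "card (gen idv {u, d, e, f}) \<le> 16"
proof -
  have "card (gen idv {u, d, e, f}) \<le> card (Pow {u, d, e, f})"
    unfolding gen_def by (simp add: setcompr_eq_image card_image_le flip: Pow_def)
  also have "\<dots> \<le> 2 ^ 4"
    by (subst card_Pow) (use card_length[of "[u, d, e, f]"] in \<open>auto intro: power_increasing[of _ 4 2, simplified]\<close>)
  finally show ?thesis by simp
qed

text \<open>The pair offsets are nonzero because the total is, so the cases are how many of them
  coincide. The bound 16 is the size of a hyperplane: by cosimplicity, deleting two points leaves a
  spanning set.\<close>

lemma P10_form_exists: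
  assumes S: "S = triangle_form a b d e f \<alpha> \<beta> \<gamma> \<delta>" "card S = 10" "disjoint_triangles S"
    and V: "{\<alpha>, \<beta>, \<gamma>, \<delta>} \<subseteq> {0, a, b, a + b}" and ne: "sum idv S \<noteq> 0"
    and cosimple: "\<And>x y. x \<in> S \<Longrightarrow> y \<in> S \<Longrightarrow> card (gen idv (S - {x, y})) > 16"
  shows "\<exists>u w d e f. S = P10_form u w d e f"
proof -
  have s: "\<alpha> + \<beta> + \<gamma> + \<delta> \<noteq> 0" using ne sum_triangle_form[of a b d e f \<alpha> \<beta> \<gamma> \<delta>] S by simp
  have S2: "S = triangle_form a b d f e \<beta> \<alpha> \<gamma> \<delta>" and S3: "S = triangle_form a b f e d \<gamma> \<beta> \<alpha> \<delta>"
    and S4: "S = triangle_form a b e d f \<alpha> \<gamma> \<beta> \<delta>"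
    using S(1) triangle_form_perms[of a b d e f \<alpha> \<beta> \<gamma> \<delta>] by metis+
  have nz: "\<alpha> \<noteq> 0" "\<beta> \<noteq> 0" "\<gamma> \<noteq> 0"
    using triangle_form_nonzero[OF S V s] triangle_form_nonzero[OF S2 S(2,3)]
      triangle_form_nonzero[OF S3 S(2,3)] V s by (auto simp: ac_simps)
  have Vs: "{\<alpha>, \<gamma>, \<delta>} \<subseteq> {0, a, b, a + b}" "{\<alpha>, \<beta>, \<delta>} \<subseteq> {0, a, b, a + b}"
    "{\<beta>, \<gamma>, \<delta>} \<subseteq> {0, a, b, a + b}" "{\<beta>, \<alpha>, \<delta>} \<subseteq> {0, a, b, a + b}" using V by auto
  consider "\<alpha> = \<beta>" "\<beta> = \<gamma>" | "\<alpha> = \<beta>" "\<alpha> \<noteq> \<gamma>" | "\<alpha> = \<gamma>" "\<alpha> \<noteq> \<beta>" | "\<beta> = \<gamma>" "\<alpha> \<noteq> \<beta>"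
    | "distinct [0, \<alpha>, \<beta>, \<gamma>]" using nz by fastforce
  then show ?thesis
  proof cases
    case 1
    have S': "S = {a, b, a + b} \<union> {d, e, f, d + e + \<alpha>, d + f + \<alpha>, e + f + \<alpha>, d + e + f + \<delta>}"
      unfolding S using 1 by auto
    have "\<alpha> \<noteq> \<delta>" using triangle_form_lines(2)[OF S] 1 by blast
    show ?thesis
    proof (cases "\<delta> = 0")
      case True
      obtain w where w: "w \<in> {a, b, a + b}" "\<alpha> \<noteq> w"
      proof (cases "\<alpha> = a")
        case True
        have "distinct [a, b, a + b, d, e, f, d + e + \<alpha>, d + f + \<beta>, e + f + \<gamma>, d + e + f + \<delta>]"
          by (rule triangle_form_distinct) (use S in simp)
        then have "a \<noteq> b" by auto
        then show ?thesis using that[of b] True by auto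
      qed (use that[of a] in auto)
      have T: "{a, b, a + b} = {\<alpha>, w, \<alpha> + w}" by (rule triangle_rename) (use V nz w in auto)
      \<comment> \<open>With equal pair offsets and \<open>\<delta> = 0\<close>, all points but two
        of the triangle lie in the hyperplane spanned by \<open>\<alpha>\<close>, \<open>d\<close>,
        \<open>e\<close>, \<open>f\<close>; those two form a series pair.\<close>
      have "S - {w, \<alpha> + w} \<subseteq> {\<alpha>, d, e, f, d + e + \<alpha>, d + f + \<alpha>, e + f + \<alpha>, d + e + f + \<delta>}"
        unfolding S' T by auto
      also have "\<dots> \<subseteq> gen idv {\<alpha>, d, e, f}"
      proof -
        let ?g = "gen idv {\<alpha>, d, e, f}"
        have g: "\<alpha> \<in> ?g" "d \<in> ?g" "e \<in> ?g" "f \<in> ?g" using gen_single[of _ "{\<alpha>,d,e,f}" idv] by auto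
        then have "d + e \<in> ?g" "d + f \<in> ?g" "e + f \<in> ?g" by (auto intro!: gen_add)
        then show ?thesis using g True by (simp add: gen_add)
      qed
      finally have "gen idv (S - {w, \<alpha> + w}) \<subseteq> gen idv {\<alpha>, d, e, f}" by (intro gen_subset) auto
      then have "card (gen idv (S - {w, \<alpha> + w})) \<le> card (gen idv {\<alpha>, d, e, f})"
        by (rule card_mono[OF finite_gen, rotated]) simp
      then have "card (gen idv (S - {w, \<alpha> + w})) \<le> 16" using gen_four_le order_trans by blast
      moreover have "w \<in> S" "\<alpha> + w \<in> S" unfolding S' T by auto
      ultimately show ?thesis using cosimple[of w "\<alpha> + w"] by simp
    next
      case False
      have T: "{a, b, a + b} = {\<alpha>, \<delta>, \<alpha> + \<delta>}"
        by (rule triangle_rename) (use V nz False \<open>\<alpha> \<noteq> \<delta>\<close> in auto)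
      have "S = P10_form \<alpha> \<delta> d e f" unfolding S' T by auto
      then show ?thesis by blast
    qed
  next
    case 2
    then have "\<gamma> \<noteq> \<delta>" using s by auto
    moreover have "S = triangle_form a b d e f \<alpha> \<alpha> \<gamma> \<delta>" using S(1) 2(1) by simp
    ultimately show ?thesis using P10_form_of_two_equal[OF _ S(2,3) Vs(1) nz(1,3) 2(2)] by metis
  next
    case 3
    then have "\<beta> \<noteq> \<delta>" using s by (auto simp: ac_simps)
    moreover have "S = triangle_form a b e d f \<alpha> \<alpha> \<beta> \<delta>" using S4 3(1) by simp
    ultimately show ?thesis using P10_form_of_two_equal[OF _ S(2,3) Vs(2) nz(1,2) 3(2)] by metis
  next
    case 4
    then have "\<alpha> \<noteq> \<delta>" using s by (auto simp: ac_simps)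
    moreover have "S = triangle_form a b f e d \<beta> \<beta> \<alpha> \<delta>" using S3 4(1) by simp
    ultimately show ?thesis using P10_form_of_two_equal[OF _ S(2,3) Vs(4) nz(2,1)] 4(2) by metis
  next
    case 5
    have sum0: "\<alpha> + \<beta> + \<gamma> = 0" by (rule sum_distinct_triangle[of _ _ _ a b]) (use V 5 in auto)
    then have "\<alpha> \<noteq> \<delta>" "\<beta> \<noteq> \<delta>" "\<gamma> \<noteq> \<delta>"
      using triangle_form_lines(3)[OF S] triangle_form_lines(3)[OF S2 S(2,3)] triangle_form_lines(3)[OF S3 S(2,3)]
      by (auto simp: ac_simps)
    \<comment> \<open>The three pair offsets exhaust the nonzero vectors of the plane and
      \<open>\<delta>\<close> is none of them; the total is then zero, a contradiction.\<close>
    then have "\<delta> = 0"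
      using 5 V sum_distinct_triangle[of \<alpha> \<beta> \<gamma> a b] sum_distinct_triangle[of \<alpha> \<beta> \<delta> a b] sum0
      by (auto simp: vec_add_eq_iff)
    then show ?thesis using s sum0 by simp
  qed
qed

section \<open>Coordinates for the two extremal configurations\<close>

lemma P10_form_iso:
  assumes E: "finite E" "inj_on v E" "rk (vec_matroid E v) E = 5" and S: "v ` E = P10_form u w d e f"
  shows "has_minor_iso P10 (vec_matroid E v)"
proof -
  \<comment> \<open>The points assigned to columns 1 to 5, the unit vectors. Columns 6 to 10 then
    become \<open>f\<close>, \<open>e + f + u\<close>, \<open>d + e + f + w\<close>,
    \<open>w\<close> and \<open>d + e + u\<close>.\<close>
  define t where "t j = [u, d, e, u + w, u + d + f] ! j" for j
  have five: "{..<5} = {0,1,2,3,4::nat}" by auto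
  have ten: "{1..10} = {1,2,3,4,5,6,7,8,9,10::nat}" by (simp add: atLeastAtMost_insertL[symmetric] numeral_eq_Suc)
  have L: "lincomb t 5 x = (if x 0 = 0 then 0 else u) + (if x 1 = 0 then 0 else d) + (if x 2 = 0 then 0 else e)
     + (if x 3 = 0 then 0 else u + w) + (if x 4 = 0 then 0 else u + d + f)" for x
    unfolding lincomb_conv_sum five by (simp add: t_def ac_simps)
  have cols: "map (\<lambda>k. map (P10_col k) [0..<5]) [1..<11] =
    [[1,0,0,0,0],[0,1,0,0,0],[0,0,1,0,0],[0,0,0,1,0],[0,0,0,0,1],[1,1,0,0,1],[0,1,1,0,1],[0,0,1,1,1],[1,0,0,1,0],[1,1,1,0,0]]"
    by code_simp
  have "(\<lambda>k. lincomb t 5 (P10_col k)) ` {1..10} = v ` E"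
    unfolding ten S L using cols by (simp add: upt_rec numeral_eq_Suc ac_simps insert_commute)
  then have "iso (vec_matroid E v) (vec_matroid {1..10} P10_col)"
    by (intro iso_lincomb[OF E(1,2) P10_inj P10_supp _ E(3)])
  then show ?thesis unfolding P10_def by (rule has_minor_iso_restriction[rotated 2]) auto
qed

text \<open>The translates \<open>y + c\<close> serve as the unit columns. The sum of four of them
  is the sum of four points of \<open>C\<close>, which equals the fifth, so \<open>C\<close> itself
  provides the columns of \<open>J - I\<close>. The missing tip is the sum of all five translates,
  which is \<open>y\<close>.\<close>

lemma Z5_iso:
  assumes E: "finite E" "inj_on v E" "rk (vec_matroid E v) E = 5"
    and C: "card C = 5" "sum idv C = 0" and S: "v ` E = C \<union> (\<lambda>c. y + c) ` C"
  shows "has_minor_iso Z5_del_t (vec_matroid E v)"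
proof -
  have "finite C" using C(1) by (intro card_ge_0_finite) simp
  then obtain xs where xs: "set xs = C" "distinct xs" using finite_distinct_list by blast
  then have "length xs = 5" using C(1) distinct_card[of xs] by simp
  then obtain a b c d e where xs': "xs = [a,b,c,d,e]"
    by (auto simp: numeral_eq_Suc length_Suc_conv)
  then have "a + b + c + d + e = 0" using C(2) xs sum.distinct_set_conv_list[OF xs(2), of idv] by (simp add: ac_simps)
  then have e: "e = a + b + c + d" by (metis vec_add_eq_0_iff)
  define t where "t j = [y + a, y + b, y + c, y + d, y + e] ! j" for j
  have five: "{..<5} = {0,1,2,3,4::nat}" by auto
  have ten: "{..<10} = {0,1,2,3,4,5,6,7,8,9::nat}" by auto
  have L: "lincomb t 5 x = (if x 0 = 0 then 0 else y + a) + (if x 1 = 0 then 0 else y + b) + (if x 2 = 0 then 0 else y + c)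
     + (if x 3 = 0 then 0 else y + d) + (if x 4 = 0 then 0 else y + e)" for x
    unfolding lincomb_conv_sum five by (simp add: t_def ac_simps)
  have S': "v ` E = {a, b, c, d, e, y + a, y + b, y + c, y + d, y + e}" unfolding S using xs xs' by auto
  have "(\<lambda>k. lincomb t 5 (spike_col 5 k)) ` {..<10} = v ` E"
    unfolding ten S' L by (simp add: spike_col_def e ac_simps insert_commute)
  then have "iso (vec_matroid E v) (vec_matroid {..<10} (spike_col 5))"
    by (intro iso_lincomb[OF E(1,2) spike_inj spike_supp _ E(3)])
  then show ?thesis unfolding Z5_vec by (rule has_minor_iso_restriction[rotated 2]) auto
qed

section \<open>Rank-5 caps containing a 5-circuit\<close>

lemma intersecting_pairs_star:
  assumes fin: "finite C" "card C = 5" and P: "\<And>Y. Y \<in> P \<Longrightarrow> Y \<subseteq> C \<and> card Y = 2"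
    and int: "\<And>Y Z. Y \<in> P \<Longrightarrow> Z \<in> P \<Longrightarrow> Y \<inter> Z \<noteq> {}" and big: "card P \<ge> 4"
  obtains i where "i \<in> C" "P = (\<lambda>j. {i, j}) ` (C - {i})"
proof -
  have "card P \<ge> 2" using big by simp
  then obtain Y Z where YZ: "Y \<in> P" "Z \<in> P" "Y \<noteq> Z" by (rule two_elements)
  then obtain i where i: "i \<in> Y" "i \<in> Z" using int by blast
  obtain j where j: "Y = {i, j}" "i \<noteq> j" using P[OF YZ(1)] i(1) by (auto simp: card_2_iff)
  obtain k where k: "Z = {i, k}" "i \<noteq> k" using P[OF YZ(2)] i(2) by (auto simp: card_2_iff)
  have jk: "j \<noteq> k" using YZ j k by auto
  have off: "W = {j, k}" if "W \<in> P" "i \<notin> W" for W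
  proof -
    have "{j, k} \<subseteq> W" using int[OF that(1) YZ(1)] int[OF that(1) YZ(2)] that(2) j k by auto
    moreover have "card W = 2" "finite W" using P[OF that(1)] fin finite_subset by auto
    ultimately show ?thesis using card_subset_eq[of W "{j, k}"] jk by simp
  qed
  have mem: "i \<in> W" if "W \<in> P" for W
  proof (rule ccontr)
    assume "i \<notin> W"
    then have jkP: "{j, k} \<in> P" using off[OF that] that by simp
    have "P \<subseteq> set [{i,j}, {i,k}, {j,k}]"
    proof
      fix X assume X: "X \<in> P"
      show "X \<in> set [{i,j}, {i,k}, {j,k}]"
      proof (cases "i \<in> X")
        case True
        then obtain l where "X = {i, l}" using P[OF X] by (auto simp: card_2_iff)
        then show ?thesis using int[OF X jkP] j k by auto
      qed (use off[OF X] in auto)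
    qed
    then have "card P \<le> card (set [{i,j}, {i,k}, {j,k}])" by (intro card_mono) auto
    also have "\<dots> \<le> 3" using card_length[of "[{i,j}, {i,k}, {j,k}]"] by simp
    finally show False using big by simp
  qed
  have iC: "i \<in> C" using P[OF YZ(1)] i by auto
  have "P \<subseteq> (\<lambda>j. {i, j}) ` (C - {i})"
  proof
    fix W assume W: "W \<in> P"
    then obtain l where "W = {i, l}" "i \<noteq> l" using P[OF W] mem[OF W] by (auto simp: card_2_iff)
    then show "W \<in> (\<lambda>j. {i, j}) ` (C - {i})" using P[OF W] by auto
  qed
  moreover have "card ((\<lambda>j. {i, j}) ` (C - {i})) \<le> 4"
    using card_image_le[of "C - {i}" "\<lambda>j. {i, j}"] fin iC by simp
  ultimately have "P = (\<lambda>j. {i, j}) ` (C - {i})" using big fin by (intro card_seteq) auto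
  then show ?thesis using that iC by blast
qed

text \<open>A cap: any further point differs from a fixed point off the hyperplane of the 5-circuit by a
  pair of the circuit, and two disjoint pairs would leave a triangle with the fifth point.\<close>

lemma cap_normal_form:
  assumes S: "finite S" "card (gen idv S) = 32" "0 \<notin> S"
    and cap: "\<And>x y. x \<in> S \<Longrightarrow> y \<in> S \<Longrightarrow> x + y \<notin> S"
    and C: "C \<subseteq> S" "card C = 5" "sum idv C = 0" "\<And>c. c \<in> C \<Longrightarrow> free idv (C - {c})"
    and big: "card S \<ge> 10"
  obtains y where "S = C \<union> (\<lambda>c. y + c) ` C" "card S = 10"
proof -
  have fC: "finite C" using C S finite_subset by auto
  obtain c0 where c0: "c0 \<in> C" using C(2) by fastforce
  let ?B = "C - {c0}"
  have fB: "finite ?B" "card ?B = 4" using fC C(2) c0 by auto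
  define H where "H = gen idv C"
  have HB: "H = gen idv ?B"
  proof
    have "c0 = sum idv ?B" using C(3) c0 fC by (simp add: sum.remove vec_add_eq_0_iff)
    then have "c0 \<in> gen idv ?B" using gen_sum[of ?B ?B idv] by simp
    then show "H \<subseteq> gen idv ?B" unfolding H_def using gen_single[of _ ?B idv]
      by (intro gen_subset[OF fB(1)]) (case_tac "y = c0"; auto)
    show "gen idv ?B \<subseteq> H" unfolding H_def by (rule gen_mono) auto
  qed
  have Hadd: "x + y \<in> H" if "x \<in> H" "y \<in> H" for x y using that gen_add[OF fC] by (simp add: H_def)
  \<comment> \<open>Since \<open>C\<close> sums to zero, a subset and its complement in
    \<open>C\<close> have the same sum, and one of the two has at most two elements.\<close>
  have Hrep: "\<exists>Y\<subseteq>C. card Y \<le> 2 \<and> h = sum idv Y" if "h \<in> H" for h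
  proof -
    obtain Y where Y: "Y \<subseteq> C" "h = sum idv Y" using \<open>h \<in> H\<close> unfolding H_def gen_def by blast
    show ?thesis
    proof (cases "card Y \<le> 2")
      case False
      have "finite Y" using Y fC finite_subset by auto
      then have "card (C - Y) \<le> 2" using False C(2) Y(1) by (simp add: card_Diff_subset)
      moreover have "sum idv C = sum idv (C - Y) + sum idv Y" using Y fC by (intro sum.subset_diff) auto
      then have "h = sum idv (C - Y)" using C(3) Y(2) by (simp add: vec_add_eq_0_iff)
      ultimately show ?thesis by (intro exI[of _ "C - Y"]) auto
    qed (use Y in blast)
  qed
  have pair_sum: "card Y = 0 \<and> Y = {} \<or> (\<exists>c\<in>C. Y = {c}) \<or> card Y = 2" if "Y \<subseteq> C" "card Y \<le> 2" for Y
  proof -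
    have "finite Y" using that fC finite_subset by auto
    moreover have "card Y = 0 \<or> card Y = 1 \<or> card Y = 2" using that by linarith
    ultimately show ?thesis using that by (auto simp: card_1_singleton_iff)
  qed
  have SH: "s \<in> C" if s: "s \<in> S" "s \<in> H" for s
  proof -
    obtain Y where Y: "Y \<subseteq> C" "card Y \<le> 2" "s = sum idv Y" using Hrep[OF s(2)] by blast
    from pair_sum[OF Y(1,2)] show ?thesis
    proof (elim disjE conjE bexE)
      assume "card Y = 2"
      then obtain p q where "Y = {p, q}" "p \<noteq> q" by (auto simp: card_2_iff)
      then show ?thesis using cap[of p q] Y C(1) s by auto
    qed (use Y s S(3) in auto)
  qed
  have freeB: "free idv ?B" by (rule C(4)[OF c0])
  have "?B \<subseteq> S" using C by auto
  then obtain J where J: "?B \<subseteq> J" "J \<subseteq> S" "free idv J" "gen idv J = gen idv S"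
    using extend_free[OF S(1) freeB] by blast
  have fJ: "finite J" using J S finite_subset by blast
  have "(2::nat) ^ card J = 2 ^ 5" using card_gen[OF J(3) fJ] J(4) S(2) by simp
  then have "card J = 5" by (metis one_less_numeral_iff power_inject_exp semiring_norm(76))
  then have "card (J - ?B) = 1" using J(1) fB by (simp add: card_Diff_subset)
  then obtain x where x: "J - ?B = {x}" by (auto simp: card_1_singleton_iff)
  have Jx: "J = insert x ?B" "x \<notin> ?B" "x \<in> S" using x J by blast+
  have xH: "x \<notin> H" unfolding HB using free_insertD[OF fB(1) J(3)[unfolded Jx(1)] Jx(2)] .
  define P where "P = {Y. Y \<subseteq> C \<and> card Y = 2 \<and> x + sum idv Y \<in> S}"
  have off: "s = x \<or> (\<exists>Y\<in>P. s = x + sum idv Y)" if s: "s \<in> S" "s \<notin> H" for s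
  proof -
    have "s \<in> gen idv J" using J(4) gen_single[OF s(1), of idv] by simp
    then obtain Z where Z: "Z \<subseteq> J" "s = sum idv Z" unfolding gen_def by blast
    have "x \<in> Z"
    proof (rule ccontr)
      assume "x \<notin> Z"
      then have "Z \<subseteq> ?B" using Z Jx by auto
      then have "s \<in> H" unfolding HB Z(2) by (rule gen_sum)
      then show False using s by simp
    qed
    moreover have "finite Z" using Z fJ finite_subset by auto
    ultimately have "s = x + sum idv (Z - {x})" using Z by (simp add: sum.remove)
    moreover have "sum idv (Z - {x}) \<in> H" unfolding HB by (rule gen_sum) (use Z Jx in auto)
    ultimately obtain Y where Y: "Y \<subseteq> C" "card Y \<le> 2" "s = x + sum idv Y" using Hrep by metis
    from pair_sum[OF Y(1,2)] show ?thesis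
    proof (elim disjE conjE bexE)
      fix c assume "c \<in> C" "Y = {c}"
      then show ?thesis using cap[of x c] Y(3) Jx(3) C(1) s(1) by auto
    next
      assume "card Y = 2"
      then have "Y \<in> P" unfolding P_def using Y s by auto
      then show ?thesis using Y(3) by blast
    qed (use Y in auto)
  qed
  have S_eq: "S = C \<union> insert x ((\<lambda>Y. x + sum idv Y) ` P)"
  proof
    show "S \<subseteq> C \<union> insert x ((\<lambda>Y. x + sum idv Y) ` P)" using SH off by blast
    show "C \<union> insert x ((\<lambda>Y. x + sum idv Y) ` P) \<subseteq> S" using C(1) Jx(3) unfolding P_def by blast
  qed
  have fP: "finite P" unfolding P_def using fC by simp
  \<comment> \<open>This bounds \<open>S\<close> by the circuit, the point \<open>x\<close> and one
    point for each pair, so ten points require four pairs.\<close>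
  have "card (C \<union> insert x ((\<lambda>Y. x + sum idv Y) ` P)) \<le> card C + card (insert x ((\<lambda>Y. x + sum idv Y) ` P))"
    by (rule card_Un_le)
  also have "\<dots> \<le> 5 + Suc (card P)"
    using C(2) card_image_le[OF fP, of "\<lambda>Y. x + sum idv Y"] fP by (auto simp: card_insert_if)
  finally have cS: "card S \<le> 6 + card P" unfolding S_eq[symmetric] by simp
  have int: "Y \<inter> Z \<noteq> {}" if YZ: "Y \<in> P" "Z \<in> P" for Y Z
  proof
    assume dis: "Y \<inter> Z = {}"
    have sub: "Y \<subseteq> C" "Z \<subseteq> C" and c2: "card Y = 2" "card Z = 2"
      and inS: "x + sum idv Y \<in> S" "x + sum idv Z \<in> S" using YZ by (auto simp: P_def)
    have fin: "finite Y" "finite Z" using sub fC finite_subset by auto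
    have "card (Y \<union> Z) = 4" using c2 dis fin by (simp add: card_Un_disjoint)
    then have "card (C - (Y \<union> Z)) = 1" using C(2) sub fin by (simp add: card_Diff_subset)
    then obtain c where c: "C - (Y \<union> Z) = {c}" by (auto simp: card_1_singleton_iff)
    have "sum idv C = sum idv (C - (Y \<union> Z)) + sum idv (Y \<union> Z)" using sub fC by (intro sum.subset_diff) auto
    then have "c = sum idv Y + sum idv Z" using C(3) c fin dis by (simp add: sum.union_disjoint vec_add_eq_0_iff)
    then have "(x + sum idv Y) + (x + sum idv Z) = c" by (simp add: ac_simps)
    moreover have "c \<in> S" using c C(1) by auto
    ultimately show False using cap[OF inS] by simp
  qed
  obtain i where i: "i \<in> C" "P = (\<lambda>j. {i, j}) ` (C - {i})"
    by (rule intersecting_pairs_star[OF fC C(2), of P]) (use int cS big in \<open>auto simp: P_def\<close>)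
  \<comment> \<open>With \<open>i\<close> the centre of the star, the points off the hyperplane are
    \<open>x + i + c\<close>; the point \<open>x\<close> is the case \<open>c = i\<close>. So the
    translation is by \<open>y = x + i\<close>.\<close>
  have "(\<lambda>Y. x + sum idv Y) ` P = (\<lambda>c. x + i + c) ` (C - {i})"
    unfolding i(2) image_image by (rule image_cong) (auto simp: ac_simps)
  moreover have "(\<lambda>c. x + i + c) ` insert i (C - {i}) = insert x ((\<lambda>c. x + i + c) ` (C - {i}))"
    by (simp only: image_insert add.assoc vec_add_self add_0_right)
  moreover have "insert i (C - {i}) = C" using i(1) by auto
  ultimately have "insert x ((\<lambda>Y. x + sum idv Y) ` P) = (\<lambda>c. x + i + c) ` C" by (simp only:)
  then have "S = C \<union> (\<lambda>c. (x + i) + c) ` C" using S_eq by simp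
  moreover from this have "card S \<le> 10"
    using card_Un_le[of C "(\<lambda>c. (x + i) + c) ` C"] card_image_le[OF fC, of "\<lambda>c. (x + i) + c"] C(2) by simp
  ultimately show ?thesis using that[of "x + i"] big by simp
qed

section \<open>From point sets back to matroids\<close>

lemma gen_image: "inj_on v E \<Longrightarrow> X \<subseteq> E \<Longrightarrow> gen idv (v ` X) = gen v X"
proof -
  assume v: "inj_on v E" "X \<subseteq> E"
  have s: "sum idv (v ` Y) = sum v Y" if "Y \<subseteq> X" for Y
    using v that by (simp add: sum.reindex inj_on_subset)
  show ?thesis
  proof
    show "gen idv (v ` X) \<subseteq> gen v X"
    proof
      fix s assume "s \<in> gen idv (v ` X)"
      then obtain Z where "Z \<subseteq> v ` X" "s = sum idv Z" unfolding gen_def by blast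
      then obtain Y where "Y \<subseteq> X" "s = sum v Y" using s by (metis subset_imageE)
      then show "s \<in> gen v X" using gen_sum by blast
    qed
    show "gen v X \<subseteq> gen idv (v ` X)"
    proof
      fix t assume "t \<in> gen v X"
      then obtain Y where "Y \<subseteq> X" "t = sum v Y" unfolding gen_def by blast
      then show "t \<in> gen idv (v ` X)" using s gen_sum[of "v ` Y" "v ` X" idv] by auto
    qed
  qed
qed

text \<open>Two different triangles with a common point cover at most five elements, so
  \<open>crowdedI\<close> applies to their union.\<close>

lemma disjoint_triangles_columns:
  assumes E: "finite E" and rk: "rk (vec_matroid E v) E = 5" and s: "simple (vec_matroid E v)"
    and u: "\<nexists>X. crowded (vec_matroid E v) X"
  shows "disjoint_triangles (v ` E)"
  unfolding disjoint_triangles_def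
proof (intro allI impI)
  fix x y z y' z' assume S: "{x, y, z, y', z'} \<subseteq> v ` E" and xy: "x = y + z" and xy': "x = y' + z'"
  define g where "g = inv_into E v"
  have g: "g s \<in> E \<and> v (g s) = s" if "s \<in> v ` E" for s
    unfolding g_def using inv_into_into[OF that] f_inv_into_f[OF that] by blast
  have nz: "s \<noteq> 0" if "s \<in> v ` E" for s using simple_vec(2)[OF E s] that by auto
  have ginj: "g s \<noteq> g t" if "s \<in> v ` E" "t \<in> v ` E" "s \<noteq> t" for s t using g that by metis
  have tri: "sum v {g x, g p, g q} = 0" if "x = p + q" "p \<in> v ` E" "q \<in> v ` E" for p q
  proof -
    have "x \<in> v ` E" using S by auto
    moreover have "x \<noteq> p" "x \<noteq> q" "p \<noteq> q" using that nz[of p] nz[of q] nz[OF \<open>x \<in> v ` E\<close>] by auto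
    ultimately have "g x \<noteq> g p" "g x \<noteq> g q" "g p \<noteq> g q" using ginj that by auto
    then have "sum v {g x, g p, g q} = x + (p + q)" using g that \<open>x \<in> v ` E\<close> by simp
    then show ?thesis using that(1) by simp
  qed
  show "y' = y \<or> y' = z"
  proof (rule ccontr)
    assume n: "\<not> ?thesis"
    let ?Y = "{g x, g y, g z}" and ?Z = "{g x, g y', g z'}"
    have "x \<noteq> y'" using xy' nz[of z'] S by auto
    then have "g y' \<notin> ?Y" using n ginj[of y'] S by auto
    then have ne: "?Y \<noteq> ?Z" by blast
    have le: "card (?Y \<union> ?Z) \<le> 5"
      using card_length[of "[g x, g y, g z, g y', g z']"] by (simp add: insert_commute)
    have "crowded (vec_matroid E v) (?Y \<union> ?Z)"
    proof (rule crowdedI[OF E _ _ tri[OF xy] _ _ tri[OF xy'] _ ne le])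
      show "5 \<le> rk (vec_matroid E v) E" using rk by simp
    qed (use S g in auto)
    then show False using u by blast
  qed
qed

text \<open>The size bound is kept apart from the identification: the bound alone yields affineness
  from 11 elements on, while naming the extremal matroid also uses the hypotheses on the
  dual.\<close>

lemma rank5_nonaffine:
  assumes E: "finite E" and s: "simple (vec_matroid E v)" and rk: "rk (vec_matroid E v) E = 5"
    and u: "\<nexists>X. crowded (vec_matroid E v) X" and na: "\<not> affine (vec_matroid E v)" and n: "card E \<ge> 10"
  shows "card E = 10"
    and "simple (dual (vec_matroid E v)) \<Longrightarrow> \<not> affine (dual (vec_matroid E v)) \<Longrightarrow>
      has_minor_iso Z5_del_t (vec_matroid E v) \<or> has_minor_iso P10 (vec_matroid E v)"
proof -
  let ?M = "vec_matroid E v" and ?S = "v ` E"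
  note M = matroid_vec[OF E, of v]
  have inj: "inj_on v E" and nz: "0 \<notin> ?S" using simple_vec[OF E s] by auto
  have fS: "finite ?S" and cS: "card ?S = card E" using E inj by (auto simp: card_image)
  have gS: "card (gen idv ?S) = 32" using gen_image[OF inj order_refl] card_gen_rk[OF E order_refl, of v] rk by simp
  note dt = disjoint_triangles_columns[OF E rk s u]
  have big: "card ?S \<ge> 10" using n cS by simp
  have goal: "card E = 10 \<and> (simple (dual ?M) \<longrightarrow> \<not> affine (dual ?M) \<longrightarrow> has_minor_iso Z5_del_t ?M \<or> has_minor_iso P10 ?M)"
  proof (cases "\<exists>a b. a \<in> ?S \<and> b \<in> ?S \<and> a + b \<in> ?S")
    case True
    then obtain a b where ab: "a \<in> ?S" "b \<in> ?S" "a + b \<in> ?S" by blast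
    obtain d e f \<alpha> \<beta> \<gamma> \<delta> where V: "{\<alpha>, \<beta>, \<gamma>, \<delta>} \<subseteq> {0, a, b, a + b}"
      and S: "?S = triangle_form a b d e f \<alpha> \<beta> \<gamma> \<delta>" and c10: "card ?S = 10"
      by (rule triangle_normal_form[OF fS gS nz dt ab big])
    have "has_minor_iso P10 ?M" if co: "simple (dual ?M)" "\<not> affine (dual ?M)"
    proof -
      have "sum idv ?S = sum v E" using inj by (simp add: sum.reindex)
      then have ne: "sum idv ?S \<noteq> 0" using affine_dual_vec[OF E, of v] co(2) by auto
      \<comment> \<open>Cosimplicity says that deleting two elements keeps the rank at 5, so the
        span still has 32 vectors.\<close>
      have "card (gen idv (?S - {x, y})) > 16" if xy: "x \<in> ?S" "y \<in> ?S" for x y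
      proof -
        obtain p q where pq: "p \<in> E" "q \<in> E" "x = v p" "y = v q" using xy by blast
        have "card {p, q} \<le> 2" using card_length[of "[p, q]"] by simp
        then have "indep (dual ?M) {p, q}" using co(1) pq unfolding simple_def by simp
        then have "rk ?M (E - {p, q}) = 5" using rk by (simp add: indep_dual[OF M])
        then have "card (gen v (E - {p, q})) = 32" using card_gen_rk[OF E, of "E - {p, q}" v] by simp
        moreover have "v ` (E - {p, q}) = ?S - {x, y}"
          using inj_on_image_set_diff[OF inj, of E "{p, q}"] pq by simp
        ultimately show ?thesis using gen_image[OF inj, of "E - {p, q}"] by simp
      qed
      then obtain p q d e f where "?S = P10_form p q d e f"
        using P10_form_exists[OF S c10 dt V ne] by blast
      then show ?thesis by (rule P10_form_iso[OF E inj rk])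
    qed
    then show ?thesis using c10 cS by simp
  next
    case False
    then have cap: "\<And>x y. x \<in> ?S \<Longrightarrow> y \<in> ?S \<Longrightarrow> x + y \<notin> ?S" by blast
    obtain D where D: "circuit ?M D" "odd (card D)" using na unfolding affine_def by blast
    have DE: "D \<subseteq> E" and sD: "sum v D = 0" using D(1) sum_circuit[OF E D(1)] by (auto simp: circuit_def)
    have fD: "finite D" "D \<noteq> {}" using DE E finite_subset D(2) by auto
    have frD: "indep ?M (D - {c})" if "c \<in> D" for c using D(1) that by (auto simp: circuit_def)
    \<comment> \<open>In rank 5 a circuit has at most six elements; an odd one that is not a
      triangle has exactly five.\<close>
    have "card D \<ge> 3" using small_dependency[OF inj _ DE sD fD(2) E] simple_vec(2)[OF E s] by blast
    moreover have "card D \<le> 6"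
    proof -
      obtain c where c: "c \<in> D" using fD by blast
      then have "card (D - {c}) \<le> 5" using card_le_rk[OF M frD[OF c], of E] DE rk by auto
      then show ?thesis using c fD by simp
    qed
    moreover have "card D \<noteq> 3"
    proof
      assume "card D = 3"
      then obtain x y z where xyz: "D = {x, y, z}" "x \<noteq> y" "y \<noteq> z" "x \<noteq> z" by (auto simp: card_3_iff)
      then have "v x + v y = v z" using sD by (simp add: vec_add_eq_0_iff flip: add.assoc)
      then show False using cap[of "v x" "v y"] xyz DE by auto
    qed
    moreover have "card D \<noteq> 4" "card D \<noteq> 6" using D(2) by auto
    ultimately have D5: "card D = 5" by linarith
    have injD: "inj_on v D" using inj DE inj_on_subset by blast
    have subs: "sum v Y = 0 \<longleftrightarrow> sum idv (v ` Y) = 0" if "Y \<subseteq> D" for Y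
      using inj_on_subset[OF injD that] by (simp add: sum.reindex)
    have C: "v ` D \<subseteq> ?S" "card (v ` D) = 5" "sum idv (v ` D) = 0"
      using DE D5 injD sD by (auto simp: card_image sum.reindex)
    have "free idv (v ` D - {c})" if c: "c \<in> v ` D" for c
    proof -
      obtain x where x: "x \<in> D" "c = v x" using c by blast
      have "v ` D - {c} = v ` (D - {x})" using inj_on_image_set_diff[OF injD, of D "{x}"] x by simp
      moreover have "free v (D - {x})" using frD[OF x(1)] by (simp add: indep_vec[OF E])
      moreover have "free v (D - {x}) \<longleftrightarrow> free idv (v ` (D - {x}))" by (rule free_image) (use subs in blast)
      ultimately show ?thesis by simp
    qed
    then obtain y where y: "?S = v ` D \<union> (\<lambda>c. y + c) ` v ` D" "card ?S = 10"
      using cap_normal_form[OF fS gS nz cap C _ big] by metis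
    then have "has_minor_iso Z5_del_t ?M" by (intro Z5_iso[OF E inj rk C(2,3)])
    then show ?thesis using y cS by simp
  qed
  show "card E = 10" using goal by blast
  show "simple (dual ?M) \<Longrightarrow> \<not> affine (dual ?M) \<Longrightarrow> has_minor_iso Z5_del_t ?M \<or> has_minor_iso P10 ?M"
    using goal by blast
qed

text \<open>If \<open>{p, q}\<close> had rank at most 1, the sums over the sets consisting of a subset of
  \<open>{p, x0}\<close> and at most one further element would be distinct: 36 vectors in a space of
  size 32.\<close>

lemma rank5_simple:
  assumes E: "finite E" and rk: "rk (vec_matroid E v) E = 5"
    and u: "\<nexists>X. crowded (vec_matroid E v) X" and n: "card E \<ge> 11"
  shows "simple (vec_matroid E v)"
proof (rule ccontr)
  let ?M = "vec_matroid E v"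
  assume "\<not> simple ?M"
  then obtain X where X: "X \<subseteq> E" "card X \<le> 2" "\<not> free v X" unfolding simple_def by (auto simp: indep_vec[OF E])
  then obtain Y where Y: "Y \<subseteq> X" "sum v Y = 0" "Y \<noteq> {}" unfolding free_def by blast
  have fX: "finite X" using X(1) E finite_subset by blast
  obtain q where q: "q \<in> Y" using Y by blast
  \<comment> \<open>Loops and parallel pairs are treated alike: for a loop \<open>q\<close> the
    partner \<open>p\<close> is arbitrary.\<close>
  have "\<exists>p. p \<in> E \<and> p \<noteq> q \<and> Y \<subseteq> {p, q}"
  proof (cases "Y = {q}")
    case True
    have "\<not> E \<subseteq> {q}" using n card_mono[of "{q}" E] by auto
    then show ?thesis using True by auto
  next
    case False
    then obtain p where p: "p \<in> Y" "p \<noteq> q" using q by blast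
    have "{p, q} = X" using X(2) fX p q Y(1) by (intro card_seteq) auto
    then show ?thesis using p X Y by blast
  qed
  then obtain p where p: "p \<in> E" "p \<noteq> q" "Y \<subseteq> {p, q}" by blast
  have qE: "q \<in> E" using q Y X by blast
  \<comment> \<open>Such a zero-sum set \<open>W\<close> and the dependency \<open>Y\<close> inside
    \<open>{p, q}\<close> would be two cycles on at most five elements.\<close>
  have key: "W = {}" if W: "W \<subseteq> E - {q}" "card (W - {p}) \<le> 3" "sum v W = 0" for W
  proof (rule ccontr)
    assume ne: "W \<noteq> {}"
    have fW: "finite W" using W E by (meson Diff_subset finite_subset)
    have "Y \<union> W \<subseteq> {p, q} \<union> (W - {p})" using p by auto
    then have "card (Y \<union> W) \<le> card ({p, q} \<union> (W - {p}))" by (rule card_mono[rotated]) (use fW in auto)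
    also have "\<dots> \<le> card {p, q} + card (W - {p})" by (rule card_Un_le)
    also have "\<dots> \<le> 5" using W(2) p(2) by simp
    finally have le: "card (Y \<union> W) \<le> 5" .
    have "Y \<noteq> W" using q W by auto
    then have "crowded ?M (Y \<union> W)"
      using X Y W ne le rk by (intro crowdedI[OF E]) auto
    then show False using u by blast
  qed
  let ?F = "E - {p, q}"
  have cF: "card ?F \<ge> 9" using n p qE by (simp add: card_Diff_subset)
  then have "?F \<noteq> {}" using card.empty by (metis not_numeral_le_zero)
  then obtain x0 where x0: "x0 \<in> ?F" by blast
  \<comment> \<open>At least 9 elements lie off \<open>{p, q}\<close>; leaving out \<open>x0\<close>
    gives 8 singletons, and the empty set makes 9 choices.\<close>
  define T where "T = insert {} ((\<lambda>x. {x}) ` (?F - {x0}))"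
  have cT: "card T \<ge> 9"
  proof -
    have "card ((\<lambda>x. {x}) ` (?F - {x0})) = card (?F - {x0})" by (rule card_image) auto
    moreover have "{} \<notin> (\<lambda>x. {x}) ` (?F - {x0})" by auto
    ultimately show ?thesis unfolding T_def using cF x0 E by simp
  qed
  have Tsub: "A \<subseteq> ?F - {x0}" "card A \<le> 1" "finite A" if "A \<in> T" for A using that unfolding T_def by auto
  define h where "h = (\<lambda>(A, B). sum v (A \<union> B))"
  have "inj_on h (T \<times> Pow {p, x0})"
  proof (rule inj_onI)
    fix a b assume ab: "a \<in> T \<times> Pow {p, x0}" "b \<in> T \<times> Pow {p, x0}" "h a = h b"
    obtain A B A' B' where a: "a = (A, B)" and b: "b = (A', B')" by (metis surj_pair)
    have mem: "A \<in> T" "A' \<in> T" "B \<subseteq> {p, x0}" "B' \<subseteq> {p, x0}" using ab a b by auto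
    have fB: "finite B" "finite B'" using mem(3,4) finite_subset by auto
    \<comment> \<open>Apart from \<open>p\<close>, the difference of two choices involves at most
      \<open>x0\<close> and one element from each of \<open>A\<close> and \<open>A'\<close>, which
      is just what \<open>key\<close> can handle.\<close>
    let ?W = "((A \<union> B) - (A' \<union> B')) \<union> ((A' \<union> B') - (A \<union> B))"
    have "sum v ?W = 0" using ab(3) a b Tsub(3)[OF mem(1)] Tsub(3)[OF mem(2)] fB by (simp add: h_def sum_symdiff)
    moreover have "?W \<subseteq> E - {q}" using Tsub(1)[OF mem(1)] Tsub(1)[OF mem(2)] mem(3,4) p x0 by blast
    moreover have "card (?W - {p}) \<le> 3"
    proof -
      have "?W - {p} \<subseteq> A \<union> A' \<union> {x0}" using mem(3,4) by blast
      then have "card (?W - {p}) \<le> card (A \<union> A' \<union> {x0})"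
        by (rule card_mono[rotated]) (use Tsub(3) mem in auto)
      also have "\<dots> \<le> card (A \<union> A') + card {x0}" by (rule card_Un_le)
      also have "\<dots> \<le> card A + card A' + 1" using card_Un_le[of A A'] by simp
      finally show ?thesis using Tsub(2)[OF mem(1)] Tsub(2)[OF mem(2)] by simp
    qed
    ultimately have "?W = {}" by (rule key[rotated 2])
    then have eq: "A \<union> B = A' \<union> B'" by blast
    have "A \<inter> {p, x0} = {}" "A' \<inter> {p, x0} = {}" using Tsub(1)[OF mem(1)] Tsub(1)[OF mem(2)] by auto
    then have "A = A'" "B = B'" using eq mem(3,4) by blast+
    then show "a = b" using a b by simp
  qed
  then have "card (h ` (T \<times> Pow {p, x0})) = card (T \<times> Pow {p, x0})" by (rule card_image)
  also have "\<dots> = card T * 4"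
  proof -
    have "p \<noteq> x0" using x0 by auto
    then show ?thesis by (simp add: card_cartesian_product card_Pow)
  qed
  finally have "36 \<le> card (h ` (T \<times> Pow {p, x0}))" using cT by simp
  also have "\<dots> \<le> card (gen v E)"
  proof (rule card_mono[OF finite_gen[OF E]])
    show "h ` (T \<times> Pow {p, x0}) \<subseteq> gen v E"
    proof
      fix s assume "s \<in> h ` (T \<times> Pow {p, x0})"
      then obtain A B where AB: "A \<in> T" "B \<subseteq> {p, x0}" "s = sum v (A \<union> B)" unfolding h_def by auto
      then have "A \<union> B \<subseteq> E" using Tsub(1)[OF AB(1)] p x0 by blast
      then show "s \<in> gen v E" unfolding AB(3) by (rule gen_sum)
    qed
  qed
  also have "\<dots> = 32" using card_gen_rk[OF E order_refl, of v] rk by simp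
  finally show False by simp
qed

text \<open>Simplicity is derived from the number of elements, so this applies to contractions,
  which may acquire loops or parallel elements.\<close>

lemma rank5_affine:
  assumes M: "matroid M" "binary M" and rk: "rk M (ground M) = 5"
    and u: "\<nexists>X. crowded M X" and n: "card (ground M) \<ge> 11"
  shows "affine M"
proof (rule ccontr)
  assume na: "\<not> affine M"
  obtain v where v: "M = vec_matroid (ground M) v" using M(2) by (auto simp: binary_def)
  note E = matroid_finite[OF M(1)]
  have 1: "rk (vec_matroid (ground M) v) (ground M) = 5" "\<nexists>X. crowded (vec_matroid (ground M) v) X"
    "\<not> affine (vec_matroid (ground M) v)" using rk u na v by simp_all
  have "card (ground M) = 10"
    by (rule rank5_nonaffine(1)[OF E rank5_simple[OF E 1(1,2) n] 1]) (use n in simp)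
  then show False using n by simp
qed

lemma indep_contract_indep:
  assumes "matroid M" "indep M C"
  shows "indep (contract M C) X \<longleftrightarrow> X \<subseteq> ground M - C \<and> indep M (X \<union> C)"
  by (rule indep_contract[OF assms order_refl rk_indep[OF assms, symmetric]])

text \<open>Every contraction to rank 5 is affine. Applied to a fundamental circuit and all sets
  \<open>C\<close> contracted, this forces the circuit to contain the whole basis, so that all
  elements off the basis are parallel.\<close>

lemma no_large_rank_corank:
  assumes M: "matroid M" "binary M" "simple M" and u: "\<nexists>X. crowded M X"
    and rk: "rk M (ground M) \<ge> 6" and n: "card (ground M) \<ge> rk M (ground M) + 6"
  shows False
proof -
  let ?E = "ground M" and ?r = "rk M (ground M)"
  obtain v where v: "M = vec_matroid ?E v" using M(2) by (auto simp: binary_def)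
  note E = matroid_finite[OF M(1)]
  have ind: "indep M X \<longleftrightarrow> X \<subseteq> ?E \<and> free v X" for X using indep_vec[OF E, of v X] v by simp
  obtain B where B: "B \<subseteq> ?E" "indep M B" "card B = ?r" by (rule rk_attained[OF M(1)])
  have fB: "finite B" "free v B" using B E finite_subset by (auto simp: ind)
  have gB: "gen v B = gen v ?E" by (rule gen_basis[OF E]) (use B fB v in auto)
  \<comment> \<open>Contracting \<open>?r - 5\<close> elements of a basis leaves rank 5 and, as the
    corank is unchanged and at least 6, at least 11 elements.\<close>
  have aff: "affine (contract M C)" if C: "C \<subseteq> B" "card C = ?r - 5" for C
  proof (rule rank5_affine)
    have CE: "C \<subseteq> ?E" using C B by auto
    have iC: "indep M C" using indep_mono[OF M(1) B(2)] C by auto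
    have fC: "finite C" using C fB finite_subset by auto
    show "matroid (contract M C)" by (rule matroid_contract[OF M(1)])
    show "binary (contract M C)" by (rule binary_contract[OF M(1,2) CE])
    have "rk (contract M C) (?E - C) + rk M C = rk M (?E - C \<union> C)" by (rule rk_contract[OF M(1)]) simp
    moreover have "?E - C \<union> C = ?E" using CE by auto
    ultimately show "rk (contract M C) (ground (contract M C)) = 5" using rk_indep[OF M(1) iC] C rk by simp
    show "\<nexists>X. crowded (contract M C) X" using crowded_contract[OF M(1) CE] u by blast
    show "11 \<le> card (ground (contract M C))" using n rk C CE fC by (simp add: card_Diff_subset)
  qed
  have full: "v e = sum v B" if e: "e \<in> ?E - B" for e
  proof -
    have "v e \<in> gen v B" unfolding gB using e by (intro gen_single) auto
    then obtain A where A: "A \<subseteq> B" "v e = sum v A" unfolding gen_def by blast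
    have fA: "finite A" using A fB finite_subset by auto
    have eA: "e \<notin> A" using e A by auto
    \<comment> \<open>The fundamental circuit \<open>insert e A\<close> of \<open>e\<close> remains
      a circuit of the contraction after removal of \<open>C\<close>; affineness makes its size
      even, and \<open>e\<close> accounts for one element.\<close>
    have odd: "odd (card (A - C))" if C: "C \<subseteq> B" "card C = ?r - 5" for C
    proof -
      have iC: "indep M C" using indep_mono[OF M(1) B(2)] C by auto
      let ?D = "insert e (A - C)"
      have "circuit (contract M C) ?D" unfolding circuit_def indep_contract_indep[OF M(1) iC]
      proof (intro conjI ballI notI)
        show "?D \<subseteq> ground (contract M C)" using A C B e by auto
        assume "?D \<subseteq> ?E - C \<and> indep M (?D \<union> C)"
        then have "indep M (?D \<union> C)" by blast
        then have "indep M (insert e A)" by (rule indep_mono[OF M(1)]) auto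
        moreover have "sum v (insert e A) = 0" using A fA eA by simp
        ultimately show False unfolding ind free_def by blast
      next
        fix x assume x: "x \<in> ?D"
        show "?D - {x} \<subseteq> ?E - C" using A C B e by auto
        show "indep M (?D - {x} \<union> C)"
        proof (cases "x = e")
          case True
          then show ?thesis using A C by (intro indep_mono[OF M(1) B(2)]) auto
        next
          case False
          then have xA: "x \<in> A" "x \<notin> C" using x by auto
          have "v e \<notin> gen v (B - {x})"
          proof
            assume "v e \<in> gen v (B - {x})"
            then obtain A' where A': "A' \<subseteq> B - {x}" "v e = sum v A'" unfolding gen_def by blast
            then have "A = A'" using free_inj[OF fB(2,1) A(1), of A'] A by auto
            then show False using A' xA by auto
          qed
          moreover have "free v (B - {x})" using fB(2) free_subset by blast
          ultimately have "free v (insert e (B - {x}))" using fB(1) by (intro free_insertI) auto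
          then have "indep M (insert e (B - {x}))" using B e by (auto simp: ind)
          then show ?thesis by (rule indep_mono[OF M(1)]) (use A C xA in auto)
        qed
      qed
      then have "even (card ?D)" using aff[OF C] unfolding affine_def by blast
      then show ?thesis using fA eA by simp
    qed
    have "A = B"
    proof (rule ccontr)
      assume "A \<noteq> B"
      then obtain b where b: "b \<in> B" "b \<notin> A" using A by blast
      obtain C0 where C0: "C0 \<subseteq> B" "card C0 = ?r - 5" using B(3) obtain_subset_with_card_n[of "?r - 5" B] by auto
      have "A \<noteq> {}" using odd[OF C0] by auto
      then obtain a where a: "a \<in> A" by blast
      have aB: "a \<in> B" "a \<noteq> b" using a b A by auto
      have "?r - 6 \<le> card (B - {a, b})" using fB B(3) aB b by (simp add: card_Diff_subset)
      \<comment> \<open>Exchanging \<open>a\<close> in \<open>A\<close> for \<open>b\<close> outside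
        \<open>A\<close> in the contracted set changes the size of \<open>A - C\<close> by one and
        keeps \<open>card C\<close>; the room for this is what rank at least 6 provides.\<close>
      then obtain K where K: "K \<subseteq> B - {a, b}" "card K = ?r - 6" "finite K" using obtain_subset_with_card_n by metis
      have "card (insert a K) = ?r - 5" "card (insert b K) = ?r - 5"
        using K rk by (auto simp: card_insert_if)
      then have o: "odd (card (A - insert a K))" "odd (card (A - insert b K))"
        using odd[of "insert a K"] odd[of "insert b K"] K aB b by auto
      have "A - insert b K = insert a (A - insert a K)" using K a b by auto
      then have "card (A - insert b K) = Suc (card (A - insert a K))" using fA by simp
      then show False using o by simp
    qed
    then show ?thesis using A by simp
  qed
  have "card (?E - B) \<ge> 2" using n B fB by (simp add: card_Diff_subset)
  then obtain e e' where e: "e \<in> ?E - B" "e' \<in> ?E - B" "e \<noteq> e'" by (rule two_elements)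
  have "simple (vec_matroid ?E v)" using M(3) v by simp
  then have "inj_on v ?E" by (rule simple_vec(1)[OF E])
  then show False using full[OF e(1)] full[OF e(2)] e inj_onD[of v ?E e e'] by auto
qed

section \<open>The classification\<close>

lemma binary_vec: "binary (vec_matroid E v)"
  unfolding binary_def by (intro exI[of _ v]) simp

lemma binary_minor:
  assumes M: "matroid M" and N: "matroid N" "binary N" and "has_minor_iso N M"
  shows "binary M"
proof -
  obtain C D where "C \<subseteq> ground N" "iso M (delete (contract N C) D)"
    using assms(4) unfolding has_minor_iso_alt by blast
  then show ?thesis using binary_iso[OF M] binary_delete binary_contract N matroid_contract by metis
qed

lemma rank4_minor_AG42:
  assumes "matroid M" "binary M" "simple M" "rk M (ground M) \<le> 4"
  shows "has_minor_iso AG42 M"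
proof -
  obtain v where v: "M = vec_matroid (ground M) v" using assms by (auto simp: binary_def)
  have "has_minor_iso AG42 (vec_matroid (ground M) v)"
    by (rule rank4_vec_minor_AG42) (use assms matroid_finite[OF assms(1)] v in auto)
  then show ?thesis using v by simp
qed

lemma affine_rank5_minor_AG42:
  assumes "matroid M" "binary M" "simple M" "rk M (ground M) = 5" "affine M"
  shows "has_minor_iso AG42 M"
proof -
  obtain v where v: "M = vec_matroid (ground M) v" using assms by (auto simp: binary_def)
  have "has_minor_iso AG42 (vec_matroid (ground M) v)"
    by (rule affine_rank5_vec_minor_AG42) (use assms matroid_finite[OF assms(1)] v in auto)
  then show ?thesis using v by simp
qed

lemma matroid_AG42: "matroid AG42" and binary_AG42: "binary AG42"
  unfolding AG42_vec by (simp_all add: matroid_vec binary_vec)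

lemma rk_full_simple:
  assumes M: "matroid M" and r: "rk M (ground M) = card (ground M)"
  shows "simple M"
  unfolding simple_def using indep_mono[OF M] indep_iff_rk[OF M order_refl] r by blast

text \<open>With two or three elements a loop or coloop is still a 1-separation. This settles rank 2
  or corank 2 on three elements; the free and the rankless case are simple or cosimple outright, and
  \<open>U_{1,2}\<close> remains.\<close>

lemma three_connected_tiny:
  assumes M: "matroid M" and c: "three_connected M" and n: "card (ground M) \<le> 3"
  shows "simple M \<or> simple (dual M) \<or> (card (ground M) = 2 \<and> has_minor_iso AG42 M)"
proof -
  let ?E = "ground M" and ?r = "rk M (ground M)"
  note D = matroid_dual[OF M] and E = matroid_finite[OF M]
  have rd: "rk (dual M) ?E + ?r = card ?E" using rk_dual[OF M order_refl] by (simp add: rk_empty[OF M])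
  have le: "?r \<le> card ?E" by (rule rk_le_card[OF M E])
  have sep: "rk N {x} + rk N (?E - {x}) \<ge> rk N ?E + 1"
    if "x \<in> ?E" "card ?E \<ge> 2" "three_connected N" "ground N = ?E" for x N
  proof -
    have "card (?E - {x}) \<ge> 1" using that E by simp
    moreover have "\<not> k_separation N 1 {x}" using that(3) unfolding three_connected_def by simp
    ultimately show ?thesis using that(1,4) unfolding k_separation_def by auto
  qed
  \<comment> \<open>Absence of 1-separations means that every element has rank 1 and its complement
    rank 2, so all pairs are independent. It is stated for any \<open>N\<close> in order to serve
    both \<open>M\<close> and its dual.\<close>
  have line: "simple N" if N: "matroid N" "three_connected N" "ground N = ?E" "rk N ?E = 2" "card ?E = 3" for N
    unfolding simple_def
  proof (intro allI impI)
    fix X assume X: "X \<subseteq> ground N" "card X \<le> 2"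
    have XE: "X \<subseteq> ?E" using X N by simp
    have fX: "finite X" using XE E finite_subset by auto
    have "\<exists>Y. X \<subseteq> Y \<and> Y \<subseteq> ?E \<and> card Y = 2"
    proof -
      obtain Y where "X \<subseteq> Y" "Y \<subseteq> ?E" "card Y = 2"
        using exists_subset_between[of X 2 ?E] XE X(2) N(5) E by auto
      then show ?thesis by blast
    qed
    then obtain Y where Y: "X \<subseteq> Y" "Y \<subseteq> ?E" "card Y = 2" by blast
    have "card (?E - Y) = 1" using Y N(5) E by (simp add: card_Diff_subset finite_subset)
    then obtain x where x: "?E - Y = {x}" by (auto simp: card_1_singleton_iff)
    then have "?E - {x} = Y" "x \<in> ?E" using Y by auto
    then have "rk N {x} + rk N Y \<ge> 3" using sep[of x N] N by simp
    moreover have "rk N {x} \<le> 1" using rk_le_card[OF N(1), of "{x}"] by simp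
    moreover have "rk N Y \<le> 2" using rk_le_card[OF N(1), of Y] Y(2,3) E finite_subset by fastforce
    ultimately have "indep N Y" using indep_iff_rk[OF N(1), of Y] Y N(3) by simp
    then show "indep N X" using indep_mono[OF N(1)] Y by blast
  qed
  consider "?r = card ?E" | "?r = 0" | "card ?E = 3" "?r = 2" | "card ?E = 3" "?r = 1" | "card ?E = 2" "?r = 1"
    using le n by linarith
  then show ?thesis
  proof cases
    case 1
    then show ?thesis using rk_full_simple[OF M] by blast
  next
    case 2
    then show ?thesis using rk_full_simple[OF D] rd by simp
  next
    case 3
    then show ?thesis using line[OF M c] by simp
  next
    case 4
    then show ?thesis using line[OF D three_connected_dual[OF M c]] rd by simp
  next
    case 5
    then obtain x y where xy: "?E = {x, y}" "x \<noteq> y" by (auto simp: card_2_iff)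
    have rx: "rk M {z} = 1" if "z \<in> ?E" for z
    proof -
      have "card (?E - {z}) = 1" using 5 E that by simp
      then have "rk M (?E - {z}) \<le> 1" using rk_le_card[OF M, of "?E - {z}"] E by simp
      then have "rk M {z} \<ge> 1" using sep[OF that _ c refl] 5 by simp
      then show ?thesis using rk_le_card[OF M, of "{z}"] by simp
    qed
    have ix: "indep M {x}" "indep M {y}" using rx xy indep_iff_rk[OF M, of "{x}"] indep_iff_rk[OF M, of "{y}"] by auto
    have nE: "\<not> indep M {x, y}" using indep_iff_rk[OF M order_refl] 5 xy by simp
    have "indep M X \<longleftrightarrow> X \<subseteq> {x, y} \<and> X \<noteq> {x, y}" for X
    proof (cases "X \<subseteq> {x, y}")
      case True
      then have "X = {} \<or> X = {x} \<or> X = {y} \<or> X = {x, y}" by auto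
      then show ?thesis using ix nE indep_empty[OF M] xy(2) by auto
    qed (use indep_ground[OF M] xy in auto)
    then have "has_minor_iso AG42 M" by (rule U12_minor_AG42[OF xy])
    then show ?thesis using 5 by blast
  qed
qed

theorem theorem1p3:
  fixes M :: "'a matroid"
  assumes "matroid M"
  shows "(three_connected M \<and> binary M \<and> two_two_uniform M) \<longleftrightarrow>
         (three_connected M \<and>
           (has_minor_iso Z5_del_t M \<or> has_minor_iso P10 M \<or>
            has_minor_iso AG42 M \<or> has_minor_iso (dual AG42) M))"
proof -
  note M = assms
  note D = matroid_dual[OF M] and E = matroid_finite[OF M]
  have backward: "binary M \<and> two_two_uniform M"
    if "matroid N" "binary N" "\<nexists>X. crowded N X" "has_minor_iso N M" for N :: "nat matroid"
    using binary_minor[OF M that(1,2,4)] not_crowded_minor[OF M that(1,4,3)] two_two_uniform_iff[OF M] by blast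
  have max: "matroid Z5_del_t" "binary Z5_del_t" "matroid P10" "binary P10"
    unfolding Z5_vec P10_def by (simp_all add: matroid_vec binary_vec)
  have dAG: "matroid (dual AG42)" "binary (dual AG42)" "\<nexists>X. crowded (dual AG42) X"
    using matroid_dual[OF matroid_AG42] binary_dual[OF matroid_AG42 binary_AG42]
      crowded_dual[OF matroid_AG42] not_crowded_AG42 by blast+
  have forward: "has_minor_iso Z5_del_t M \<or> has_minor_iso P10 M \<or> has_minor_iso AG42 M \<or> has_minor_iso (dual AG42) M"
    if c: "three_connected M" and b: "binary M" and u: "two_two_uniform M"
  proof -
    let ?E = "ground M" and ?r = "rk M (ground M)"
    have uM: "\<nexists>X. crowded M X" using u two_two_uniform_iff[OF M] by blast
    then have uD: "\<nexists>X. crowded (dual M) X" using crowded_dual[OF M] by blast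
    have bD: "binary (dual M)" by (rule binary_dual[OF M b])
    have rd: "rk (dual M) ?E + ?r = card ?E" using rk_dual[OF M order_refl] by (simp add: rk_empty[OF M])
    have dual: "has_minor_iso AG42 (dual M) \<Longrightarrow> has_minor_iso (dual AG42) M"
      by (rule has_minor_iso_dual[OF M matroid_AG42])
    show ?thesis
    proof (cases "card ?E \<le> 3")
      case True
      then have "?r \<le> 4" "rk (dual M) (ground (dual M)) \<le> 4" using rd by auto
      then show ?thesis
        using three_connected_tiny[OF M c True] rank4_minor_AG42[OF M b] rank4_minor_AG42[OF D bD] dual by blast
    next
      case False
      have sM: "simple M" and sD: "simple (dual M)"
        using three_connected_simple[OF M c] three_connected_simple[OF D three_connected_dual[OF M c]] False by auto
      \<comment> \<open>Rank against corank, the latter as the rank of the dual. The sum of the two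
        is the number of elements, so the mixed cases 5 and at least 6 have at least 11 elements and
        are excluded by \<open>rank5_affine\<close>.\<close>
      consider "?r \<le> 4" | "rk (dual M) ?E \<le> 4" | "?r = 5" "affine M" | "rk (dual M) ?E = 5" "affine (dual M)"
        | "?r = 5" "rk (dual M) ?E = 5" "\<not> affine M" "\<not> affine (dual M)"
        | "?r = 5" "\<not> affine M" "rk (dual M) ?E \<ge> 6" | "rk (dual M) ?E = 5" "\<not> affine (dual M)" "?r \<ge> 6"
        | "?r \<ge> 6" "rk (dual M) ?E \<ge> 6"
        by linarith
      then show ?thesis
      proof cases
        case 1
        then show ?thesis using rank4_minor_AG42[OF M b sM] by blast
      next
        case 2
        then show ?thesis using rank4_minor_AG42[OF D bD sD] dual by simp
      next
        case 3
        then show ?thesis using affine_rank5_minor_AG42[OF M b sM] by blast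
      next
        case 4
        then show ?thesis using affine_rank5_minor_AG42[OF D bD sD] dual by simp
      next
        case 5
        obtain v where v: "M = vec_matroid ?E v" using b by (auto simp: binary_def)
        have "has_minor_iso Z5_del_t (vec_matroid ?E v) \<or> has_minor_iso P10 (vec_matroid ?E v)"
          by (rule rank5_nonaffine(2)[OF E]) (use v 5 sM sD uM rd in simp_all)
        then show ?thesis unfolding v[symmetric] by blast
      next
        case 6
        then show ?thesis using rank5_affine[OF M b _ uM] rd by simp
      next
        case 7
        then show ?thesis using rank5_affine[OF D bD _ uD] rd by simp
      next
        case 8
        then show ?thesis using no_large_rank_corank[OF M b sM uM] rd by simp
      qed
    qed
  qed
  show ?thesis
    using forward backward[OF max(1,2)] backward[OF max(3,4)] backward[OF matroid_AG42 binary_AG42] backward[OF dAG]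
      not_crowded_Z5 not_crowded_P10 not_crowded_AG42 by blast
qed

end
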